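(* Consider the nonlinear dynamic program and the AOTD algorithm described in the context. Suppose the reduced-Hessian lower bound, uniform controllability, uniform boundedness, compactness/smoothness, vanishing Hessian modification, and local Lipschitz assumptions (all spelled out in the context) hold, with $\mu\ge\bar\mu:=32\,\Upsilon_{\rm Upper}^{4t_C+1}/\gamma_C$. Suppose also that the full primal–dual sequence $\{(\bm z^\tau,\bm\lambda^\tau)\}$ generated by AOTD is infinite and converges to a KKT pair $(\bm z^\ast,\bm\lambda^\ast)$ where $\bm z^\ast$ is a strict local minimizer of the problem. Let $\epsilon^{\bar\tau}\in(0,1)$ be the frozen (eventually constant) value of the accuracy tolerance $\epsilon^\tau$, i.e. $\epsilon^\tau=\epsilon^{\bar\tau}$ for all $\tau\ge\bar\tau$. Then, for every $\varphi\in(0,\,1/\epsilon^{\bar\tau}-1)$ and all sufficiently large $\tau$, $$\big\|(\bm z^{\tau+1}-\bm z^\ast,\ \bm\lambda^{\tau+1}-\bm\lambda^\ast)\big\|\le(1+\varphi)\,\epsilon^{\bar\tau}\,\big\|(\bm z^{\tau}-\bm z^\ast,\ \bm\lambda^{\tau}-\bm\lambda^\ast)\big\|,$$ so the iterates converge linearly with rate $(1+\varphi)\epsilon^{\bar\tau}<1$.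
   Context: **Notation.** $\|\cdot\|$ is the Euclidean norm of vectors and spectral norm of matrices; $\sigma_{\min}$ is the smallest singular value; $\mathbb I$ the identity; $(\bm x;\bm y)$ vertical concatenation. Stages are indexed by subscripts, iterations by superscripts $\tau$. **Problem.** Integers $N,n_x,n_u\ge1$, $\bar{\bm x}_0\in\mathbb R^{n_x}$, functions $g_k:\mathbb R^{n_x}\times\mathbb R^{n_u}\to\mathbb R$, $f_k:\mathbb R^{n_x}\times\mathbb R^{n_u}\to\mathbb R^{n_x}$ ($0\le k\le N-1$), $g_N:\mathbb R^{n_x}\to\mathbb R$. The problem is to minimize $\sum_{k=0}^{N-1}g_k(\bm x_k,\bm u_k)+g_N(\bm x_N)$ subject to $\bm x_0=\bar{\bm x}_0$, $\bm x_{k+1}=f_k(\bm x_k,\bm u_k)$. Put $\bm z_k=(\bm x_k;\bm u_k)$ for $k<N$, $\bm z_N=\bm x_N$, $\bm z=(\bm z_0;\dots;\bm z_N)$; $g(\bm z)$ is the total cost, $f(\bm z)=(\bm x_0-\bar{\bm x}_0;\ \bm x_1-f_0(\bm x_0,\bm u_0);\dots;\bm x_N-f_{N-1}(\bm x_{N-1},\bm u_{N-1}))$, $\bm\lambda=(\bm\lambda_0;\dots;\bm\lambda_N)$ with $\bm\lambda_k\in\mathbb R^{n_x}$, $\mathcal L(\bm z,\bm\lambda)=g(\bm z)+\bm\lambda^Tf(\bm z)$, $\nabla\mathcal L=(\nabla_{\bm z}\mathcal L;\nabla_{\bm\lambda}\mathcal L)$. A KKT pair is a zero of $\nabla\mathcal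 L$. A superscript $\tau$ denotes evaluation at $(\bm z^\tau,\bm\lambda^\tau)$. $A_k,B_k$ are the Jacobians of $f_k$ in $\bm x_k,\bm u_k$; $G$ is the Jacobian of $f$; $H=\nabla^2_{\bm z}\mathcal L=\mathrm{diag}(H_0,\dots,H_N)$, where $H_k$ depends on $(\bm z_k,\bm\lambda_{k+1})$ for $k<N$ and $H_N$ on $\bm z_N$. $\hat H^\tau=\mathrm{diag}(\hat H_0^\tau,\dots,\hat H_N^\tau)$ is a symmetric modification of $H^\tau$ with the same block structure, $\hat H_k^\tau=\begin{pmatrix}\hat Q_k&\hat S_k^T\\ \hat S_k&\hat R_k\end{pmatrix}$ ($k<N$), $\hat H_N^\tau=\hat Q_N$, with $\hat H^\tau=H^\tau$ whenever $H^\tau$ itself satisfies the reduced-Hessian lower bound below. $\Gamma^\tau=\begin{pmatrix}\hat H^\tau&(G^\tau)^T\\ G^\tau&\bm0\end{pmatrix}$. The exact Newton direction $(\Delta\bm z^\tau,\Delta\bm\lambda^\tau)$ solves $\Gamma^\tau(\Delta\bm z^\tau;\Delta\bm\lambda^\tau)=-\nabla\mathcal L^\tau$. **Merit function.** For $\bm\eta=(\eta_1,\eta_2)$ positive, $\mathcal L_{\bm\eta}=\mathcal L+\frac{\eta_1}2\|\nabla_{\bm\lambda}\mathcal L\|^2+\frac{\eta_2}2\|\nabla_{\bm z}\mathcal L\|^2$; $\mathcal L^\tau_{\bm\eta}=\mathcal L_{\bm\eta}(\bm z^\tau,\bm\lambda^\tau)$. **Decomposition.** $M\in\{1,\dots,N\}$,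 knots $0=n_0<\dots<n_M=N$, cores $\mathcal K_i=\{n_i,\dots,n_{i+1}-1\}$ for $i<M-1$ and $\mathcal K_{M-1}=\{n_{M-1},\dots,N\}$. Given nominal overlap $b_i\in\mathbb Z_{\ge1}$, subproblem $i\in\{0,\dots,M-1\}$ has window $[m_1,m_2]$, $m_1=m_1^i=\max\{n_i-b_i,0\}$, $m_2=m_2^i=\min\{n_{i+1}+b_i,N\}$. With a fixed $\mu>0$, the local quadratic program at iteration $\tau$, in $\bm p_k\in\mathbb R^{n_x}$ ($m_1\le k\le m_2$), $\bm q_k\in\mathbb R^{n_u}$ ($m_1\le k<m_2$), minimizes $$\sum_{k=m_1}^{m_2-1}\Big\{\tfrac12\begin{pmatrix}\bm p_k\\\bm q_k\end{pmatrix}^T\hat H_k^\tau\begin{pmatrix}\bm p_k\\\bm q_k\end{pmatrix}+(\nabla_{\bm x_k}\mathcal L^\tau)^T\bm p_k+(\nabla_{\bm u_k}\mathcal L^\tau)^T\bm q_k\Big\}+\tfrac12\bm p_{m_2}^T\hat H_{\rm T}\bm p_{m_2}+(\nabla_{\bm x_{m_2}}\mathcal L^\tau)^T\bm p_{m_2},$$ $\hat H_{\rm T}=\hat Q_{m_2}+\mu\mathbb I$ if $m_2<N$ and $\hat Q_N$ if $m_2=N$, subject to $\bm p_{m_1}=\bm d_1$ and $\bm p_{k+1}=A_k^\tau\bm p_k+B_k^\tau\bm q_k-\nabla_{\bm\lambda_{k+1}}\mathcal L^\tau$ for $m_1\le k<m_2$, where $\bm d_1=\bar{\bm x}_0-\bm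 x_0^\tau$ if $m_1=0$ and $\bm d_1=\bm0$ otherwise. Let $\tilde{\bm\omega}$ stack the $\bm p_k,\bm q_k$ and $\tilde{\bm\zeta}=(\bm\zeta_{m_1};\dots;\bm\zeta_{m_2})$ stack the multipliers (Lagrangian = objective $+\bm\zeta_{m_1}^T(\bm p_{m_1}-\bm d_1)+\sum_k\bm\zeta_{k+1}^T(\bm p_{k+1}-A_k^\tau\bm p_k-B_k^\tau\bm q_k+\nabla_{\bm\lambda_{k+1}}\mathcal L^\tau)$). The KKT system is $\Gamma_i^\tau(\tilde{\bm\omega};\tilde{\bm\zeta})=-\nabla\mathcal L^{(i),\tau}_{\rm QP}$, where $\nabla\mathcal L^{(i),\tau}_{\rm QP}$ is the gradient of this Lagrangian at $(\bm0,\bm0)$ and $\Gamma_i^\tau$ its Hessian. A local solve with tolerance $\epsilon_i^\tau>0$ returns any $(\Delta\tilde{\bm\omega}_i,\Delta\tilde{\bm\zeta}_i)$ with $$\big\|\Gamma_i^\tau(\Delta\tilde{\bm\omega}_i;\Delta\tilde{\bm\zeta}_i)+\nabla\mathcal L^{(i),\tau}_{\rm QP}\big\|\le\epsilon_i^\tau\|\nabla\mathcal L^{(i),\tau}_{\rm QP}\|\quad\text{(local residual condition)};$$ local solvers are assumed to achieve this for any $\epsilon_i^\tau>0$ in finitely many iterations (almost surely if randomized). The composed direction $(\Delta\tilde{\bm z},\Delta\tilde{\bm\lambda})$ takes its stage-$k$ primal and dual components from local solution $i$ whenever $k\in\mathcal K_i$ (dual increments being the $\bm\zeta_k$). **Tests.**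 $\bm r=\Gamma^\tau(\Delta\tilde{\bm z};\Delta\tilde{\bm\lambda})+\nabla\mathcal L^\tau$, and $\bm r_i$ its restriction to $\mathcal K_i$. Accuracy condition: $\|\bm r\|\le\epsilon^\tau\|\nabla\mathcal L^\tau\|/(\|\Gamma^\tau\|\Psi^\tau)$ with $\Psi^\tau=\dfrac{20\max(\|\hat H^\tau\|^2,1)}{\min\{\gamma_{\rm RH},1\}\min\{\sigma_{\min}(G^\tau)^2,1\}}$. Descent condition: $(\nabla\mathcal L^\tau_{\bm\eta^\tau})^T(\Delta\tilde{\bm z};\Delta\tilde{\bm\lambda})\le-\eta_2^\tau\|\nabla\mathcal L^\tau\|^2/2$. Cap: $\epsilon^\tau_{\max}=\dfrac{(0.5-\beta)\eta_2^\tau}{(1+\eta_1^\tau+\eta_2^\tau)(\Psi^\tau\Upsilon^\tau)^2}$, $\Upsilon^\tau=\max\{\|G^\tau\|,\|\hat H^\tau\|,1\}$. **AOTD algorithm.** Inputs: $(\bm z^0,\bm\lambda^0)$, $\eta_1^0,\eta_2^0,\epsilon^0,\epsilon_i^0>0$, $b_i^0\in\mathbb Z_{\ge1}$, $\beta\in(0,0.5)$, $\delta\in(0,1)$, $\varrho_b,\varrho_\epsilon>0$, $\nu>1$, $\mu>0$, $\mathrm{tol}_{\rm KKT}\ge0$. For $\tau=0,1,2,\dots$: (i) if $\|\nabla\mathcal L^\tau\|\le\mathrm{tol}_{\rm KKT}$, return. (ii) If $\epsilon^\tau>\epsilon^\tau_{\max}$, set $\epsilon^\tau\gets\epsilon^\tau_{\max}/\nu$.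 Set the direction to $\bm0$. (iii) While the accuracy or the descent condition fails: [accuracy loop] while accuracy fails, perform all local solves with current $b_i^\tau,\epsilon_i^\tau$, compose, and, if accuracy still fails, update for all $i$ $$\epsilon_i^\tau\gets\epsilon_i^\tau\exp\!\Big(-\varrho_\epsilon\Big[\tfrac{\|\bm r_i\|}{\|\bm r\|}+\tfrac1{\sqrt M}\Big]\Big),\qquad b_i^\tau\gets b_i^\tau+\max\Big\{1,\Big\lceil\varrho_b\tfrac{\|\bm r_i\|}{\|\bm r\|}\Big\rceil\Big\};$$ then, if descent fails, set $\eta_1^\tau\gets\nu^2\eta_1^\tau$, $\eta_2^\tau\gets\eta_2^\tau/\nu$, recompute $\epsilon^\tau_{\max}$, and set $\epsilon^\tau\gets\min\{\epsilon^\tau_{\max},\epsilon^\tau/\nu^4\}$. (iv) Accept the direction as $(\Delta\tilde{\bm z}^\tau,\Delta\tilde{\bm\lambda}^\tau)$; backtrack $\alpha^\tau=1,\delta,\delta^2,\dots$ until the Armijo condition $\mathcal L_{\bm\eta^\tau}((\bm z^\tau;\bm\lambda^\tau)+\alpha^\tau(\Delta\tilde{\bm z}^\tau;\Delta\tilde{\bm\lambda}^\tau))\le\mathcal L^\tau_{\bm\eta^\tau}+\alpha^\tau\beta(\nabla\mathcal L^\tau_{\bm\eta^\tau})^T(\Delta\tilde{\bm z}^\tau;\Delta\tilde{\bm\lambda}^\tau)$ holds; set $(\bm z^{\tau+1};\bm\lambda^{\tau+1})=(\bm z^\tau;\bm\lambda^\tau)+\alpha^\tau(\Delta\tilde{\bm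 z}^\tau;\Delta\tilde{\bm\lambda}^\tau)$; carry $\eta_1^\tau,\eta_2^\tau,\epsilon^\tau,\epsilon_i^\tau,b_i^\tau$ to iteration $\tau+1$. Superscript-$\tau$ parameters without further comment are those in force when the step of iteration $\tau$ is accepted. The paper proves, under the first four assumptions below and $\mu\ge\bar\mu$, that there is a finite $\bar\tau$ such that all adaptive parameters are constant for $\tau\ge\bar\tau$ and $\epsilon^{\bar\tau}\in(0,1)$; this is the frozen tolerance in the claim. **Assumptions** (constants independent of $\tau$). *Reduced-Hessian lower bound:* there is $\gamma_{\rm RH}>0$ (the constant used in $\Psi^\tau$) with $(Z^\tau)^T\hat H^\tau Z^\tau\succeq\gamma_{\rm RH}\mathbb I$ for all $\tau\ge0$, where the columns of $Z^\tau$ form an orthonormal basis of $\ker G^\tau$. *Uniform controllability:* there are $\gamma_C\in(0,1]$ and $t_C\in\{1,\dots,N\}$ such that for all $\tau\ge0$ and $0\le k\le N-t_C$ there is an integer $t=t_k^\tau\in[1,t_C]$ with $\Xi\Xi^T\succeq\gamma_C\mathbb I$, $\Xi=[B_{k+t-1},\ A_{k+t-1}B_{k+t-2},\ \dots,\ A_{k+t-1}\cdots A_{k+1}B_k]$ evaluated at $\bm z^\tau$. *Uniform boundedness:* there is $\Upsilon_{\rm Upper}\ge2$ with $\|\hat H_k^\tau\|,\|A_k^\tau\|,\|B_k^\tau\|\le\Upsilon_{\rm Upper}$ for $0\le k\le N-1$ and $\|\hat H_N^\tau\|\le\Upsilon_{\rm Upper}$, all $\tau\ge0$. *Compactness/smoothness:*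 there is a compact set $\mathcal Z\times\Lambda$, $\mathcal Z=\mathcal Z_0\times\dots\times\mathcal Z_N$, $\Lambda=\Lambda_0\times\dots\times\Lambda_N$, containing $(\bm z^\tau+\alpha\Delta\tilde{\bm z}^\tau,\bm\lambda^\tau+\alpha\Delta\tilde{\bm\lambda}^\tau)$ for all $\tau\ge0$, $\alpha\in[0,1]$; $g_k,g_N,f_k$ are three times continuously differentiable; and for $0\le k\le N-1$, $\sup_{\mathcal Z_k\times\Lambda_{k+1}}\|H_k\|$, $\sup_{\mathcal Z_k}\|A_k\|$, $\sup_{\mathcal Z_k}\|B_k\|$, and $\sup_{\mathcal Z_N}\|H_N\|$ are all $\le\Upsilon_{\rm Upper}$ (same constant). *Vanishing Hessian modification:* $\|H^\tau-\hat H^\tau\|=o(1)$ as $\tau\to\infty$. *Local Lipschitz continuity:* there are an open neighborhood $\mathcal U$ of $(\bm z^\ast,\bm\lambda^\ast)$ and $\Upsilon_L>0$, independent of $k$, such that for all $(\bm z,\bm\lambda),(\bm z',\bm\lambda')\in\mathcal U$ and $0\le k\le N-1$: $\max\{\|A_k(\bm z_k)-A_k(\bm z_k')\|,\|B_k(\bm z_k)-B_k(\bm z_k')\|\}\le\Upsilon_L\|\bm z_k-\bm z_k'\|$, $\|H_k(\bm z_k,\bm\lambda_{k+1})-H_k(\bm z_k',\bm\lambda_{k+1}')\|\le\Upsilon_L\|(\bm z_k-\bm z_k';\bm\lambda_{k+1}-\bm\lambda'_{k+1})\|$, and $\|H_N(\bm z_N)-H_N(\bm z_N')\|\le\Upsilon_L\|\bm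 z_N-\bm z_N'\|$. *)

theory Defs
  imports "HOL-Analysis.Analysis"
begin

section \<open>Calculus and linear algebra\<close>

definition grad :: "('a::real_inner \<Rightarrow> real) \<Rightarrow> 'a \<Rightarrow> 'a" where
  "grad f x = (SOME D. GDERIV f x :> D)"

definition C3 :: "('a::real_normed_vector \<Rightarrow> 'b::real_normed_vector) \<Rightarrow> bool" where
  "C3 f \<longleftrightarrow>
    (\<exists>(D1 :: 'a \<Rightarrow> 'a \<Rightarrow>\<^sub>L 'b)
      (D2 :: 'a \<Rightarrow> 'a \<Rightarrow>\<^sub>L 'a \<Rightarrow>\<^sub>L 'b)
      (D3 :: 'a \<Rightarrow> 'a \<Rightarrow>\<^sub>L 'a \<Rightarrow>\<^sub>L 'a \<Rightarrow>\<^sub>L 'b).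
      (\<forall>x. (f has_derivative blinfun_apply (D1 x)) (at x)) \<and>
      (\<forall>x. (D1 has_derivative blinfun_apply (D2 x)) (at x)) \<and>
      (\<forall>x. (D2 has_derivative blinfun_apply (D3 x)) (at x)) \<and>
      continuous_on UNIV D3)"

text \<open>For a linear map whose codomain is of no larger dimension than its domain (such as the
  constraint Jacobian below), the singular values are the square roots of the eigenvalues of
  \<open>T T\<^sup>T\<close>. There are finitely many, so the infimum is a minimum. The spectral norm is
  \<^const>\<open>onorm\<close>.\<close>

definition sigma_min :: "('a::euclidean_space \<Rightarrow> 'b::euclidean_space) \<Rightarrow> real" where
  "sigma_min T = Inf {s. 0 \<le> s \<and> (\<exists>v. v \<noteq> 0 \<and> T (adjoint T v) = s\<^sup>2 *\<^sub>R v)}"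

definition orthonormal_basis_of :: "'a::euclidean_space set \<Rightarrow> 'a set \<Rightarrow> bool" where
  "orthonormal_basis_of B S \<longleftrightarrow> pairwise orthogonal B \<and> (\<forall>b\<in>B. norm b = 1) \<and> span B = S"

text \<open>\<open>Z\<^sup>T T Z \<succeq> \<gamma> I\<close>, where the columns of \<open>Z\<close> are an orthonormal basis \<open>B\<close> of the kernel of
  \<open>G\<close>; the entries of \<open>Z\<^sup>T T Z\<close> are \<open>b \<bullet> T b'\<close> for \<open>b, b' \<in> B\<close>, and \<open>c\<close> is a coefficient vector.\<close>

definition reduced_ge ::
  "('a::euclidean_space \<Rightarrow> 'a) \<Rightarrow> ('a \<Rightarrow> 'b::real_vector) \<Rightarrow> real \<Rightarrow> bool" where
  "reduced_ge T G \<gamma> \<longleftrightarrow>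
    (\<forall>B. orthonormal_basis_of B {v. G v = 0} \<longrightarrow>
      (\<forall>c :: 'a \<Rightarrow> real.
        \<gamma> * (\<Sum>b\<in>B. (c b)\<^sup>2) \<le> (\<Sum>b\<in>B. \<Sum>b'\<in>B. c b * (b \<bullet> T b') * c b')))"

definition loewner_ge :: "real^'m^'m \<Rightarrow> real \<Rightarrow> bool" where
  "loewner_ge A \<gamma> \<longleftrightarrow> (\<forall>v. \<gamma> * (v \<bullet> v) \<le> v \<bullet> (A *v v))"

abbreviation spec_norm :: "real^'m^'k \<Rightarrow> real" where
  "spec_norm A \<equiv> onorm (\<lambda>v. A *v v)"


section \<open>Trajectories\<close>

text \<open>The horizon is \<open>N = CARD('n)\<close>, which ranges over all positive integers. Stages
  \<open>0, \<dots>, N - 1\<close> are identified with the elements of \<open>'n\<close> through an arbitrary fixed enumeration;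
  nothing depends on its choice. A primal vector is \<open>((z\<^sub>0, \<dots>, z\<^sub>N\<^sub>-\<^sub>1), x\<^sub>N)\<close> with
  \<open>z\<^sub>k = (x\<^sub>k, u\<^sub>k)\<close>, a dual vector is \<open>((\<lambda>\<^sub>0, \<dots>, \<lambda>\<^sub>N\<^sub>-\<^sub>1), \<lambda>\<^sub>N)\<close>. The library norms on these
  types are the Euclidean norms of the stacked vectors.\<close>

type_synonym ('x, 'u) pair = "(real^'x) \<times> (real^'u)"
type_synonym ('n, 'x, 'u) prim = "(('x, 'u) pair^'n) \<times> (real^'x)"
type_synonym ('n, 'x) dual = "((real^'x)^'n) \<times> (real^'x)"
type_synonym ('n, 'x, 'u) pd = "('n, 'x, 'u) prim \<times> ('n, 'x) dual"

definition stg :: "nat \<Rightarrow> 'n::finite" where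
  "stg k = from_nat_into UNIV k"

definition idx :: "'n::finite \<Rightarrow> nat" where
  "idx i = to_nat_on UNIV i"

lemma idx_less: "idx (i::'n::finite) < CARD('n)"
  using to_nat_on_finite[of "UNIV::'n set"] by (auto simp: idx_def bij_betw_def)

lemma stg_idx [simp]: "stg (idx i) = i"
  by (simp add: stg_def idx_def)

lemma idx_stg [simp]: "k < CARD('n) \<Longrightarrow> idx (stg k :: 'n::finite) = k"
  using to_nat_on_finite[of "UNIV::'n set"]
  by (auto simp: stg_def idx_def bij_betw_def intro!: to_nat_on_from_nat_into)

text \<open>\<open>stage_z\<close> and \<open>ctrl\<close> are meaningful for \<open>k < N\<close>, \<open>state\<close> and \<open>mult\<close> for \<open>k \<le> N\<close>.\<close>

definition stage_z :: "('n::finite, 'x::finite, 'u::finite) prim \<Rightarrow> nat \<Rightarrow> ('x, 'u) pair" where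
  "stage_z z k = fst z $ stg k"

definition state :: "('n::finite, 'x::finite, 'u::finite) prim \<Rightarrow> nat \<Rightarrow> real^'x" where
  "state z k = (if k < CARD('n) then fst (stage_z z k) else snd z)"

definition ctrl :: "('n::finite, 'x::finite, 'u::finite) prim \<Rightarrow> nat \<Rightarrow> real^'u" where
  "ctrl z k = snd (stage_z z k)"

definition mult :: "('n::finite, 'x::finite) dual \<Rightarrow> nat \<Rightarrow> real^'x" where
  "mult l k = (if k < CARD('n) then fst l $ stg k else snd l)"

definition mk_prim :: "(nat \<Rightarrow> real^'x) \<Rightarrow> (nat \<Rightarrow> real^'u) \<Rightarrow> ('n::finite, 'x, 'u) prim" where
  "mk_prim X U = ((\<chi> i. (X (idx i), U (idx i))), X CARD('n))"

definition mk_dual :: "(nat \<Rightarrow> real^'x) \<Rightarrow> ('n::finite, 'x) dual" where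
  "mk_dual X = ((\<chi> i. X (idx i)), X CARD('n))"

lemma state_mk_prim [simp]:
  "k \<le> CARD('n) \<Longrightarrow> state (mk_prim X U :: ('n::finite, 'x::finite, 'u::finite) prim) k = X k"
  by (auto simp: state_def stage_z_def mk_prim_def)

lemma ctrl_mk_prim [simp]:
  "k < CARD('n) \<Longrightarrow> ctrl (mk_prim X U :: ('n::finite, 'x::finite, 'u::finite) prim) k = U k"
  by (auto simp: ctrl_def stage_z_def mk_prim_def)

lemma mult_mk_dual [simp]:
  "k \<le> CARD('n) \<Longrightarrow> mult (mk_dual X :: ('n::finite, 'x::finite) dual) k = X k"
  by (auto simp: mult_def mk_dual_def)


section \<open>The nonlinear dynamic program\<close>

record ('x, 'u) ocp =
  stage_cost :: "nat \<Rightarrow> (real^'x::finite) \<times> (real^'u::finite) \<Rightarrow> real"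
  term_cost :: "real^'x \<Rightarrow> real"
  dynamics :: "nat \<Rightarrow> (real^'x) \<times> (real^'u) \<Rightarrow> real^'x"
  init_state :: "real^'x"

definition total_cost :: "('x::finite, 'u::finite) ocp \<Rightarrow> ('n::finite, 'x, 'u) prim \<Rightarrow> real" where
  "total_cost P z = (\<Sum>k<CARD('n). stage_cost P k (stage_z z k)) + term_cost P (state z CARD('n))"

definition constr :: "('x::finite, 'u::finite) ocp \<Rightarrow> ('n::finite, 'x, 'u) prim \<Rightarrow> ('n, 'x) dual" where
  "constr P z = mk_dual (\<lambda>k. if k = 0 then state z 0 - init_state P
     else state z k - dynamics P (k - 1) (stage_z z (k - 1)))"

definition strict_local_min :: "('x::finite, 'u::finite) ocp \<Rightarrow> ('n::finite, 'x, 'u) prim \<Rightarrow> bool" where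
  "strict_local_min P z \<longleftrightarrow> constr P z = 0 \<and>
    (\<exists>e>0. \<forall>y\<in>ball z e. constr P y = 0 \<and> y \<noteq> z \<longrightarrow> total_cost P z < total_cost P y)"

definition lagr :: "('x::finite, 'u::finite) ocp \<Rightarrow> ('n::finite, 'x, 'u) pd \<Rightarrow> real" where
  "lagr P w = total_cost P (fst w) + snd w \<bullet> constr P (fst w)"

definition grad_z :: "('x::finite, 'u::finite) ocp \<Rightarrow> ('n::finite, 'x, 'u) pd \<Rightarrow> ('n, 'x, 'u) prim" where
  "grad_z P w = grad (\<lambda>z. lagr P (z, snd w)) (fst w)"

definition grad_l :: "('x::finite, 'u::finite) ocp \<Rightarrow> ('n::finite, 'x, 'u) pd \<Rightarrow> ('n, 'x) dual" where
  "grad_l P w = grad (\<lambda>l. lagr P (fst w, l)) (snd w)"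

definition grad_lagr :: "('x::finite, 'u::finite) ocp \<Rightarrow> ('n::finite, 'x, 'u) pd \<Rightarrow> ('n, 'x, 'u) pd" where
  "grad_lagr P w = (grad_z P w, grad_l P w)"

definition kkt_pair :: "('x::finite, 'u::finite) ocp \<Rightarrow> ('n::finite, 'x, 'u) pd \<Rightarrow> bool" where
  "kkt_pair P w \<longleftrightarrow> grad_lagr P w = 0"

definition jac_A :: "('x::finite, 'u::finite) ocp \<Rightarrow> nat \<Rightarrow> ('x, 'u) pair \<Rightarrow> real^'x^'x" where
  "jac_A P k v = jacobian (\<lambda>x. dynamics P k (x, snd v)) (at (fst v))"

definition jac_B :: "('x::finite, 'u::finite) ocp \<Rightarrow> nat \<Rightarrow> ('x, 'u) pair \<Rightarrow> real^'u^'x" where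
  "jac_B P k v = jacobian (\<lambda>u. dynamics P k (fst v, u)) (at (snd v))"

definition jac_G ::
  "('x::finite, 'u::finite) ocp \<Rightarrow> ('n::finite, 'x, 'u) pd \<Rightarrow> ('n, 'x, 'u) prim \<Rightarrow> ('n, 'x) dual" where
  "jac_G P w = frechet_derivative (constr P) (at (fst w))"

definition hess ::
  "('x::finite, 'u::finite) ocp \<Rightarrow> ('n::finite, 'x, 'u) pd \<Rightarrow> ('n, 'x, 'u) prim \<Rightarrow> ('n, 'x, 'u) prim" where
  "hess P w = frechet_derivative (\<lambda>z. grad_z P (z, snd w)) (at (fst w))"

text \<open>Diagonal blocks \<open>H\<^sub>k\<close> (\<open>k < N\<close>) and \<open>H\<^sub>N\<close> of \<^const>\<open>hess\<close>.\<close>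

definition hess_blk ::
  "('x::finite, 'u::finite) ocp \<Rightarrow> nat \<Rightarrow> ('n::finite, 'x, 'u) pd \<Rightarrow> ('x, 'u) pair \<Rightarrow> ('x, 'u) pair" where
  "hess_blk P k w v = stage_z (hess P w (axis (stg k) v, 0)) k"

definition hess_blk_N ::
  "('x::finite, 'u::finite) ocp \<Rightarrow> ('n::finite, 'x, 'u) pd \<Rightarrow> real^'x \<Rightarrow> real^'x" where
  "hess_blk_N P w v = snd (hess P w (0, v))"

definition merit ::
  "('x::finite, 'u::finite) ocp \<Rightarrow> real \<Rightarrow> real \<Rightarrow> ('n::finite, 'x, 'u) pd \<Rightarrow> real" where
  "merit P \<eta>1 \<eta>2 w =
    lagr P w + \<eta>1 / 2 * (norm (grad_l P w))\<^sup>2 + \<eta>2 / 2 * (norm (grad_z P w))\<^sup>2"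


section \<open>The modified Hessian\<close>

text \<open>\<open>Q\<close> is used for \<open>k \<le> N\<close> (with \<open>Q\<close> at \<open>N\<close> being the whole last block), \<open>S\<close> and \<open>R\<close> for
  \<open>k < N\<close>.\<close>

record ('x, 'u) hmod =
  hQ :: "nat \<Rightarrow> real^'x::finite^'x"
  hS :: "nat \<Rightarrow> real^'x^'u::finite"
  hR :: "nat \<Rightarrow> real^'u^'u"

definition hat_blk ::
  "('x::finite, 'u::finite) hmod \<Rightarrow> nat \<Rightarrow> ('x, 'u) pair \<Rightarrow> ('x, 'u) pair" where
  "hat_blk W k v =
    (hQ W k *v fst v + transpose (hS W k) *v snd v, hS W k *v fst v + hR W k *v snd v)"

definition hat_hess ::
  "('x::finite, 'u::finite) hmod \<Rightarrow> ('n::finite, 'x, 'u) prim \<Rightarrow> ('n, 'x, 'u) prim" where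
  "hat_hess W z = ((\<chi> i. hat_blk W (idx i) (fst z $ i)), hQ W CARD('n) *v snd z)"

text \<open>A symmetric modification of the Hessian at \<open>w\<close>, which leaves the Hessian unchanged if it
  already satisfies the reduced-Hessian lower bound.\<close>

definition hess_modification ::
  "('x::finite, 'u::finite) ocp \<Rightarrow> real \<Rightarrow> ('n::finite, 'x, 'u) pd \<Rightarrow> ('x, 'u) hmod \<Rightarrow> bool" where
  "hess_modification P \<gamma> w W \<longleftrightarrow>
    (\<forall>k\<le>CARD('n). transpose (hQ W k) = hQ W k) \<and>
    (\<forall>k<CARD('n). transpose (hR W k) = hR W k) \<and>
    (reduced_ge (hess P w) (jac_G P w) \<gamma> \<longrightarrow> hat_hess W = hess P w)"

definition kkt_mat ::
  "('x::finite, 'u::finite) ocp \<Rightarrow> ('x, 'u) hmod \<Rightarrow> ('n::finite, 'x, 'u) pd \<Rightarrow>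
    ('n, 'x, 'u) pd \<Rightarrow> ('n, 'x, 'u) pd" where
  "kkt_mat P W w d =
    (hat_hess W (fst d) + adjoint (jac_G P w) (snd d), jac_G P w (fst d))"


section \<open>Decomposition and local subproblems\<close>

text \<open>Fixed inputs of the algorithm. \<open>gam\<close> is the reduced-Hessian constant entering \<open>\<Psi>\<close>,
  \<open>nsub\<close> is the number \<open>M\<close> of subproblems.\<close>

record params =
  nsub :: nat
  knot :: "nat \<Rightarrow> nat"
  gam :: real
  beta :: real
  delta :: real
  rho_b :: real
  rho_eps :: real
  nu :: real
  mu :: real
  tol_kkt :: real

definition valid_params :: "nat \<Rightarrow> params \<Rightarrow> bool" where
  "valid_params N a \<longleftrightarrow>
    1 \<le> nsub a \<and> nsub a \<le> N \<and>
    knot a 0 = 0 \<and> knot a (nsub a) = N \<and> (\<forall>i<nsub a. knot a i < knot a (Suc i)) \<and>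
    0 < gam a \<and> 0 < beta a \<and> beta a < 1/2 \<and> 0 < delta a \<and> delta a < 1 \<and>
    0 < rho_b a \<and> 0 < rho_eps a \<and> 1 < nu a \<and> 0 < mu a \<and> 0 \<le> tol_kkt a"

definition core :: "nat \<Rightarrow> params \<Rightarrow> nat \<Rightarrow> nat set" where
  "core N a i = (if Suc i < nsub a then {knot a i..<knot a (Suc i)} else {knot a i..N})"

text \<open>Truncated subtraction on the naturals is the maximum with \<open>0\<close>.\<close>

definition win_lo :: "params \<Rightarrow> (nat \<Rightarrow> nat) \<Rightarrow> nat \<Rightarrow> nat" where
  "win_lo a b i = knot a i - b i"

definition win_hi :: "nat \<Rightarrow> params \<Rightarrow> (nat \<Rightarrow> nat) \<Rightarrow> nat \<Rightarrow> nat" where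
  "win_hi N a b i = min (knot a (Suc i) + b i) N"

text \<open>Vectors of the subproblem with window \<open>[m1, m2]\<close> are represented by full primal-dual vectors
  that vanish off the window. There is no control at stage \<open>m2\<close>.\<close>

definition win_space :: "nat \<Rightarrow> nat \<Rightarrow> ('n::finite, 'x::finite, 'u::finite) pd set" where
  "win_space m1 m2 =
    {s. (\<forall>k\<le>CARD('n). k \<notin> {m1..m2} \<longrightarrow> state (fst s) k = 0 \<and> mult (snd s) k = 0) \<and>
        (\<forall>k<CARD('n). k \<notin> {m1..<m2} \<longrightarrow> ctrl (fst s) k = 0)}"

definition qp_objective ::
  "('x::finite, 'u::finite) ocp \<Rightarrow> params \<Rightarrow> ('x, 'u) hmod \<Rightarrow> ('n::finite, 'x, 'u) pd \<Rightarrow>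
    nat \<Rightarrow> nat \<Rightarrow> ('n, 'x, 'u) prim \<Rightarrow> real" where
  "qp_objective P a W w m1 m2 y =
    (let g = grad_z P w;
         HT = (if m2 < CARD('n) then hQ W m2 + mat (mu a) else hQ W CARD('n))
     in (\<Sum>k=m1..<m2. 1/2 * (stage_z y k \<bullet> hat_blk W k (stage_z y k))
            + state g k \<bullet> state y k + ctrl g k \<bullet> ctrl y k)
        + 1/2 * (state y m2 \<bullet> (HT *v state y m2)) + state g m2 \<bullet> state y m2)"

definition qp_lagr ::
  "('x::finite, 'u::finite) ocp \<Rightarrow> params \<Rightarrow> ('x, 'u) hmod \<Rightarrow> ('n::finite, 'x, 'u) pd \<Rightarrow>
    nat \<Rightarrow> nat \<Rightarrow> ('n, 'x, 'u) pd \<Rightarrow> real" where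
  "qp_lagr P a W w m1 m2 s =
    (let y = fst s; \<zeta> = snd s; z = fst w;
         d1 = (if m1 = 0 then init_state P - state z 0 else 0)
     in qp_objective P a W w m1 m2 y
        + mult \<zeta> m1 \<bullet> (state y m1 - d1)
        + (\<Sum>k=m1..<m2. mult \<zeta> (Suc k) \<bullet>
            (state y (Suc k) - jac_A P k (stage_z z k) *v state y k
              - jac_B P k (stage_z z k) *v ctrl y k + mult (grad_l P w) (Suc k))))"

text \<open>\<^const>\<open>qp_lagr\<close> only depends on the components inside the window, so its gradient and
  Hessian, although taken in the full space, are those of the subproblem padded with zeros.\<close>

definition qp_grad ::
  "('x::finite, 'u::finite) ocp \<Rightarrow> params \<Rightarrow> ('x, 'u) hmod \<Rightarrow> ('n::finite, 'x, 'u) pd \<Rightarrow>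
    nat \<Rightarrow> nat \<Rightarrow> ('n, 'x, 'u) pd" where
  "qp_grad P a W w m1 m2 = grad (qp_lagr P a W w m1 m2) 0"

definition qp_hess ::
  "('x::finite, 'u::finite) ocp \<Rightarrow> params \<Rightarrow> ('x, 'u) hmod \<Rightarrow> ('n::finite, 'x, 'u) pd \<Rightarrow>
    nat \<Rightarrow> nat \<Rightarrow> ('n, 'x, 'u) pd \<Rightarrow> ('n, 'x, 'u) pd" where
  "qp_hess P a W w m1 m2 = frechet_derivative (grad (qp_lagr P a W w m1 m2)) (at 0)"

text \<open>\<open>s\<close> is an admissible output of a local solve with tolerance \<open>e\<close>.\<close>

definition local_solution ::
  "('x::finite, 'u::finite) ocp \<Rightarrow> params \<Rightarrow> ('x, 'u) hmod \<Rightarrow> ('n::finite, 'x, 'u) pd \<Rightarrow>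
    nat \<Rightarrow> nat \<Rightarrow> real \<Rightarrow> ('n, 'x, 'u) pd \<Rightarrow> bool" where
  "local_solution P a W w m1 m2 e s \<longleftrightarrow>
    s \<in> win_space m1 m2 \<and>
    norm (qp_hess P a W w m1 m2 s + qp_grad P a W w m1 m2) \<le> e * norm (qp_grad P a W w m1 m2)"

definition composed :: "params \<Rightarrow> (nat \<Rightarrow> ('n::finite, 'x::finite, 'u::finite) pd) \<Rightarrow> ('n, 'x, 'u) pd \<Rightarrow> bool" where
  "composed a s d \<longleftrightarrow>
    (\<forall>i<nsub a. \<forall>k\<in>core CARD('n) a i.
      state (fst d) k = state (fst (s i)) k \<and>
      (k < CARD('n) \<longrightarrow> ctrl (fst d) k = ctrl (fst (s i)) k) \<and>
      mult (snd d) k = mult (snd (s i)) k)"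

text \<open>\<open>d\<close> is a possible composed direction for local tolerances \<open>e\<close> and overlaps \<open>b\<close>.\<close>

definition local_solves ::
  "('x::finite, 'u::finite) ocp \<Rightarrow> params \<Rightarrow> ('x, 'u) hmod \<Rightarrow> ('n::finite, 'x, 'u) pd \<Rightarrow>
    (nat \<Rightarrow> real) \<Rightarrow> (nat \<Rightarrow> nat) \<Rightarrow> ('n, 'x, 'u) pd \<Rightarrow> bool" where
  "local_solves P a W w e b d \<longleftrightarrow>
    (\<exists>s. (\<forall>i<nsub a.
            local_solution P a W w (win_lo a b i) (win_hi CARD('n) a b i) (e i) (s i)) \<and>
         composed a s d)"


section \<open>Tests\<close>

definition residual ::
  "('x::finite, 'u::finite) ocp \<Rightarrow> ('x, 'u) hmod \<Rightarrow> ('n::finite, 'x, 'u) pd \<Rightarrow>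
    ('n, 'x, 'u) pd \<Rightarrow> ('n, 'x, 'u) pd" where
  "residual P W w d = kkt_mat P W w d + grad_lagr P w"

definition restr :: "nat set \<Rightarrow> ('n::finite, 'x::finite, 'u::finite) pd \<Rightarrow> ('n, 'x, 'u) pd" where
  "restr K r =
    (mk_prim (\<lambda>k. if k \<in> K then state (fst r) k else 0) (\<lambda>k. if k \<in> K then ctrl (fst r) k else 0),
     mk_dual (\<lambda>k. if k \<in> K then mult (snd r) k else 0))"

definition Psi ::
  "('x::finite, 'u::finite) ocp \<Rightarrow> params \<Rightarrow> ('x, 'u) hmod \<Rightarrow> ('n::finite, 'x, 'u) pd \<Rightarrow> real" where
  "Psi P a W w =
    20 * max ((onorm (hat_hess W :: ('n, 'x, 'u) prim \<Rightarrow> _))\<^sup>2) 1 /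
      (min (gam a) 1 * min ((sigma_min (jac_G P w))\<^sup>2) 1)"

definition Ups ::
  "('x::finite, 'u::finite) ocp \<Rightarrow> ('x, 'u) hmod \<Rightarrow> ('n::finite, 'x, 'u) pd \<Rightarrow> real" where
  "Ups P W w =
    max (onorm (jac_G P w)) (max (onorm (hat_hess W :: ('n, 'x, 'u) prim \<Rightarrow> _)) 1)"

definition accurate ::
  "('x::finite, 'u::finite) ocp \<Rightarrow> params \<Rightarrow> ('x, 'u) hmod \<Rightarrow> ('n::finite, 'x, 'u) pd \<Rightarrow>
    real \<Rightarrow> ('n, 'x, 'u) pd \<Rightarrow> bool" where
  "accurate P a W w \<epsilon> d \<longleftrightarrow>
    norm (residual P W w d) \<le>
      \<epsilon> * norm (grad_lagr P w) / (onorm (kkt_mat P W w) * Psi P a W w)"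

definition descent ::
  "('x::finite, 'u::finite) ocp \<Rightarrow> ('n::finite, 'x, 'u) pd \<Rightarrow> real \<Rightarrow> real \<Rightarrow> ('n, 'x, 'u) pd \<Rightarrow> bool" where
  "descent P w \<eta>1 \<eta>2 d \<longleftrightarrow>
    grad (merit P \<eta>1 \<eta>2) w \<bullet> d \<le> - \<eta>2 * (norm (grad_lagr P w))\<^sup>2 / 2"

definition eps_max ::
  "('x::finite, 'u::finite) ocp \<Rightarrow> params \<Rightarrow> ('x, 'u) hmod \<Rightarrow> ('n::finite, 'x, 'u) pd \<Rightarrow>
    real \<Rightarrow> real \<Rightarrow> real" where
  "eps_max P a W w \<eta>1 \<eta>2 =
    (1/2 - beta a) * \<eta>2 / ((1 + \<eta>1 + \<eta>2) * (Psi P a W w * Ups P W w)\<^sup>2)"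

definition armijo ::
  "('x::finite, 'u::finite) ocp \<Rightarrow> params \<Rightarrow> ('n::finite, 'x, 'u) pd \<Rightarrow> real \<Rightarrow> real \<Rightarrow>
    ('n, 'x, 'u) pd \<Rightarrow> real \<Rightarrow> bool" where
  "armijo P a w \<eta>1 \<eta>2 d \<alpha> \<longleftrightarrow>
    merit P \<eta>1 \<eta>2 (w + \<alpha> *\<^sub>R d) \<le>
      merit P \<eta>1 \<eta>2 w + \<alpha> * beta a * (grad (merit P \<eta>1 \<eta>2) w \<bullet> d)"


section \<open>The AOTD algorithm\<close>

text \<open>Adaptive parameters: \<open>\<eta>\<^sub>1, \<eta>\<^sub>2\<close>, the accuracy tolerance \<open>\<epsilon>\<close>, the local tolerances \<open>\<epsilon>\<^sub>i\<close> and the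
  overlaps \<open>b\<^sub>i\<close> (the latter two for \<open>i < M\<close>).\<close>

record adapt =
  eta1 :: real
  eta2 :: real
  acc_tol :: real
  loc_tol :: "nat \<Rightarrow> real"
  overlap :: "nat \<Rightarrow> nat"

definition valid_init :: "params \<Rightarrow> adapt \<Rightarrow> bool" where
  "valid_init a s \<longleftrightarrow> 0 < eta1 s \<and> 0 < eta2 s \<and> 0 < acc_tol s \<and>
    (\<forall>i<nsub a. 0 < loc_tol s i \<and> 1 \<le> overlap s i)"

definition upd_loc_tol ::
  "params \<Rightarrow> ('n::finite, 'x::finite, 'u::finite) pd \<Rightarrow> (nat \<Rightarrow> real) \<Rightarrow> nat \<Rightarrow> real" where
  "upd_loc_tol a r e i = e i * exp (- rho_eps a *
     (norm (restr (core CARD('n) a i) r) / norm r + 1 / sqrt (real (nsub a))))"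

definition upd_overlap ::
  "params \<Rightarrow> ('n::finite, 'x::finite, 'u::finite) pd \<Rightarrow> (nat \<Rightarrow> nat) \<Rightarrow> nat \<Rightarrow> nat" where
  "upd_overlap a r b i =
     b i + max 1 (nat \<lceil>rho_b a * (norm (restr (core CARD('n) a i) r) / norm r)\<rceil>)"

text \<open>Loops are relations between entry and exit configurations, since the local solves are
  nondeterministic; they only relate to an exit configuration if they terminate.\<close>

inductive accuracy_loop ::
  "('x::finite, 'u::finite) ocp \<Rightarrow> params \<Rightarrow> ('x, 'u) hmod \<Rightarrow> ('n::finite, 'x, 'u) pd \<Rightarrow> real \<Rightarrow>
    (nat \<Rightarrow> real) \<times> (nat \<Rightarrow> nat) \<times> ('n, 'x, 'u) pd \<Rightarrow>
    (nat \<Rightarrow> real) \<times> (nat \<Rightarrow> nat) \<times> ('n, 'x, 'u) pd \<Rightarrow> bool"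
  for P a W w \<epsilon>
where
  stop: "accurate P a W w \<epsilon> d \<Longrightarrow> accuracy_loop P a W w \<epsilon> (e, b, d) (e, b, d)"
| success: "\<not> accurate P a W w \<epsilon> d \<Longrightarrow> local_solves P a W w e b d' \<Longrightarrow>
    accurate P a W w \<epsilon> d' \<Longrightarrow> accuracy_loop P a W w \<epsilon> (e, b, d) (e, b, d')"
| again: "\<not> accurate P a W w \<epsilon> d \<Longrightarrow> local_solves P a W w e b d' \<Longrightarrow>
    \<not> accurate P a W w \<epsilon> d' \<Longrightarrow> r = residual P W w d' \<Longrightarrow>
    accuracy_loop P a W w \<epsilon> (upd_loc_tol a r e, upd_overlap a r b, d') c \<Longrightarrow>
    accuracy_loop P a W w \<epsilon> (e, b, d) c"

definition merit_update ::
  "('x::finite, 'u::finite) ocp \<Rightarrow> params \<Rightarrow> ('x, 'u) hmod \<Rightarrow> ('n::finite, 'x, 'u) pd \<Rightarrow>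
    ('n, 'x, 'u) pd \<Rightarrow> adapt \<Rightarrow> adapt" where
  "merit_update P a W w d s =
    (if descent P w (eta1 s) (eta2 s) d then s
     else let h1 = (nu a)\<^sup>2 * eta1 s; h2 = eta2 s / nu a
          in s\<lparr>eta1 := h1, eta2 := h2,
               acc_tol := min (eps_max P a W w h1 h2) (acc_tol s / nu a ^ 4)\<rparr>)"

inductive direction_loop ::
  "('x::finite, 'u::finite) ocp \<Rightarrow> params \<Rightarrow> ('x, 'u) hmod \<Rightarrow> ('n::finite, 'x, 'u) pd \<Rightarrow>
    adapt \<times> ('n, 'x, 'u) pd \<Rightarrow> adapt \<times> ('n, 'x, 'u) pd \<Rightarrow> bool"
  for P a W w
where
  stop: "accurate P a W w (acc_tol s) d \<Longrightarrow> descent P w (eta1 s) (eta2 s) d \<Longrightarrow>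
    direction_loop P a W w (s, d) (s, d)"
| again: "\<not> (accurate P a W w (acc_tol s) d \<and> descent P w (eta1 s) (eta2 s) d) \<Longrightarrow>
    accuracy_loop P a W w (acc_tol s) (loc_tol s, overlap s, d) (e, b, d') \<Longrightarrow>
    direction_loop P a W w
      (merit_update P a W w d' (s\<lparr>loc_tol := e, overlap := b\<rparr>), d') c \<Longrightarrow>
    direction_loop P a W w (s, d) c"

definition cap_acc_tol ::
  "('x::finite, 'u::finite) ocp \<Rightarrow> params \<Rightarrow> ('x, 'u) hmod \<Rightarrow> ('n::finite, 'x, 'u) pd \<Rightarrow>
    adapt \<Rightarrow> adapt" where
  "cap_acc_tol P a W w s =
    (let m = eps_max P a W w (eta1 s) (eta2 s)
     in if acc_tol s > m then s\<lparr>acc_tol := m / nu a\<rparr> else s)"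

text \<open>One iteration that does not return: from iterate \<open>w\<close> and parameters \<open>s\<close>, with Hessian
  modification \<open>W\<close>, to the accepted parameters \<open>s'\<close>, direction \<open>d\<close>, stepsize \<open>\<alpha>\<close> and next iterate
  \<open>w'\<close>.\<close>

definition aotd_step ::
  "('x::finite, 'u::finite) ocp \<Rightarrow> params \<Rightarrow> ('x, 'u) hmod \<Rightarrow> ('n::finite, 'x, 'u) pd \<Rightarrow>
    adapt \<Rightarrow> adapt \<Rightarrow> ('n, 'x, 'u) pd \<Rightarrow> real \<Rightarrow> ('n, 'x, 'u) pd \<Rightarrow> bool" where
  "aotd_step P a W w s s' d \<alpha> w' \<longleftrightarrow>
    \<not> norm (grad_lagr P w) \<le> tol_kkt a \<and>
    direction_loop P a W w (cap_acc_tol P a W w s, 0) (s', d) \<and>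
    (\<exists>j. \<alpha> = delta a ^ j \<and> armijo P a w (eta1 s') (eta2 s') d (delta a ^ j) \<and>
         (\<forall>i<j. \<not> armijo P a w (eta1 s') (eta2 s') d (delta a ^ i))) \<and>
    w' = w + \<alpha> *\<^sub>R d"

text \<open>An infinite run with input parameters \<open>s0\<close>; \<open>s \<tau>\<close> are the parameters in force when the step
  of iteration \<open>\<tau>\<close> is accepted.\<close>

definition aotd_run ::
  "('x::finite, 'u::finite) ocp \<Rightarrow> params \<Rightarrow> adapt \<Rightarrow> (nat \<Rightarrow> ('x, 'u) hmod) \<Rightarrow>
    (nat \<Rightarrow> ('n::finite, 'x, 'u) pd) \<Rightarrow> (nat \<Rightarrow> adapt) \<Rightarrow> (nat \<Rightarrow> ('n, 'x, 'u) pd) \<Rightarrow>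
    (nat \<Rightarrow> real) \<Rightarrow> bool" where
  "aotd_run P a s0 W w s d \<alpha> \<longleftrightarrow>
    valid_params CARD('n) a \<and> valid_init a s0 \<and>
    (\<forall>\<tau>. hess_modification P (gam a) (w \<tau>) (W \<tau>) \<and>
      aotd_step P a (W \<tau>) (w \<tau>) (if \<tau> = 0 then s0 else s (\<tau> - 1)) (s \<tau>) (d \<tau>) (\<alpha> \<tau>)
        (w (Suc \<tau>)))"


section \<open>Assumptions\<close>

definition reduced_hessian_lower_bound ::
  "('x::finite, 'u::finite) ocp \<Rightarrow> real \<Rightarrow> (nat \<Rightarrow> ('x, 'u) hmod) \<Rightarrow>
    (nat \<Rightarrow> ('n::finite, 'x, 'u) pd) \<Rightarrow> bool" where
  "reduced_hessian_lower_bound P \<gamma> W w \<longleftrightarrow>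
    0 < \<gamma> \<and> (\<forall>\<tau>. reduced_ge (hat_hess (W \<tau>)) (jac_G P (w \<tau>)) \<gamma>)"

text \<open>\<open>trans_mat A j m = A (j + m - 1) \<cdots> A (j + 1) A j\<close>\<close>

primrec trans_mat :: "(nat \<Rightarrow> real^'x^'x) \<Rightarrow> nat \<Rightarrow> nat \<Rightarrow> real^'x^'x" where
  "trans_mat A j 0 = mat 1"
| "trans_mat A j (Suc m) = A (j + m) ** trans_mat A j m"

text \<open>\<open>\<Xi> \<Xi>\<^sup>T\<close> for the controllability matrix \<open>\<Xi>\<close> with the \<open>t\<close> column blocks
  \<open>A (k + t - 1) \<cdots> A (k + j + 1) B (k + j)\<close>, \<open>0 \<le> j < t\<close>.\<close>

definition ctrb_block ::
  "(nat \<Rightarrow> real^'x^'x) \<Rightarrow> (nat \<Rightarrow> real^'u^'x) \<Rightarrow> nat \<Rightarrow> nat \<Rightarrow> nat \<Rightarrow> real^'u^'x" where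
  "ctrb_block A B k t j = trans_mat A (k + j + 1) (t - 1 - j) ** B (k + j)"

definition ctrb_gram ::
  "(nat \<Rightarrow> real^'x^'x) \<Rightarrow> (nat \<Rightarrow> real^'u^'x) \<Rightarrow> nat \<Rightarrow> nat \<Rightarrow> real^'x^'x" where
  "ctrb_gram A B k t = (\<Sum>j<t. ctrb_block A B k t j ** transpose (ctrb_block A B k t j))"

definition uniform_controllability ::
  "('x::finite, 'u::finite) ocp \<Rightarrow> real \<Rightarrow> nat \<Rightarrow> (nat \<Rightarrow> ('n::finite, 'x, 'u) pd) \<Rightarrow> bool" where
  "uniform_controllability P \<gamma>C tC w \<longleftrightarrow>
    0 < \<gamma>C \<and> \<gamma>C \<le> 1 \<and> 1 \<le> tC \<and> tC \<le> CARD('n) \<and>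
    (\<forall>\<tau>. \<forall>k\<le>CARD('n) - tC. \<exists>t\<in>{1..tC}.
      loewner_ge (ctrb_gram (\<lambda>j. jac_A P j (stage_z (fst (w \<tau>)) j))
                            (\<lambda>j. jac_B P j (stage_z (fst (w \<tau>)) j)) k t) \<gamma>C)"

definition uniform_boundedness ::
  "('x::finite, 'u::finite) ocp \<Rightarrow> real \<Rightarrow> (nat \<Rightarrow> ('x, 'u) hmod) \<Rightarrow>
    (nat \<Rightarrow> ('n::finite, 'x, 'u) pd) \<Rightarrow> bool" where
  "uniform_boundedness P \<Upsilon> W w \<longleftrightarrow>
    2 \<le> \<Upsilon> \<and>
    (\<forall>\<tau>. (\<forall>k<CARD('n).
            onorm (hat_blk (W \<tau>) k) \<le> \<Upsilon> \<and>
            spec_norm (jac_A P k (stage_z (fst (w \<tau>)) k)) \<le> \<Upsilon> \<and>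
            spec_norm (jac_B P k (stage_z (fst (w \<tau>)) k)) \<le> \<Upsilon>) \<and>
         spec_norm (hQ (W \<tau>) CARD('n)) \<le> \<Upsilon>)"

text \<open>The stagewise bounds are stated over the full product sets: the blocks of the Hessian only
  depend on the stage components indicated by their index.\<close>

definition compactness_smoothness ::
  "('x::finite, 'u::finite) ocp \<Rightarrow> real \<Rightarrow> (nat \<Rightarrow> ('n::finite, 'x, 'u) pd) \<Rightarrow>
    (nat \<Rightarrow> ('n, 'x, 'u) pd) \<Rightarrow> bool" where
  "compactness_smoothness P \<Upsilon> w d \<longleftrightarrow>
    (\<exists>(Zk :: nat \<Rightarrow> ('x, 'u) pair set) (ZN :: (real^'x) set) (Lk :: nat \<Rightarrow> (real^'x) set)
       (Z :: ('n, 'x, 'u) prim set) (L :: ('n, 'x) dual set).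
      Z = {z. (\<forall>k<CARD('n). stage_z z k \<in> Zk k) \<and> state z CARD('n) \<in> ZN} \<and>
      L = {l. \<forall>k\<le>CARD('n). mult l k \<in> Lk k} \<and>
      compact (Z \<times> L) \<and>
      (\<forall>\<tau>. \<forall>\<alpha>\<in>{0..1}. w \<tau> + \<alpha> *\<^sub>R d \<tau> \<in> Z \<times> L) \<and>
      (\<forall>y\<in>Z \<times> L.
        (\<forall>k<CARD('n).
          onorm (hess_blk P k y) \<le> \<Upsilon> \<and>
          spec_norm (jac_A P k (stage_z (fst y) k)) \<le> \<Upsilon> \<and>
          spec_norm (jac_B P k (stage_z (fst y) k)) \<le> \<Upsilon>) \<and>
        onorm (hess_blk_N P y) \<le> \<Upsilon>)) \<and>
    (\<forall>k<CARD('n). C3 (stage_cost P k) \<and> C3 (dynamics P k)) \<and> C3 (term_cost P)"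

definition vanishing_modification ::
  "('x::finite, 'u::finite) ocp \<Rightarrow> (nat \<Rightarrow> ('x, 'u) hmod) \<Rightarrow>
    (nat \<Rightarrow> ('n::finite, 'x, 'u) pd) \<Rightarrow> bool" where
  "vanishing_modification P W w \<longleftrightarrow>
    (\<lambda>\<tau>. onorm (\<lambda>v. hess P (w \<tau>) v - hat_hess (W \<tau>) v)) \<longlonglongrightarrow> 0"

definition local_lipschitz_at ::
  "('x::finite, 'u::finite) ocp \<Rightarrow> ('n::finite, 'x, 'u) pd \<Rightarrow> bool" where
  "local_lipschitz_at P ws \<longleftrightarrow>
    (\<exists>U C. open U \<and> ws \<in> U \<and> 0 < C \<and>
      (\<forall>y\<in>U. \<forall>y'\<in>U.
        (\<forall>k<CARD('n).
          (let v = stage_z (fst y) k; v' = stage_z (fst y') k;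
               l = mult (snd y) (Suc k); l' = mult (snd y') (Suc k)
           in max (spec_norm (jac_A P k v - jac_A P k v')) (spec_norm (jac_B P k v - jac_B P k v'))
                \<le> C * norm (v - v') \<and>
              onorm (\<lambda>h. hess_blk P k y h - hess_blk P k y' h) \<le> C * norm (v - v', l - l'))) \<and>
        onorm (\<lambda>h. hess_blk_N P y h - hess_blk_N P y' h)
          \<le> C * norm (state (fst y) CARD('n) - state (fst y') CARD('n))))"

end

theory Submission
  imports Defs "HOL-Library.Landau_Symbols"
begin

text \<open>
  The KKT matrix \<open>\<Gamma>\<close> satisfies \<open>\<parallel>v\<parallel> \<le> \<Psi> \<parallel>\<Gamma> v\<parallel>\<close>, and \<open>\<Gamma>\<close> at the iterates converges to the exact KKT
  matrix \<open>K\<close> at the limit, because the Hessian modification vanishes. With \<open>e = w - w\<^sup>*\<close> and \<open>r\<close> the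
  residual of the accepted direction \<open>d\<close>, linearity gives \<open>\<Gamma> (e + d) = r + (\<Gamma> e - \<nabla>L(w)) = r + o(\<parallel>e\<parallel>)\<close>, so
  the accuracy test yields \<open>\<parallel>e + d\<parallel> \<le> \<epsilon> \<parallel>e\<parallel> + o(\<parallel>e\<parallel>)\<close>. It remains to see that the unit step is
  eventually accepted. Near \<open>w\<^sup>*\<close> the merit function is, up to \<open>o(\<parallel>e\<parallel>\<^sup>2)\<close>, half the quadratic form of
  \<open>M = K + K D K\<close> with \<open>D = diag(\<eta>\<^sub>2, \<eta>\<^sub>1)\<close>, whence its change along \<open>d\<close> is half its slope plus
  \<open>\<langle>M (e + d), d\<rangle> / 2\<close>. The last term is controlled by the residual, and the cap on \<open>\<epsilon>\<close> makes it small
  against the slope guaranteed by the descent test.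
\<close>

section \<open>Landau symbols for vector sequences and convergence of linear maps\<close>

lemma inner_smallo:
  fixes f h :: "nat \<Rightarrow> 'a::real_inner" and E F :: "nat \<Rightarrow> real"
  assumes "(\<lambda>n. norm (f n)) \<in> o(E)" "(\<lambda>n. norm (h n)) \<in> O(F)"
  shows "(\<lambda>n. f n \<bullet> h n) \<in> o(\<lambda>n. E n * F n)"
proof -
  have "(\<lambda>n. norm (f n) * norm (h n)) \<in> o(\<lambda>n. E n * F n)"
    by (rule landau_o.small_big_mult[OF assms])
  moreover have "(\<lambda>n. f n \<bullet> h n) \<in> O(\<lambda>n. norm (f n) * norm (h n))"
    by (rule landau_o.bigI[of 1]) (auto simp: Cauchy_Schwarz_ineq2)
  ultimately show ?thesis
    by (rule landau_o.big_small_trans[rotated])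
qed

lemma linear_bigo:
  fixes T :: "'a::real_normed_vector \<Rightarrow> 'b::real_normed_vector" and v :: "nat \<Rightarrow> 'a"
  assumes "bounded_linear T"
  shows "(\<lambda>n. norm (T (v n))) \<in> O(\<lambda>n. norm (v n))"
proof (rule landau_o.bigI[of "onorm T + 1"])
  show "onorm T + 1 > 0" using onorm_pos_le[OF assms] by simp
  have "norm (T v) \<le> (onorm T + 1) * norm v" for v
    using onorm[OF assms, of v] norm_ge_zero[of v] unfolding distrib_right mult_1_left by linarith
  then show "\<forall>\<^sub>F n in sequentially. norm (norm (T (v n))) \<le> (onorm T + 1) * norm (norm (v n))"
    by simp
qed

lemma linear_smallo:
  fixes T :: "'a::real_normed_vector \<Rightarrow> 'b::real_normed_vector" and v :: "nat \<Rightarrow> 'a"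
  assumes "bounded_linear T" "(\<lambda>n. norm (v n)) \<in> o(E)"
  shows "(\<lambda>n. norm (T (v n))) \<in> o(E)"
  by (rule landau_o.big_small_trans[OF linear_bigo[OF assms(1)] assms(2)])

lemma norm_add_bigo:
  fixes f h :: "nat \<Rightarrow> 'a::real_normed_vector"
  assumes "(\<lambda>n. norm (f n)) \<in> O(E)" "(\<lambda>n. norm (h n)) \<in> O(E)"
  shows "(\<lambda>n. norm (f n + h n)) \<in> O(E)"
proof -
  have "(\<lambda>n. norm (f n + h n)) \<in> O(\<lambda>n. norm (f n) + norm (h n))"
    by (rule landau_o.bigI[of 1]) (auto intro!: always_eventually norm_triangle_ineq)
  also have "(\<lambda>n. norm (f n) + norm (h n)) \<in> O(E)"
    using assms by (rule sum_in_bigo)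
  finally show ?thesis .
qed

lemma norm_add_smallo:
  fixes f h :: "nat \<Rightarrow> 'a::real_normed_vector"
  assumes "(\<lambda>n. norm (f n)) \<in> o(E)" "(\<lambda>n. norm (h n)) \<in> o(E)"
  shows "(\<lambda>n. norm (f n + h n)) \<in> o(E)"
proof -
  have "(\<lambda>n. norm (f n + h n)) \<in> O(\<lambda>n. norm (f n) + norm (h n))"
    by (rule landau_o.bigI[of 1]) (auto intro!: always_eventually norm_triangle_ineq)
  also have "(\<lambda>n. norm (f n) + norm (h n)) \<in> o(E)"
    using assms by (rule sum_in_smallo)
  finally show ?thesis .
qed

lemma norm_diff_smallo:
  fixes f h :: "nat \<Rightarrow> 'a::real_normed_vector"
  assumes "(\<lambda>n. norm (f n)) \<in> o(E)" "(\<lambda>n. norm (h n)) \<in> o(E)"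
  shows "(\<lambda>n. norm (f n - h n)) \<in> o(E)"
  using norm_add_smallo[of f E "\<lambda>n. - h n"] assms by simp

lemma norm_bigo_of_diff_smallo:
  fixes f h :: "nat \<Rightarrow> 'a::real_normed_vector"
  assumes "(\<lambda>n. norm (f n - h n)) \<in> o(E)" "(\<lambda>n. norm (h n)) \<in> O(E)"
  shows "(\<lambda>n. norm (f n)) \<in> O(E)"
  using norm_add_bigo[OF landau_o.small_imp_big[OF assms(1)] assms(2)] by simp

text \<open>Convergence in operator norm; unlike \<^const>\<open>onorm\<close> this carries no junk value when the
  maps are not known to be bounded.\<close>

definition op_tendsto ::
  "(nat \<Rightarrow> 'a::real_normed_vector \<Rightarrow> 'b::real_normed_vector) \<Rightarrow> ('a \<Rightarrow> 'b) \<Rightarrow> bool" where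
  "op_tendsto T T' \<longleftrightarrow> (\<forall>c>0. \<forall>\<^sub>F n in sequentially. \<forall>v. norm (T n v - T' v) \<le> c * norm v)"

text \<open>The bound in \<open>op_tendsto\<close> is uniform in the vector, so the argument may
  move with \<open>n\<close>. This turns convergence of matrices into an error of smaller order than
  the vectors they act on.\<close>

lemma op_tendsto_smallo:
  assumes "op_tendsto T T'" "(\<lambda>n. norm (v n)) \<in> O(E)"
  shows "(\<lambda>n. norm (T n (v n) - T' (v n))) \<in> o(E)"
proof (rule landau_o.small_big_trans[OF _ assms(2)], rule landau_o.smallI)
  fix c :: real assume "c > 0"
  then have "\<forall>\<^sub>F n in sequentially. \<forall>v. norm (T n v - T' v) \<le> c * norm v"
    using assms(1) by (auto simp: op_tendsto_def)
  then show "\<forall>\<^sub>F n in sequentially. norm (norm (T n (v n) - T' (v n))) \<le> c * norm (norm (v n))"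
    by eventually_elim simp
qed

lemma op_tendsto_trans:
  assumes "op_tendsto T T'" "op_tendsto (\<lambda>n v. S n v - T n v) (\<lambda>_. 0)"
  shows "op_tendsto S T'"
  unfolding op_tendsto_def
proof (intro allI impI)
  fix c :: real assume "c > 0"
  then have "c / 2 > 0" by simp
  then have "\<forall>\<^sub>F n in sequentially. \<forall>v. norm (T n v - T' v) \<le> c / 2 * norm v"
    "\<forall>\<^sub>F n in sequentially. \<forall>v. norm (S n v - T n v) \<le> c / 2 * norm v"
    using assms unfolding op_tendsto_def diff_0_right by blast+
  then show "\<forall>\<^sub>F n in sequentially. \<forall>v. norm (S n v - T' v) \<le> c * norm v"
  proof eventually_elim
    case (elim n)
    show ?case
    proof
      fix v
      have "norm (S n v - T' v) = norm ((S n v - T n v) + (T n v - T' v))" by simp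
      also have "\<dots> \<le> norm (S n v - T n v) + norm (T n v - T' v)" by (rule norm_triangle_ineq)
      also have "\<dots> \<le> c / 2 * norm v + c / 2 * norm v" using elim by (intro add_mono) auto
      finally show "norm (S n v - T' v) \<le> c * norm v" by simp
    qed
  qed
qed

text \<open>In finite dimension the operator norm of a difference is at most the sum of its norms on
  the basis vectors, and this finite sum tends to 0.\<close>

lemma op_tendsto_pointwise:
  fixes T :: "nat \<Rightarrow> 'a::euclidean_space \<Rightarrow> 'b::real_normed_vector"
  assumes lin: "\<And>n. linear (T n)" "linear T'" and lim: "\<And>v. (\<lambda>n. T n v) \<longlonglongrightarrow> T' v"
  shows "op_tendsto T T'"
  unfolding op_tendsto_def
proof (intro allI impI)
  fix c :: real assume "c > 0"
  have "(\<lambda>n. \<Sum>b\<in>Basis. norm (T n b - T' b)) \<longlonglongrightarrow> (\<Sum>b\<in>Basis. norm (T' b - T' b))"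
    by (intro tendsto_intros lim)
  then have "(\<lambda>n. \<Sum>b\<in>Basis. norm (T n b - T' b)) \<longlonglongrightarrow> 0" by simp
  then have "\<forall>\<^sub>F n in sequentially. (\<Sum>b\<in>Basis. norm (T n b - T' b)) < c"
    using \<open>c > 0\<close> by (rule order_tendstoD)
  then show "\<forall>\<^sub>F n in sequentially. \<forall>v. norm (T n v - T' v) \<le> c * norm v"
  proof eventually_elim
    case (elim n)
    show ?case
    proof
      fix v
      interpret D: linear "\<lambda>v. T n v - T' v"
        using linear_compose_sub[OF lin(1) lin(2)] .
      have "norm (T n v - T' v) = norm (\<Sum>b\<in>Basis. (v \<bullet> b) *\<^sub>R (T n b - T' b))"
        by (subst (1 2) euclidean_representation[of v, symmetric]) (simp only: D.sum D.scale)
      also have "\<dots> \<le> (\<Sum>b\<in>Basis. norm v * norm (T n b - T' b))"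
        by (intro sum_norm_le) (auto intro!: mult_right_mono Basis_le_norm)
      also have "\<dots> \<le> norm v * c"
        using elim by (auto simp: sum_distrib_left[symmetric] intro!: mult_left_mono)
      finally show "norm (T n v - T' v) \<le> c * norm v" by (simp add: mult.commute)
    qed
  qed
qed

lemma tendsto_op_tendsto:
  assumes *: "op_tendsto T T'"
  shows "(\<lambda>n. T n v) \<longlonglongrightarrow> T' v"
proof -
  have "(\<lambda>n. norm (T n v - T' v)) \<in> o(\<lambda>_. norm v)"
    by (rule op_tendsto_smallo[OF *]) simp
  then have "(\<lambda>n. norm (T n v - T' v)) \<in> o(\<lambda>_. 1::real)"
    by (rule landau_o.small_big_trans) (simp add: bigo_const)
  then have "(\<lambda>n. norm (T n v - T' v)) \<longlonglongrightarrow> 0"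
    by (auto dest: smalloD_tendsto)
  then show ?thesis by (simp add: tendsto_norm_zero_iff LIM_zero_iff)
qed

section \<open>Approximate Newton steps near a nondegenerate critical point\<close>

text \<open>The factor \<open>\<Psi>\<close> from inverting \<open>\<Gamma>\<close> cancels against
  the residual test, and the remaining \<open>1 / N\<close> cancels against the growth of
  \<open>g\<close>, which is at most \<open>N * norm e\<close> up to the model error. Hence exactly
  \<open>\<epsilon>\<close> is left in front of \<open>norm e\<close>.\<close>

lemma newton_step_contraction:
  fixes e d g :: "nat \<Rightarrow> 'a::real_normed_vector" and \<Gamma> :: "nat \<Rightarrow> 'a \<Rightarrow> 'a"
  assumes lin: "\<And>n. linear (\<Gamma> n)"
    and upper: "\<And>n v. norm (\<Gamma> n v) \<le> N n * norm v" and N: "\<And>n. 0 < N n"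
    and lower: "\<And>n v. norm v \<le> \<Psi> n * norm (\<Gamma> n v)" and \<Psi>: "\<And>n. 0 < \<Psi> n" "\<And>n. \<Psi> n \<le> C"
    and NP: "\<And>n. 1 \<le> N n * \<Psi> n"
    and model: "(\<lambda>n. norm (g n - \<Gamma> n (e n))) \<in> o(\<lambda>n. norm (e n))"
    and res: "\<And>n. norm (\<Gamma> n (d n) + g n) \<le> \<epsilon> * norm (g n) / (N n * \<Psi> n)"
    and "0 < \<epsilon>" "\<epsilon> < 1" "c > 0"
  shows "\<forall>\<^sub>F n in sequentially. norm (e n + d n) \<le> (\<epsilon> + c) * norm (e n)"
proof -
  have "C > 0" using \<Psi>[of 0] by linarith
  \<comment> \<open>The model error \<open>q\<close> is charged twice, each time at most as
    \<open>C * q\<close>: once through the size of \<open>g\<close>, once through the passage from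
    the residual to \<open>\<Gamma> (e + d)\<close>. This tolerance makes the total
    \<open>c * norm e\<close>.\<close>
  then have "c / (2 * C) > 0" using \<open>c > 0\<close> by simp
  from landau_o.smallD[OF model this]
  show ?thesis
  proof eventually_elim
    case (elim n)
    define q where "q = norm (g n - \<Gamma> n (e n))"
    have q0: "q \<ge> 0" and q: "q \<le> c / (2 * C) * norm (e n)" using elim by (auto simp: q_def)
    have rN: "\<Psi> n * norm (\<Gamma> n (d n) + g n) \<le> \<epsilon> * norm (g n) / N n"
      using mult_left_mono[OF res[of n], of "\<Psi> n"] \<Psi>(1)[of n] by (simp add: field_simps)
    have "norm (g n) \<le> norm (\<Gamma> n (e n)) + q"
      unfolding q_def by (metis add.commute norm_triangle_sub)
    also have "\<dots> \<le> N n * norm (e n) + q" using upper by simp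
    finally have "\<epsilon> * norm (g n) / N n \<le> \<epsilon> * (N n * norm (e n) + q) / N n"
      using \<open>0 < \<epsilon>\<close> N[of n] by (intro divide_right_mono mult_left_mono) auto
    also have "\<dots> = \<epsilon> * norm (e n) + \<epsilon> * (q / N n)" using N[of n] by (simp add: field_simps)
    also have "\<epsilon> * (q / N n) \<le> q / N n"
      using \<open>\<epsilon> < 1\<close> q0 N[of n] by (intro mult_left_le_one_le) (auto simp: \<open>0 < \<epsilon>\<close> less_imp_le)
    \<comment> \<open>\<open>N\<close> is bounded away from 0 because
      \<open>1 \<le> N * \<Psi> \<le> N * C\<close>.\<close>
    also have "q / N n \<le> q * C"
    proof -
      have "1 \<le> N n * C" using NP[of n] mult_left_mono[OF \<Psi>(2)[of n], of "N n"] N[of n] by linarith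
      then have "q * 1 \<le> q * (N n * C)" using q0 by (intro mult_left_mono)
      then show ?thesis using N[of n] by (simp add: field_simps)
    qed
    finally have 1: "\<Psi> n * norm (\<Gamma> n (d n) + g n) \<le> \<epsilon> * norm (e n) + q * C" using rN by simp
    have "\<Gamma> n (e n + d n) = (\<Gamma> n (d n) + g n) - (g n - \<Gamma> n (e n))"
      by (simp add: linear_add[OF lin])
    then have "norm (\<Gamma> n (e n + d n)) \<le> norm (\<Gamma> n (d n) + g n) + q"
      unfolding q_def using norm_triangle_ineq4 by metis
    then have "\<Psi> n * norm (\<Gamma> n (e n + d n)) \<le> \<Psi> n * norm (\<Gamma> n (d n) + g n) + \<Psi> n * q"
      using \<Psi>(1)[of n] by (simp add: less_imp_le mult_left_mono ring_distribs flip: distrib_left)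
    also have "\<Psi> n * q \<le> C * q" using \<Psi>(2) q0 by (intro mult_right_mono)
    finally have "norm (e n + d n) \<le> \<epsilon> * norm (e n) + 2 * C * q"
      using lower[of "e n + d n" n] 1 by (simp add: algebra_simps)
    also have "2 * C * q \<le> 2 * C * (c / (2 * C) * norm (e n))"
      using q \<open>C > 0\<close> by (intro mult_left_mono) auto
    also have "\<dots> = c * norm (e n)" using \<open>C > 0\<close> by simp
    finally show ?case by (simp add: algebra_simps)
  qed
qed

text \<open>Subtracting the quadratic model from \<open>L\<close> along a ray leaves a function
  whose derivative is the linearisation error of \<open>g\<close> paired with the direction. The
  mean value theorem then lifts differentiability of \<open>g\<close> at the single point
  \<open>ws\<close> to a second-order expansion of \<open>L\<close>.\<close>

lemma second_order_expansion:
  fixes L :: "'a::euclidean_space \<Rightarrow> real" and g :: "'a \<Rightarrow> 'a" and v :: "nat \<Rightarrow> 'a"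
  assumes L: "\<And>w. (L has_derivative (\<lambda>h. g w \<bullet> h)) (at w)"
    and g: "(g has_derivative K) (at ws)" and "g ws = 0" and v: "v \<longlonglongrightarrow> 0"
  shows "(\<lambda>n. norm (g (ws + v n) - K (v n))) \<in> o(\<lambda>n. norm (v n))"
    and "(\<lambda>n. L (ws + v n) - L ws - 1/2 * (K (v n) \<bullet> v n)) \<in> o(\<lambda>n. norm (v n) * norm (v n))"
proof -
  have linK: "linear K" using g by (rule has_derivative_linear)
  have near: "\<exists>\<rho>>0. \<forall>y. norm y < \<rho> \<longrightarrow> norm (g (ws + y) - K y) \<le> c * norm y" if "c > 0" for c
  proof -
    from g that obtain \<rho> where "\<rho> > 0"
      and \<rho>: "\<And>y. norm (y - ws) < \<rho> \<Longrightarrow> norm (g y - g ws - K (y - ws)) \<le> c * norm (y - ws)"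
      unfolding has_derivative_at_alt by blast
    then show ?thesis
      using \<open>g ws = 0\<close> \<rho>[of "ws + _"] by (intro exI[of _ \<rho>]) auto
  qed
  have ev: "\<forall>\<^sub>F n in sequentially. norm (v n) < \<rho>" if "\<rho> > 0" for \<rho>
    using order_tendstoD(2)[OF tendsto_norm_zero[OF v] that] .
  show "(\<lambda>n. norm (g (ws + v n) - K (v n))) \<in> o(\<lambda>n. norm (v n))"
  proof (rule landau_o.smallI)
    fix c :: real assume "c > 0"
    from near[OF this] obtain \<rho> where \<rho>: "\<rho> > 0"
      "\<And>y. norm y < \<rho> \<Longrightarrow> norm (g (ws + y) - K y) \<le> c * norm y" by blast
    show "\<forall>\<^sub>F n in sequentially. norm (norm (g (ws + v n) - K (v n))) \<le> c * norm (norm (v n))"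
      using ev[OF \<rho>(1)] by eventually_elim (use \<rho>(2) in auto)
  qed
  show "(\<lambda>n. L (ws + v n) - L ws - 1/2 * (K (v n) \<bullet> v n)) \<in> o(\<lambda>n. norm (v n) * norm (v n))"
  proof (rule landau_o.smallI)
    fix c :: real assume "c > 0"
    from near[OF this] obtain \<rho> where \<rho>: "\<rho> > 0"
      "\<And>y. norm y < \<rho> \<Longrightarrow> norm (g (ws + y) - K y) \<le> c * norm y" by blast
    have *: "\<bar>L (ws + y) - L ws - 1/2 * (K y \<bullet> y)\<bar> \<le> c * (norm y * norm y)" if y: "norm y < \<rho>" for y
    proof -
      \<comment> \<open>There is no linear term to subtract because \<open>g ws = 0\<close>, so
        \<open>F 1 - F 0\<close> is precisely the error to be estimated.\<close>
      define F where "F t = L (ws + t *\<^sub>R y) - t\<^sup>2 / 2 * (K y \<bullet> y)" for t :: real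
      have F: "(F has_real_derivative (g (ws + t *\<^sub>R y) - K (t *\<^sub>R y)) \<bullet> y) (at t)" for t
      proof -
        have inner: "((\<lambda>t. ws + t *\<^sub>R y) has_derivative (\<lambda>h. h *\<^sub>R y)) (at t)"
          by (auto intro!: derivative_eq_intros)
        have "((\<lambda>t. L (ws + t *\<^sub>R y)) has_derivative (\<lambda>h. g (ws + t *\<^sub>R y) \<bullet> (h *\<^sub>R y))) (at t)"
          by (rule has_derivative_compose[OF inner L])
        then have "((\<lambda>t. L (ws + t *\<^sub>R y)) has_real_derivative (g (ws + t *\<^sub>R y) \<bullet> y)) (at t)"
          by (simp add: has_field_derivative_def mult_commute_abs mult.commute)
        then show ?thesis unfolding F_def
          by (auto intro!: derivative_eq_intros simp: inner_diff_left linear_scale[OF linK])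
      qed
      obtain t where t: "0 < t" "t < 1" "F 1 - F 0 = (1 - 0) * ((g (ws + t *\<^sub>R y) - K (t *\<^sub>R y)) \<bullet> y)"
        using MVT2[of 0 1 F, OF _ F] by auto
      have "norm (t *\<^sub>R y) \<le> norm y" using t by (simp add: mult_left_le_one_le)
      then have "norm (g (ws + t *\<^sub>R y) - K (t *\<^sub>R y)) \<le> c * norm y"
        using \<rho>(2)[of "t *\<^sub>R y"] y \<open>c > 0\<close> mult_left_mono[of "norm (t *\<^sub>R y)" "norm y" c]
        by linarith
      then have "\<bar>F 1 - F 0\<bar> \<le> c * norm y * norm y"
        using t(3) Cauchy_Schwarz_ineq2[of "g (ws + t *\<^sub>R y) - K (t *\<^sub>R y)" y]
          mult_right_mono[of _ "c * norm y" "norm y"] by fastforce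
      then show ?thesis by (simp add: F_def)
    qed
    show "\<forall>\<^sub>F n in sequentially. norm (L (ws + v n) - L ws - 1/2 * (K (v n) \<bullet> v n))
        \<le> c * norm (norm (v n) * norm (v n))"
      using ev[OF \<rho>(1)] by eventually_elim (use * in auto)
  qed
qed

text \<open>Since \<open>g\<close> vanishes at \<open>ws\<close>, both factors of the penalty are of
  order \<open>norm v\<close>, and replacing one of them by its linearisation costs only an error of
  smaller order than the square. For symmetric \<open>K\<close> the resulting form is that of
  \<open>K + K D K\<close>.\<close>

lemma merit_expansion:
  fixes L :: "'a::euclidean_space \<Rightarrow> real" and g :: "'a \<Rightarrow> 'a" and v :: "nat \<Rightarrow> 'a"
  assumes L: "\<And>w. (L has_derivative (\<lambda>h. g w \<bullet> h)) (at w)"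
    and g: "(g has_derivative K) (at ws)" and "g ws = 0" and v: "v \<longlonglongrightarrow> 0"
    and D: "bounded_linear D"
    and m: "\<And>w. m w = L w + 1/2 * (D (g w) \<bullet> g w)"
  shows "(\<lambda>n. m (ws + v n) - m ws - 1/2 * (K (v n) \<bullet> v n + D (K (v n)) \<bullet> K (v n)))
    \<in> o(\<lambda>n. norm (v n) * norm (v n))"
proof -
  let ?g = "\<lambda>n. g (ws + v n)" and ?E = "\<lambda>n. norm (v n)"
  note exp = second_order_expansion[OF L g \<open>g ws = 0\<close> v]
  have K: "bounded_linear K" using g by (rule has_derivative_bounded_linear)
  have KO: "(\<lambda>n. norm (K (v n))) \<in> O(?E)" by (rule linear_bigo[OF K])
  have gO: "(\<lambda>n. norm (?g n)) \<in> O(?E)" by (rule norm_bigo_of_diff_smallo[OF exp(1) KO])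
  have DKO: "(\<lambda>n. norm (D (K (v n)))) \<in> O(?E)"
    by (rule landau_o.big.trans[OF linear_bigo[OF D] KO])
  \<comment> \<open>The difference of \<open>D g \<bullet> g\<close> and
    \<open>D (K v) \<bullet> K v\<close> telescopes into facts 1 and 2 by exchanging one factor at a
    time.\<close>
  have 1: "(\<lambda>n. D (?g n - K (v n)) \<bullet> ?g n) \<in> o(\<lambda>n. ?E n * ?E n)"
    by (rule inner_smallo[OF linear_smallo[OF D exp(1)] gO])
  have 2: "(\<lambda>n. (?g n - K (v n)) \<bullet> D (K (v n))) \<in> o(\<lambda>n. ?E n * ?E n)"
    by (rule inner_smallo[OF exp(1) DKO])
  have "(\<lambda>n. 1/2 * (D (?g n - K (v n)) \<bullet> ?g n + (?g n - K (v n)) \<bullet> D (K (v n))))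
      \<in> o(\<lambda>n. ?E n * ?E n)"
    by (subst landau_o.small.cmult_in_iff) (auto intro: sum_in_smallo 1 2)
  from sum_in_smallo(1)[OF exp(2) this] show ?thesis
    by (rule landau_o.small.in_cong[THEN iffD1, rotated])
       (auto simp: m \<open>g ws = 0\<close> linear_0 bounded_linear.linear[OF D] linear_diff
         inner_diff_left inner_diff_right inner_commute algebra_simps intro!: always_eventually)
qed

text \<open>\<open>\<Gamma>\<close> is the matrix of the Newton system and \<open>K'\<close> the one
  in the gradient of \<open>m\<close>; both agree with \<open>K\<close> to leading order. With
  \<open>x = e + d\<close> the model change \<open>(B x x - B e e) / 2\<close> equals
  \<open>(B e d + B x d) / 2\<close>. The first half is half the slope; the second is a residual
  term, as \<open>K x\<close> is nearly \<open>r\<close>, and the cap keeps it below half of the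
  guaranteed decrease.\<close>

lemma unit_step_armijo:
  fixes L :: "'a::euclidean_space \<Rightarrow> real" and g :: "'a \<Rightarrow> 'a" and w d :: "nat \<Rightarrow> 'a"
  assumes L: "\<And>w. (L has_derivative (\<lambda>h. g w \<bullet> h)) (at w)"
    and g: "(g has_derivative K) (at ws)" and g0: "g ws = 0" and w: "w \<longlonglongrightarrow> ws"
    and D: "bounded_linear D" and D_sym: "\<And>u v. D u \<bullet> v = u \<bullet> D v"
    and D_bound: "\<And>v. norm (D v) \<le> \<eta>s * norm v" and "0 \<le> \<eta>s"
    and m: "\<And>w. m w = L w + 1/2 * (D (g w) \<bullet> g w)"
    and K_sym: "\<And>u v. K u \<bullet> v = u \<bullet> K v"
    and \<Gamma>: "op_tendsto \<Gamma> K" and K': "op_tendsto K' K"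
    and lin: "\<And>n. linear (\<Gamma> n)"
    and upper: "\<And>n v. norm (\<Gamma> n v) \<le> N n * norm v" and N: "\<And>n. 0 < N n"
    and lower: "\<And>n v. norm v \<le> \<Psi> n * norm (\<Gamma> n v)" and \<Psi>: "\<And>n. 0 < \<Psi> n" "\<And>n. \<Psi> n \<le> C"
    and NP: "\<And>n. 1 \<le> N n * \<Psi> n"
    and res: "\<And>n. norm (\<Gamma> n (d n) + g (w n)) \<le> \<epsilon> * norm (g (w n)) / (N n * \<Psi> n)"
    and \<epsilon>: "0 < \<epsilon>" "\<epsilon> < 1"
    and slope: "\<And>n. slope n = g (w n) \<bullet> d n + D (g (w n)) \<bullet> K' n (d n)"
    and descent: "\<And>n. slope n \<le> - \<eta> * (norm (g (w n)))\<^sup>2 / 2"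
    and \<beta>: "\<beta> < 1/2" and "\<eta> > 0"
    and cap: "\<And>n. \<epsilon> * (\<Psi> n + \<eta>s) \<le> (1/2 - \<beta>) * \<eta> / 4"
  shows "\<forall>\<^sub>F n in sequentially. m (w n + d n) \<le> m (w n) + \<beta> * slope n"
proof -
  define e where "e n = w n - ws" for n
  define x where "x n = e n + d n" for n
  define G where "G n = g (w n)" for n
  define r where "r n = \<Gamma> n (d n) + G n" for n
  \<comment> \<open>This is the bilinear form of \<open>K + K D K\<close>, the limiting second-order
    model of \<open>m\<close>; it is symmetric because \<open>K\<close> and \<open>D\<close>
    are.\<close>
  define B where "B u v = K u \<bullet> v + D (K u) \<bullet> K v" for u v
  let ?E = "\<lambda>n. norm (e n)"
  have C: "C > 0" using \<Psi>[of 0] by linarith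
  have K: "bounded_linear K" using g by (rule has_derivative_bounded_linear)
  note linK = bounded_linear.linear[OF K] and linD = bounded_linear.linear[OF D]
  have w_e: "w n = ws + e n" and wd_x: "w n + d n = ws + x n" for n by (simp_all add: e_def x_def)
  have e0: "e \<longlonglongrightarrow> 0" unfolding e_def using w by (simp add: LIM_zero)
  have gK: "(\<lambda>n. norm (G n - K (e n))) \<in> o(?E)"
    unfolding G_def w_e by (rule second_order_expansion(1)[OF L g g0 e0])
  have EO: "?E \<in> O(?E)" by simp
  have KeO: "(\<lambda>n. norm (K (e n))) \<in> O(?E)" by (rule linear_bigo[OF K])
  have GO: "(\<lambda>n. norm (G n)) \<in> O(?E)" by (rule norm_bigo_of_diff_smallo[OF gK KeO])
  have model: "(\<lambda>n. norm (G n - \<Gamma> n (e n))) \<in> o(?E)"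
    using norm_diff_smallo[OF gK op_tendsto_smallo[OF \<Gamma> EO]] by simp
  \<comment> \<open>Only the order of magnitude of \<open>x\<close> matters here, so the contraction
    lemma is used with the crude slack 1.\<close>
  have contr: "\<forall>\<^sub>F n in sequentially. norm (x n) \<le> (\<epsilon> + 1) * ?E n"
    unfolding x_def using model res[folded G_def] \<epsilon>
    by (intro newton_step_contraction[OF lin upper N lower \<Psi> NP]) auto
  have xO: "(\<lambda>n. norm (x n)) \<in> O(?E)"
    by (rule landau_o.bigI[of "\<epsilon> + 1"]) (use contr \<epsilon> in auto)
  have x0: "x \<longlonglongrightarrow> 0"
    using contr tendsto_mult_right_zero[OF tendsto_norm_zero[OF e0]] by (rule Lim_null_comparison)
  have dO: "(\<lambda>n. norm (d n)) \<in> O(?E)"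
    using norm_add_bigo[OF xO, of "\<lambda>n. - e n"] EO by (simp add: x_def)
  have KdO: "(\<lambda>n. norm (K (d n))) \<in> O(?E)"
    by (rule landau_o.big.trans[OF linear_bigo[OF K] dO])
  have \<Gamma>d: "(\<lambda>n. norm (\<Gamma> n (d n) - K (d n))) \<in> o(?E)" by (rule op_tendsto_smallo[OF \<Gamma> dO])
  have \<Gamma>dO: "(\<lambda>n. norm (\<Gamma> n (d n))) \<in> O(?E)" by (rule norm_bigo_of_diff_smallo[OF \<Gamma>d KdO])
  have K'd: "(\<lambda>n. norm (K' n (d n) - K (d n))) \<in> o(?E)" by (rule op_tendsto_smallo[OF K' dO])
  have K'dO: "(\<lambda>n. norm (K' n (d n))) \<in> O(?E)" by (rule norm_bigo_of_diff_smallo[OF K'd KdO])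
  have rO: "(\<lambda>n. norm (r n)) \<in> O(?E)" unfolding r_def by (rule norm_add_bigo[OF \<Gamma>dO GO])
  \<comment> \<open>\<open>K e\<close> approximates the gradient and \<open>K d\<close> approximates
    \<open>\<Gamma> d\<close>; their sum therefore approximates the residual.\<close>
  have Kx: "(\<lambda>n. norm (K (x n) - r n)) \<in> o(?E)"
  proof -
    have "r n - K (x n) = (G n - K (e n)) + (\<Gamma> n (d n) - K (d n))" for n
      by (simp add: x_def r_def linear_add[OF linK])
    then have "norm (K (x n) - r n) = norm ((G n - K (e n)) + (\<Gamma> n (d n) - K (d n)))" for n
      by (simp add: norm_minus_commute)
    then show ?thesis using norm_add_smallo[OF gK \<Gamma>d] by simp
  qed
  \<comment> \<open>\<open>T1\<close> and \<open>T2\<close> are the errors of the quadratic model at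
    the new and old points, \<open>T3\<close> that of the slope, \<open>T4\<close> that of
    expressing \<open>B x d\<close> by the residual. The weights in \<open>err\<close> are those
    that make \<open>split\<close> an exact identity.\<close>
  define T1 where "T1 n = m (w n + d n) - m ws - 1/2 * B (x n) (x n)" for n
  define T2 where "T2 n = m (w n) - m ws - 1/2 * B (e n) (e n)" for n
  define T3 where "T3 n = slope n - B (e n) (d n)" for n
  define T4 where "T4 n = B (x n) (d n) - (r n \<bullet> d n + D (r n) \<bullet> \<Gamma> n (d n))" for n
  define err where "err n = T1 n - T2 n - 1/2 * T3 n + 1/2 * T4 n" for n
  have T1: "T1 \<in> o(\<lambda>n. ?E n * ?E n)"
  proof -
    have "T1 \<in> o(\<lambda>n. norm (x n) * norm (x n))"
      unfolding T1_def wd_x B_def by (rule merit_expansion[OF L g g0 x0 D m])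
    also have "(\<lambda>n. norm (x n) * norm (x n)) \<in> O(\<lambda>n. ?E n * ?E n)" by (rule landau_o.big.mult[OF xO xO])
    finally show ?thesis .
  qed
  have T2: "T2 \<in> o(\<lambda>n. ?E n * ?E n)"
    unfolding T2_def w_e B_def by (rule merit_expansion[OF L g g0 e0 D m])
  have T3: "T3 \<in> o(\<lambda>n. ?E n * ?E n)"
  proof -
    have eq: "T3 n = (G n - K (e n)) \<bullet> d n + D (G n - K (e n)) \<bullet> K' n (d n)
        + (K' n (d n) - K (d n)) \<bullet> D (K (e n))" for n
      by (simp add: T3_def B_def slope G_def linear_diff[OF linD] inner_diff_left inner_diff_right
          inner_commute)
    have DO: "(\<lambda>n. norm (D (K (e n)))) \<in> O(?E)"
      by (rule landau_o.big.trans[OF linear_bigo[OF D] KeO])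
    show ?thesis
      unfolding eq[abs_def]
      by (intro sum_in_smallo inner_smallo[OF gK dO] inner_smallo[OF linear_smallo[OF D gK] K'dO] inner_smallo[OF K'd DO])
  qed
  have T4: "T4 \<in> o(\<lambda>n. ?E n * ?E n)"
  proof -
    have eq: "T4 n = (K (x n) - r n) \<bullet> d n + D (K (x n) - r n) \<bullet> K (d n)
        - (\<Gamma> n (d n) - K (d n)) \<bullet> D (r n)" for n
      by (simp add: T4_def B_def linear_diff[OF linD] inner_diff_left inner_diff_right
          inner_commute)
    have DO: "(\<lambda>n. norm (D (r n))) \<in> O(?E)"
      by (rule landau_o.big.trans[OF linear_bigo[OF D] rO])
    show ?thesis
      unfolding eq[abs_def]
      by (intro sum_in_smallo inner_smallo[OF Kx dO] inner_smallo[OF linear_smallo[OF D Kx] KdO] inner_smallo[OF \<Gamma>d DO])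
  qed
  have err: "err \<in> o(\<lambda>n. ?E n * ?E n)"
    unfolding err_def using T1 T2 T3 T4 by (intro sum_in_smallo) auto
  have split: "m (w n + d n) - m (w n) - \<beta> * slope n
      = (1/2 - \<beta>) * slope n + 1/2 * (r n \<bullet> d n + D (r n) \<bullet> \<Gamma> n (d n)) + err n" for n
  proof -
    have "B u v = B v u" for u v
      unfolding B_def by (metis D_sym K_sym inner_commute)
    moreover have "B (u + v) z = B u z + B v z" "B z (u + v) = B z u + B z v" for u v z
      by (simp_all add: B_def linear_add[OF linK] linear_add[OF linD] inner_add_left inner_add_right)
    ultimately have "B (x n) (x n) - B (e n) (e n) = B (x n) (d n) + B (e n) (d n)"
      by (simp add: x_def)
    then show ?thesis by (simp add: err_def T1_def T2_def T3_def T4_def field_simps)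
  qed
  define \<kappa> where "\<kappa> = (1/2 - \<beta>) * \<eta>"
  have \<kappa>: "\<kappa> > 0" using \<beta> \<open>\<eta> > 0\<close> by (simp add: \<kappa>_def)
  \<comment> \<open>With the first tolerance the model error absorbs half of \<open>norm e\<close>,
    giving \<open>norm e \<le> 2 * C * norm g\<close>. Squaring this produces
    \<open>4 * C^2\<close>, so the second tolerance leaves \<open>\<kappa> / 4\<close>.\<close>
  have "1 / (2 * C) > 0" "\<kappa> / (16 * C\<^sup>2) > 0" using C \<kappa> by simp_all
  from landau_o.smallD[OF model this(1)] landau_o.smallD[OF err this(2)]
  show ?thesis
  proof eventually_elim
    case (elim n)
    let ?g = "norm (G n)"
    have "norm (e n) \<le> \<Psi> n * norm (\<Gamma> n (e n))" by (rule lower)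
    also have "\<dots> \<le> C * norm (\<Gamma> n (e n))" using \<Psi> by (intro mult_right_mono) auto
    also have "\<dots> \<le> C * (?g + norm (G n - \<Gamma> n (e n)))"
      using C norm_triangle_ineq4[of "G n" "G n - \<Gamma> n (e n)"] by simp
    also have "\<dots> \<le> C * (?g + 1 / (2 * C) * ?E n)" using elim(1) C by simp
    also have "\<dots> = C * ?g + ?E n / 2" using C by (simp add: field_simps)
    finally have Eg: "?E n \<le> 2 * C * ?g" by simp
    have "\<bar>err n\<bar> \<le> \<kappa> / (16 * C\<^sup>2) * (?E n * ?E n)" using elim(2) by simp
    also have "\<dots> \<le> \<kappa> / (16 * C\<^sup>2) * ((2 * C * ?g) * (2 * C * ?g))"
      using Eg \<kappa> C by (intro mult_left_mono mult_mono) auto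
    also have "\<dots> = \<kappa> / 4 * ?g\<^sup>2" using C by (simp add: power2_eq_square)
    finally have 1: "err n \<le> \<kappa> / 4 * ?g\<^sup>2" by simp
    have "norm (r n) \<le> \<epsilon> * ?g / (N n * \<Psi> n)" using res[of n] by (simp add: r_def G_def)
    also have "\<dots> \<le> \<epsilon> * ?g / 1"
      using NP[of n] \<epsilon> by (intro divide_left_mono) auto
    finally have r1: "norm (r n) \<le> \<epsilon> * ?g" by simp
    also have "\<dots> \<le> ?g" using \<epsilon> by (intro mult_left_le_one_le) auto
    finally have r2: "norm (r n) \<le> ?g" .
    have "\<Gamma> n (d n) = r n - G n" by (simp add: r_def)
    then have \<Gamma>g: "norm (\<Gamma> n (d n)) \<le> 2 * ?g"
      using norm_triangle_ineq4[of "r n" "G n"] r2 by simp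
    have "r n \<bullet> d n \<le> norm (r n) * (\<Psi> n * norm (\<Gamma> n (d n)))"
      by (rule order_trans[OF norm_cauchy_schwarz]) (simp add: lower mult_left_mono)
    moreover have "D (r n) \<bullet> \<Gamma> n (d n) \<le> (\<eta>s * norm (r n)) * norm (\<Gamma> n (d n))"
      by (rule order_trans[OF norm_cauchy_schwarz]) (simp add: D_bound mult_right_mono)
    ultimately have "r n \<bullet> d n + D (r n) \<bullet> \<Gamma> n (d n)
        \<le> norm (r n) * ((\<Psi> n + \<eta>s) * norm (\<Gamma> n (d n)))"
      by (simp add: algebra_simps)
    also have "\<dots> \<le> \<epsilon> * ?g * ((\<Psi> n + \<eta>s) * (2 * ?g))"
      using r1 \<Gamma>g \<Psi>(1)[of n] \<open>0 \<le> \<eta>s\<close> \<epsilon> by (intro mult_mono) auto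
    also have "\<dots> = \<epsilon> * (\<Psi> n + \<eta>s) * (2 * ?g\<^sup>2)" by (simp add: power2_eq_square)
    also have "\<dots> \<le> \<kappa> / 4 * (2 * ?g\<^sup>2)" using cap[of n] by (intro mult_right_mono) (auto simp: \<kappa>_def)
    finally have 2: "1/2 * (r n \<bullet> d n + D (r n) \<bullet> \<Gamma> n (d n)) \<le> \<kappa> / 4 * ?g\<^sup>2" by simp
    \<comment> \<open>The budget closes: the slope contributes at most \<open>- \<kappa> / 2\<close>
      times the squared gradient norm, while the residual and \<open>err\<close> contribute at most
      \<open>\<kappa> / 4\<close> each.\<close>
    have "(1/2 - \<beta>) * slope n \<le> (1/2 - \<beta>) * (- \<eta> * ?g\<^sup>2 / 2)"
      using descent[of n] \<beta> by (intro mult_left_mono) (auto simp: G_def)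
    then have "(1/2 - \<beta>) * slope n \<le> - \<kappa> / 2 * ?g\<^sup>2" by (simp add: \<kappa>_def)
    with 1 2 split[of n] show ?case by (simp add: algebra_simps)
  qed
qed

section \<open>Invertibility of saddle-point matrices and the least singular value\<close>

lemma orthonormal_inner:
  assumes "pairwise orthogonal B" "\<And>x. x \<in> B \<Longrightarrow> norm x = 1" "b \<in> B" "b' \<in> B"
  shows "b \<bullet> b' = (if b = b' then 1 else 0)"
  using assms by (auto simp: pairwise_def orthogonal_def norm_eq_1)

text \<open>Expanding \<open>v\<close> in an orthonormal basis of the kernel turns both sides into
  the coefficient sums of \<open>reduced_ge\<close>; such a basis exists, so the quantifier over
  bases can be instantiated.\<close>

lemma reduced_ge_on_kernel:
  fixes T :: "'a::euclidean_space \<Rightarrow> 'a" and G :: "'a \<Rightarrow> 'b::real_vector"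
  assumes "reduced_ge T G \<gamma>" "linear T" "linear G" "G v = 0"
  shows "\<gamma> * (v \<bullet> v) \<le> v \<bullet> T v"
proof -
  have "subspace {v. G v = 0}" using linear_subspace_kernel[OF assms(3)] by simp
  then obtain B where B: "pairwise orthogonal B" "\<And>x. x \<in> B \<Longrightarrow> norm x = 1" "independent B"
      "span B = {v. G v = 0}"
    by (metis orthonormal_basis_subspace)
  have fin: "finite B" using B(3) by (rule independent_imp_finite)
  have ort: "b \<bullet> b' = (if b = b' then 1 else 0)" if "b \<in> B" "b' \<in> B" for b b'
    using orthonormal_inner[OF B(1,2) that] .
  have "v \<in> span B" using B(4) assms(4) by simp
  then obtain c where v: "v = (\<Sum>b\<in>B. c b *\<^sub>R b)" using span_finite[OF fin] by auto
  have "v \<bullet> v = (\<Sum>b\<in>B. \<Sum>b'\<in>B. c b * (c b' * (b \<bullet> b')))"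
    by (simp add: v inner_sum_left inner_sum_right mult.left_commute inner_commute)
  also have "\<dots> = (\<Sum>b\<in>B. \<Sum>b'\<in>B. if b = b' then (c b)\<^sup>2 else 0)"
    by (intro sum.cong refl) (auto simp: ort power2_eq_square)
  also have "\<dots> = (\<Sum>b\<in>B. (c b)\<^sup>2)" using fin by simp
  finally have vv: "v \<bullet> v = (\<Sum>b\<in>B. (c b)\<^sup>2)" .
  have "T v = (\<Sum>b\<in>B. c b *\<^sub>R T b)"
    by (simp add: v linear_sum[OF assms(2)] linear_scale[OF assms(2)])
  then have *: "b \<bullet> T v = (\<Sum>b'\<in>B. (b \<bullet> T b') * c b')" for b
    by (simp add: inner_sum_right mult.commute)
  have "v \<bullet> T v = (\<Sum>b\<in>B. c b * (b \<bullet> T v))"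
    by (subst (1) v) (simp add: inner_sum_left)
  then have "v \<bullet> T v = (\<Sum>b\<in>B. \<Sum>b'\<in>B. c b * (b \<bullet> T b') * c b')"
    by (simp add: * sum_distrib_left mult.assoc)
  moreover have "orthonormal_basis_of B {v. G v = 0}"
    using B by (auto simp: orthonormal_basis_of_def)
  ultimately show ?thesis using assms(1) unfolding reduced_ge_def vv by simp
qed

text \<open>Split \<open>p\<close> into \<open>y\<close> in the range of \<open>adjoint G\<close>
  and \<open>z\<close> in the kernel of \<open>G\<close>. The second row controls \<open>y\<close>,
  coercivity on the kernel then controls \<open>z\<close>, and the first row finally controls
  \<open>adjoint G q\<close> and hence \<open>q\<close>.\<close>

lemma saddle_lower_bound:
  fixes H :: "'a::euclidean_space \<Rightarrow> 'a" and G :: "'a \<Rightarrow> 'b::euclidean_space"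
  assumes H: "linear H" and G: "linear G" and \<gamma>: "0 < \<gamma>" "\<gamma> \<le> 1" and c: "0 < c" "c \<le> 1"
    and h: "1 \<le> h" "\<And>v. norm (H v) \<le> h * norm v"
    and ker: "\<And>v. G v = 0 \<Longrightarrow> \<gamma> * (v \<bullet> v) \<le> v \<bullet> H v"
    and adj: "\<And>y. c * norm y \<le> norm (adjoint G y)"
  shows "norm (p, q) \<le> 20 * h\<^sup>2 / (\<gamma> * c\<^sup>2) * norm (H p + adjoint G q, G p)"
proof -
  define A where "A = norm (H p + adjoint G q)"
  define B where "B = norm (G p)"
  define \<rho> where "\<rho> = h\<^sup>2 / (\<gamma> * c\<^sup>2)"
  have G': "linear (adjoint G)" by (rule adjoint_linear[OF G])
  have "subspace (range (adjoint G))" using linear_subspace_image[OF G'] by simp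
  then have span: "span (range (adjoint G)) = range (adjoint G)" by (simp add: span_eq_iff)
  obtain y z where y: "y \<in> range (adjoint G)" and z: "\<And>w. w \<in> range (adjoint G) \<Longrightarrow> orthogonal z w"
    and p: "p = y + z"
    using orthogonal_subspace_decomp_exists[of "range (adjoint G)" p] unfolding span by metis
  from y obtain u where u: "y = adjoint G u" by auto
  \<comment> \<open>The orthogonal complement of the range of \<open>adjoint G\<close> is the kernel
    of \<open>G\<close>: test \<open>z\<close> against \<open>adjoint G (G z)\<close>.\<close>
  have "G z \<bullet> G z = 0"
    using z[of "adjoint G (G z)"] by (simp add: orthogonal_def adjoint_works[OF G])
  then have Gz: "G z = 0" by simp
  then have Gy: "G p = G y" by (simp add: p linear_add[OF G])
  \<comment> \<open>With \<open>y = adjoint G u\<close>, the squared norm of \<open>y\<close> is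
    \<open>G y \<bullet> u\<close>, and \<open>adj\<close> bounds \<open>c * norm u\<close> by
    \<open>norm y\<close>.\<close>
  have yB: "c * norm y \<le> B"
  proof (cases "y = 0")
    case False
    have "(norm y)\<^sup>2 = G y \<bullet> u"
      by (simp add: u power2_norm_eq_inner adjoint_works[OF G])
    also have "\<dots> \<le> B * norm u" unfolding B_def Gy by (rule norm_cauchy_schwarz)
    finally have "c * (norm y)\<^sup>2 \<le> B * (c * norm u)" using c by (simp add: mult.left_commute)
    also have "\<dots> \<le> B * norm y" using adj[of u] by (intro mult_left_mono) (auto simp: u B_def)
    finally show ?thesis using False by (simp add: power2_eq_square)
  qed (simp add: B_def)
  \<comment> \<open>Pairing the first row with \<open>z\<close> eliminates \<open>q\<close>, since
    \<open>z\<close> is orthogonal to the range of \<open>adjoint G\<close>.\<close>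
  have zA: "\<gamma> * norm z \<le> A + h * norm y"
  proof (cases "z = 0")
    case False
    have "z \<bullet> adjoint G q = 0" using z[of "adjoint G q"] by (simp add: orthogonal_def)
    then have "z \<bullet> H z = z \<bullet> ((H p + adjoint G q) - H y)"
      by (simp add: p linear_add[OF H] inner_simps)
    also have "\<dots> \<le> norm z * norm ((H p + adjoint G q) - H y)" by (rule norm_cauchy_schwarz)
    also have "\<dots> \<le> norm z * (A + h * norm y)"
      using norm_triangle_ineq4[of "H p + adjoint G q" "H y"] h(2)[of y]
      unfolding A_def by (intro mult_left_mono) auto
    finally have "\<gamma> * (z \<bullet> z) \<le> norm z * (A + h * norm y)" using ker[OF Gz] by linarith
    then show ?thesis using False by (simp add: power2_norm_eq_inner[symmetric] power2_eq_square mult_ac)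
  qed (use h in \<open>simp add: A_def\<close>)
  have A0: "A \<ge> 0" and B0: "B \<ge> 0" by (simp_all add: A_def B_def)
  have y1: "norm y \<le> B / c" using yB c by (simp add: field_simps)
  have z1: "norm z \<le> (A + h * (B / c)) / \<gamma>"
  proof -
    have "\<gamma> * norm z \<le> A + h * (B / c)"
      using zA mult_left_mono[OF y1, of h] h(1) by linarith
    then show ?thesis using \<gamma> by (simp add: field_simps)
  qed
  have q1: "norm q \<le> (A + h * (norm y + norm z)) / c"
  proof -
    have "norm (adjoint G q) = norm ((H p + adjoint G q) - H p)" by simp
    also have "\<dots> \<le> A + h * norm p" unfolding A_def using h(2)[of p] by (intro norm_triangle_le_diff) simp
    also have "\<dots> \<le> A + h * (norm y + norm z)"
      using h(1) norm_triangle_ineq[of y z] by (simp add: p)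
    finally have "c * norm q \<le> A + h * (norm y + norm z)" using adj[of q] by linarith
    then show ?thesis using c by (simp add: field_simps)
  qed
  have ge1: "1 \<le> 1 / c" "1 \<le> 1 / \<gamma>" using c \<gamma> by simp_all
  have \<rho>: "\<rho> = (h * h) * (1 / \<gamma>) * (1 / c) * (1 / c)" by (simp add: \<rho>_def power2_eq_square)
  have hh: "1 \<le> h * h" "h \<le> h * h" using h(1) mult_mono[of 1 h 1 h] mult_left_mono[of 1 h h] by simp_all
  \<comment> \<open>Each coefficient below is dominated by \<open>\<rho>\<close> factor by factor,
    because \<open>h\<close>, \<open>1 / \<gamma>\<close> and \<open>1 / c\<close> are all at least
    1.\<close>
  have mono: "t1 * t2 * t3 * t4 \<le> \<rho>"
    if "t1 \<le> h * h" "t2 \<le> 1 / \<gamma>" "t3 \<le> 1 / c" "t4 \<le> 1 / c" "0 \<le> t1" "0 \<le> t2" "0 \<le> t3" "0 \<le> t4" for t1 t2 t3 t4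
    unfolding \<rho> using that h(1) \<gamma> c by (intro mult_mono) auto
  have b: "1 / c \<le> \<rho>" "1 / \<gamma> \<le> \<rho>" "h / (\<gamma> * c) \<le> \<rho>" "h / c \<le> \<rho>" "h / (\<gamma> * c * c) \<le> \<rho>"
    "h * h / (\<gamma> * c * c) \<le> \<rho>" "h / (c * c) \<le> \<rho>"
    using mono[of 1 1 "1/c" 1] mono[of 1 "1/\<gamma>" 1 1] mono[of h "1/\<gamma>" "1/c" 1] mono[of h 1 "1/c" 1]
      mono[of h "1/\<gamma>" "1/c" "1/c"] mono[of "h*h" "1/\<gamma>" "1/c" "1/c"] mono[of h 1 "1/c" "1/c"] hh ge1 h(1) c \<gamma>
    by simp_all
  have z2: "norm z \<le> \<rho> * A + \<rho> * B"
  proof -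
    have "(A + h * (B / c)) / \<gamma> = (1 / \<gamma>) * A + (h / (\<gamma> * c)) * B" by (simp add: field_simps add_divide_distrib)
    then show ?thesis using z1 mult_right_mono[OF b(2) A0] mult_right_mono[OF b(3) B0] by linarith
  qed
  have y2: "norm y \<le> \<rho> * B" using y1 mult_right_mono[OF b(1) B0] by simp
  have q2: "norm q \<le> 2 * \<rho> * A + 2 * \<rho> * B"
  proof -
    have "h * (norm y + norm z) \<le> h * (B / c + (A + h * (B / c)) / \<gamma>)"
      using y1 z1 h(1) by (intro mult_left_mono) auto
    then have "norm q \<le> (A + h * (B / c + (A + h * (B / c)) / \<gamma>)) / c"
      using q1 divide_right_mono[of "A + h * (norm y + norm z)" "A + h * (B / c + (A + h * (B / c)) / \<gamma>)" c] c
      by linarith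
    also have "\<dots> = (1 / c) * A + (h / (\<gamma> * c)) * A + (h / (c * c)) * B + (h * h / (\<gamma> * c * c)) * B"
      using c \<gamma> by (simp add: field_simps)
    also have "\<dots> \<le> \<rho> * A + \<rho> * A + \<rho> * B + \<rho> * B"
      using mult_right_mono[OF b(1) A0] mult_right_mono[OF b(3) A0] mult_right_mono[OF b(7) B0]
        mult_right_mono[OF b(6) B0] by linarith
    finally show ?thesis by linarith
  qed
  have "\<rho> \<ge> 0" using b(1) ge1 by linarith
  have "norm (p, q) \<le> norm p + norm q" by (rule norm_Pair_le)
  also have "\<dots> \<le> norm y + norm z + norm q" using norm_triangle_ineq[of y z] by (simp add: p)
  \<comment> \<open>In units of \<open>\<rho>\<close>, \<open>y\<close> contributes
    \<open>B\<close>, \<open>z\<close> contributes \<open>A + B\<close> and \<open>q\<close>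
    contributes \<open>2 * A + 2 * B\<close>. The constant 20 is generous and matches the one in
    \<open>Psi\<close>.\<close>
  also have "\<dots> \<le> \<rho> * (3 * A + 4 * B)" using y2 z2 q2 by (simp add: algebra_simps)
  also have "\<dots> \<le> \<rho> * (20 * norm (H p + adjoint G q, G p))"
  proof (intro mult_left_mono \<open>\<rho> \<ge> 0\<close>)
    have "A \<le> norm (H p + adjoint G q, G p)" "B \<le> norm (H p + adjoint G q, G p)"
      unfolding A_def B_def by (metis norm_fst_le fst_conv, metis norm_snd_le snd_conv)
    then show "3 * A + 4 * B \<le> 20 * norm (H p + adjoint G q, G p)" using A0 B0 by linarith
  qed
  finally show ?thesis by (simp add: \<rho>_def mult_ac)
qed

text \<open>A minimiser of the Rayleigh quotient of \<open>T T\<^sup>T\<close> on the unit sphere is an eigenvector.\<close>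

lemma least_singular_value_attained:
  fixes T :: "'a::euclidean_space \<Rightarrow> 'b::euclidean_space"
  assumes T: "linear T"
  obtains s v where "0 \<le> s" "v \<noteq> 0" "T (adjoint T v) = s\<^sup>2 *\<^sub>R v"
    "\<And>y. s * norm y \<le> norm (adjoint T y)"
proof -
  have A: "linear (adjoint T)" by (rule adjoint_linear[OF T])
  have "compact (sphere 0 1 :: 'b set)" "(sphere 0 1 :: 'b set) \<noteq> {}" by auto
  moreover have "continuous_on (sphere 0 1) (\<lambda>v. norm (adjoint T v))"
    by (intro continuous_on_norm linear_continuous_on linear_conv_bounded_linear[THEN iffD1] A)
  ultimately obtain v where v: "norm v = 1" and min: "\<And>y. norm y = 1 \<Longrightarrow> norm (adjoint T v) \<le> norm (adjoint T y)"
    using continuous_attains_inf[of "sphere (0::'b) 1" "\<lambda>v. norm (adjoint T v)"] by auto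
  define s where "s = norm (adjoint T v)"
  have low: "s * norm y \<le> norm (adjoint T y)" for y
  proof (cases "y = 0")
    case False
    then have "norm (y /\<^sub>R norm y) = 1" by simp
    from min[OF this] have "s \<le> norm (adjoint T y) / norm y"
      by (simp add: s_def linear_scale[OF A] divide_inverse_commute)
    then show ?thesis using False by (simp add: field_simps)
  qed (simp add: linear_0[OF A])
  have quad: "s\<^sup>2 * (y \<bullet> y) \<le> T (adjoint T y) \<bullet> y" for y
  proof -
    have "(s * norm y)\<^sup>2 \<le> (norm (adjoint T y))\<^sup>2" using low by (intro power_mono) (auto simp: s_def)
    then show ?thesis
      by (simp add: power_mult_distrib power2_norm_eq_inner adjoint_works[OF T])
  qed
  define R where "R = T (adjoint T v) - s\<^sup>2 *\<^sub>R v"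
  have vR: "v \<bullet> R = 0"
  proof -
    have "s\<^sup>2 = v \<bullet> T (adjoint T v)"
      by (simp add: s_def power2_norm_eq_inner adjoint_works[OF T] inner_commute)
    then show ?thesis using v by (simp add: R_def inner_diff_right norm_eq_1)
  qed
  have "R \<bullet> R = 0"
  proof (rule ccontr)
    assume "R \<bullet> R \<noteq> 0"
    then have RR: "R \<bullet> R > 0" using inner_ge_zero[of R] by linarith
    define k where "k = T (adjoint T R) \<bullet> R - s\<^sup>2 * (R \<bullet> R)"
    have k: "k \<ge> 0" using quad[of R] by (simp add: k_def)
    \<comment> \<open>The form of \<open>T T^T - s^2 I\<close> is nonnegative and zero at
      \<open>v\<close>; moving by \<open>t\<close> along \<open>R\<close> gives it the value
      \<open>2 * t * (R \<bullet> R) + t^2 * k\<close>. This negative \<open>t\<close> is small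
      enough for the linear term to win, and the added 1 covers \<open>k = 0\<close>.\<close>
    define t where "t = - (R \<bullet> R) / (k + 1)"
    have sym: "T (adjoint T x) \<bullet> y = T (adjoint T y) \<bullet> x" for x y
      by (metis adjoint_works[OF T] inner_commute)
    have "0 \<le> T (adjoint T (v + t *\<^sub>R R)) \<bullet> (v + t *\<^sub>R R) - s\<^sup>2 * ((v + t *\<^sub>R R) \<bullet> (v + t *\<^sub>R R))"
      using quad[of "v + t *\<^sub>R R"] by simp
    also have "\<dots> = R \<bullet> v + 2 * t * (R \<bullet> R) + t\<^sup>2 * k"
    proof -
      have "T (adjoint T (v + t *\<^sub>R R)) \<bullet> (v + t *\<^sub>R R)
        = T (adjoint T v) \<bullet> v + 2 * t * (T (adjoint T v) \<bullet> R) + t\<^sup>2 * (T (adjoint T R) \<bullet> R)"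
        using sym[of R v] by (simp add: linear_add[OF A] linear_scale[OF A] linear_add[OF T] linear_scale[OF T]
            inner_add_left inner_add_right power2_eq_square algebra_simps)
      moreover have "(v + t *\<^sub>R R) \<bullet> (v + t *\<^sub>R R) = v \<bullet> v + 2 * t * (v \<bullet> R) + t\<^sup>2 * (R \<bullet> R)"
        by (simp add: inner_add_left inner_add_right power2_eq_square algebra_simps inner_commute)
      moreover have "T (adjoint T v) = R + s\<^sup>2 *\<^sub>R v" by (simp add: R_def)
      ultimately show ?thesis by (simp add: k_def inner_add_left algebra_simps)
    qed
    also have "\<dots> = t * (2 * (R \<bullet> R) + t * k)" using vR by (simp add: power2_eq_square inner_commute algebra_simps)
    finally have *: "0 \<le> t * (2 * (R \<bullet> R) + t * k)" .
    have "t < 0" using RR k by (simp add: t_def field_simps)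
    moreover have "- t * k \<le> R \<bullet> R" using RR k by (simp add: t_def field_simps)
    then have "2 * (R \<bullet> R) + t * k > 0" using RR by linarith
    ultimately have "t * (2 * (R \<bullet> R) + t * k) < 0" by (rule mult_neg_pos)
    then show False using * by linarith
  qed
  then have "T (adjoint T v) = s\<^sup>2 *\<^sub>R v" by (simp add: R_def)
  moreover have "v \<noteq> 0" using v by auto
  moreover have "0 \<le> s" by (simp add: s_def)
  ultimately show ?thesis using that low by blast
qed

text \<open>The attained value \<open>s\<close> belongs to the set whose infimum is
  \<open>sigma_min T\<close>, and \<open>s\<close> already satisfies the estimate.\<close>

lemma sigma_min_le:
  fixes T :: "'a::euclidean_space \<Rightarrow> 'b::euclidean_space"
  assumes T: "linear T"
  shows "sigma_min T * norm y \<le> norm (adjoint T y)"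
proof -
  obtain s v where s: "0 \<le> s" "v \<noteq> 0" "T (adjoint T v) = s\<^sup>2 *\<^sub>R v" "s * norm y \<le> norm (adjoint T y)"
    using least_singular_value_attained[OF T] by metis
  have "sigma_min T \<le> s" unfolding sigma_min_def
    by (rule cInf_lower) (use s in \<open>auto intro!: bdd_belowI[of _ 0]\<close>)
  then show ?thesis using s(4) mult_right_mono[of "sigma_min T" s "norm y"] by simp
qed

text \<open>An eigenvector \<open>v\<close> for the singular value \<open>s\<close> satisfies
  \<open>norm (adjoint T v) = s * norm v\<close>, so \<open>c\<close> is below every singular
  value.\<close>

lemma sigma_min_ge:
  fixes T :: "'a::euclidean_space \<Rightarrow> 'b::euclidean_space"
  assumes T: "linear T" and c: "\<And>y. c * norm y \<le> norm (adjoint T y)"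
  shows "c \<le> sigma_min T"
  unfolding sigma_min_def
proof (rule cInf_greatest)
  \<comment> \<open>A lower bound of a set of reals bounds its \<open>Inf\<close> only if the set is
    nonempty; the attained least singular value provides a member.\<close>
  show "{s. 0 \<le> s \<and> (\<exists>v. v \<noteq> 0 \<and> T (adjoint T v) = s\<^sup>2 *\<^sub>R v)} \<noteq> {}"
    by (rule least_singular_value_attained[OF T]) blast
  fix s assume "s \<in> {s. 0 \<le> s \<and> (\<exists>v. v \<noteq> 0 \<and> T (adjoint T v) = s\<^sup>2 *\<^sub>R v)}"
  then obtain v where s: "0 \<le> s" "v \<noteq> 0" "T (adjoint T v) = s\<^sup>2 *\<^sub>R v" by auto
  have "(norm (adjoint T v))\<^sup>2 = T (adjoint T v) \<bullet> v"
    by (simp add: power2_norm_eq_inner adjoint_works[OF T])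
  also have "\<dots> = (s * norm v)\<^sup>2" using s(3) by (simp add: power_mult_distrib power2_norm_eq_inner)
  finally have "norm (adjoint T v) = s * norm v" using s(1) by (simp add: power2_eq_iff_nonneg)
  then show "c \<le> s" using c[of v] s(2) by simp
qed

section \<open>Calculus of twice continuously differentiable maps, gradients and adjoints\<close>

text \<open>Derivatives are kept as plain functions, and the second one is taken for each fixed
  first direction. Compositions with linear maps and finite sums then have explicit derivatives. In
  \<open>D2 x k h\<close> the direction of the second differentiation is \<open>k\<close>.\<close>

definition C2_derivs ::
  "('a::real_normed_vector \<Rightarrow> 'b::real_normed_vector) \<Rightarrow> ('a \<Rightarrow> 'a \<Rightarrow> 'b) \<Rightarrow> ('a \<Rightarrow> 'a \<Rightarrow> 'a \<Rightarrow> 'b) \<Rightarrow> bool"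
where
  "C2_derivs f D1 D2 \<longleftrightarrow>
    (\<forall>x. (f has_derivative D1 x) (at x)) \<and>
    (\<forall>x h. ((\<lambda>x. D1 x h) has_derivative (\<lambda>k. D2 x k h)) (at x)) \<and>
    (\<forall>k h. continuous_on UNIV (\<lambda>x. D2 x k h))"

lemma C2_derivsD:
  assumes "C2_derivs f D1 D2"
  shows "(f has_derivative D1 x) (at x)"
    "((\<lambda>x. D1 x h) has_derivative (\<lambda>k. D2 x k h)) (at x)"
    "continuous_on UNIV (\<lambda>x. D2 x k h)"
  using assms unfolding C2_derivs_def by blast+

lemma C3_imp_C2_derivs:
  assumes "C3 f"
  obtains D1 D2 where "C2_derivs f D1 D2"
proof -
  from assms obtain D1 D2 D3 where
    D: "\<And>x. (f has_derivative blinfun_apply (D1 x)) (at x)"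
      "\<And>x. (D1 has_derivative blinfun_apply (D2 x)) (at x)"
      "\<And>x. (D2 has_derivative blinfun_apply (D3 x)) (at x)"
    unfolding C3_def by blast
  have "continuous_on UNIV D2"
    by (intro continuous_at_imp_continuous_on ballI has_derivative_continuous[OF D(3)])
  then have "continuous_on UNIV (\<lambda>x. D2 x k h)" for k h
    by (intro continuous_intros)
  moreover have "((\<lambda>x. D1 x h) has_derivative (\<lambda>k. D2 x k h)) (at x)" for x h
    by (rule bounded_linear.has_derivative[OF blinfun.bounded_linear_left D(2)])
  ultimately have "C2_derivs f (\<lambda>x h. D1 x h) (\<lambda>x k h. D2 x k h)"
    using D(1) by (simp add: C2_derivs_def)
  then show ?thesis by (rule that)
qed

lemma C2_derivs_compose_right:
  assumes f: "C2_derivs f D1 D2" and T: "bounded_linear T"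
  shows "C2_derivs (\<lambda>x. f (T x)) (\<lambda>x h. D1 (T x) (T h)) (\<lambda>x k h. D2 (T x) (T k) (T h))"
proof -
  note T' = bounded_linear_imp_has_derivative[OF T]
  show ?thesis unfolding C2_derivs_def
    using has_derivative_compose[OF T' C2_derivsD(1)[OF f]] has_derivative_compose[OF T' C2_derivsD(2)[OF f]]
      continuous_on_compose2[OF C2_derivsD(3)[OF f] linear_continuous_on[OF T]]
    by auto
qed

lemma C2_derivs_compose_left:
  assumes f: "C2_derivs f D1 D2" and T: "bounded_linear T"
  shows "C2_derivs (\<lambda>x. T (f x)) (\<lambda>x h. T (D1 x h)) (\<lambda>x k h. T (D2 x k h))"
  unfolding C2_derivs_def
  using bounded_linear.has_derivative[OF T C2_derivsD(1)[OF f]]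
    bounded_linear.has_derivative[OF T C2_derivsD(2)[OF f]]
    continuous_on_compose2[OF linear_continuous_on[OF T, of UNIV] C2_derivsD(3)[OF f]]
  by auto

lemma C2_derivs_linear: "bounded_linear T \<Longrightarrow> C2_derivs T (\<lambda>x. T) (\<lambda>_ _ _. 0)"
  by (auto simp: C2_derivs_def intro: bounded_linear_imp_has_derivative)

lemma C2_derivs_const: "C2_derivs (\<lambda>_. c) (\<lambda>_ _. 0) (\<lambda>_ _ _. 0)"
  by (auto simp: C2_derivs_def)

lemma C2_derivs_add:
  assumes "C2_derivs f D1 D2" "C2_derivs g E1 E2"
  shows "C2_derivs (\<lambda>x. f x + g x) (\<lambda>x h. D1 x h + E1 x h) (\<lambda>x k h. D2 x k h + E2 x k h)"
  using assms by (auto simp: C2_derivs_def intro!: has_derivative_add continuous_on_add)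

lemma C2_derivs_diff:
  assumes "C2_derivs f D1 D2" "C2_derivs g E1 E2"
  shows "C2_derivs (\<lambda>x. f x - g x) (\<lambda>x h. D1 x h - E1 x h) (\<lambda>x k h. D2 x k h - E2 x k h)"
  using assms by (auto simp: C2_derivs_def intro!: has_derivative_diff continuous_on_diff)

lemma C2_derivs_sum:
  assumes "\<And>i. i \<in> I \<Longrightarrow> C2_derivs (f i) (D1 i) (D2 i)"
  shows "C2_derivs (\<lambda>x. \<Sum>i\<in>I. f i x) (\<lambda>x h. \<Sum>i\<in>I. D1 i x h) (\<lambda>x k h. \<Sum>i\<in>I. D2 i x k h)"
  using assms by (auto simp: C2_derivs_def intro!: has_derivative_sum continuous_on_sum)

text \<open>\<open>grad\<close> chooses some gradient; uniqueness of the Frechet derivative leaves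
  only one candidate.\<close>

lemma grad_eqI:
  assumes "(f has_derivative (\<lambda>h. D \<bullet> h)) (at x)"
  shows "grad f x = D"
proof -
  have "GDERIV f x :> D" using assms by (simp add: gderiv_def inner_commute)
  moreover have "E = D" if "GDERIV f x :> E" for E
  proof -
    have "(f has_derivative (\<lambda>h. E \<bullet> h)) (at x)" using that by (simp add: gderiv_def inner_commute)
    from has_derivative_unique[OF this assms] have "E \<bullet> h = D \<bullet> h" for h by (rule fun_cong)
    then show ?thesis using vector_eq_rdot by blast
  qed
  ultimately show ?thesis unfolding grad_def by (rule some_equality)
qed

text \<open>The Riesz vector, assembled from the values of \<open>D\<close> on the basis, supplies
  the existence that the choice in \<open>grad\<close> presupposes.\<close>

lemma grad_inner:
  fixes f :: "'a::euclidean_space \<Rightarrow> real"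
  assumes f: "(f has_derivative D) (at x)"
  shows "grad f x \<bullet> h = D h"
proof -
  interpret D: linear D using f by (rule has_derivative_linear)
  have *: "(\<Sum>b\<in>Basis. D b *\<^sub>R b) \<bullet> h = D h" for h
  proof -
    have "D h = D (\<Sum>b\<in>Basis. (h \<bullet> b) *\<^sub>R b)" by (simp only: euclidean_representation)
    also have "\<dots> = (\<Sum>b\<in>Basis. (h \<bullet> b) * D b)" by (simp only: D.sum D.scale real_scaleR_def)
    also have "\<dots> = (\<Sum>b\<in>Basis. D b *\<^sub>R b) \<bullet> h"
      unfolding inner_sum_left inner_scaleR_left by (simp only: inner_commute[of h] mult.commute)
    finally show ?thesis by simp
  qed
  have "grad f x = (\<Sum>b\<in>Basis. D b *\<^sub>R b)" by (rule grad_eqI) (simp add: * f)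
  then show ?thesis by (simp add: *)
qed

lemma adjoint_Basis:
  fixes f :: "'a::euclidean_space \<Rightarrow> 'b::euclidean_space"
  assumes "linear f"
  shows "adjoint f y = (\<Sum>b\<in>Basis. (y \<bullet> f b) *\<^sub>R b)"
proof (rule euclidean_eqI)
  fix b :: 'a assume "b \<in> Basis"
  then show "adjoint f y \<bullet> b = (\<Sum>b\<in>Basis. (y \<bullet> f b) *\<^sub>R b) \<bullet> b"
    by (simp only: adjoint_clauses(2)[OF assms] inner_sum_left_Basis)
qed

section \<open>First and second derivatives of the Lagrangian\<close>

locale smooth_lagrangian =
  fixes c :: "'a::euclidean_space \<Rightarrow> real" and F :: "'a \<Rightarrow> 'b::euclidean_space" and c1 c2 F1 F2
  assumes c: "C2_derivs c c1 c2" and F: "C2_derivs F F1 F2"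
begin

definition "Lag w = c (fst w) + snd w \<bullet> F (fst w)"

text \<open>This is the Riesz vector of the derivative of \<open>Lag\<close> in its first argument.
  Spelling out the coordinates makes it a finite sum that can be differentiated termwise.\<close>

definition "gz w = (\<Sum>b\<in>Basis. (c1 (fst w) b + snd w \<bullet> F1 (fst w) b) *\<^sub>R b)"

definition "Hz w h = (\<Sum>b\<in>Basis. (c2 (fst w) h b + snd w \<bullet> F2 (fst w) h b) *\<^sub>R b)"

lemma linear_F1: "linear (F1 x)"
  using C2_derivsD(1)[OF F] by (rule has_derivative_linear)

lemma gz_inner: "gz w \<bullet> h = c1 (fst w) h + snd w \<bullet> F1 (fst w) h"
proof -
  interpret c1: linear "c1 (fst w)" using C2_derivsD(1)[OF c] by (rule has_derivative_linear)
  interpret F1: linear "F1 (fst w)" by (rule linear_F1)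
  have "c1 (fst w) h = c1 (fst w) (\<Sum>b\<in>Basis. (h \<bullet> b) *\<^sub>R b)"
    "F1 (fst w) h = F1 (fst w) (\<Sum>b\<in>Basis. (h \<bullet> b) *\<^sub>R b)"
    by (simp_all only: euclidean_representation)
  then have "c1 (fst w) h + snd w \<bullet> F1 (fst w) h
      = (\<Sum>b\<in>Basis. (h \<bullet> b) * c1 (fst w) b + (h \<bullet> b) * (snd w \<bullet> F1 (fst w) b))"
    by (simp only: c1.sum c1.scale F1.sum F1.scale inner_sum_right inner_scaleR_right real_scaleR_def
        sum.distrib)
  also have "\<dots> = (\<Sum>b\<in>Basis. (c1 (fst w) b + snd w \<bullet> F1 (fst w) b) * (b \<bullet> h))"
    by (rule sum.cong[OF refl]) (simp add: inner_commute[of h] algebra_simps)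
  finally show ?thesis by (simp add: gz_def inner_sum_left)
qed

lemma derivative_of_fst:
  assumes "(f has_derivative D) (at (fst w))"
  shows "((\<lambda>w. f (fst w)) has_derivative (\<lambda>h. D (fst h))) (at w)"
proof -
  have "((\<lambda>w. fst w) has_derivative (\<lambda>h. fst h)) (at w)"
    by (intro has_derivative_fst has_derivative_ident)
  from has_derivative_compose[where g=f and g'=D, OF this assms] show ?thesis .
qed

lemma Lag_derivative: "(Lag has_derivative (\<lambda>h. (gz w, F (fst w)) \<bullet> h)) (at w)"
proof -
  note d1 = derivative_of_fst[OF C2_derivsD(1)[OF c]] and d2 = derivative_of_fst[OF C2_derivsD(1)[OF F]]
  show ?thesis unfolding Lag_def[abs_def]
    by (rule has_derivative_eq_rhs[OF has_derivative_add[OF d1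
          has_derivative_inner[OF has_derivative_snd[OF has_derivative_ident] d2]]])
       (simp add: fun_eq_iff gz_inner inner_prod_def inner_commute[of "F (fst w)"])
qed

lemma Lag_derivative_fst: "((\<lambda>z. Lag (z, l)) has_derivative (\<lambda>h. gz (z, l) \<bullet> h)) (at z)"
proof -
  have "((\<lambda>z. (z, l)) has_derivative (\<lambda>h. (h, 0))) (at z)" by (auto intro!: derivative_eq_intros)
  from has_derivative_compose[OF this Lag_derivative] show ?thesis by (simp add: inner_prod_def)
qed

lemma Lag_derivative_snd: "((\<lambda>l. Lag (z, l)) has_derivative (\<lambda>h. F z \<bullet> h)) (at l)"
proof -
  have "((\<lambda>l. (z, l)) has_derivative (\<lambda>h. (0, h))) (at l)" by (auto intro!: derivative_eq_intros)
  from has_derivative_compose[OF this Lag_derivative] show ?thesis by (simp add: inner_prod_def)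
qed

text \<open>The multiplier enters each coordinate of \<open>gz\<close> linearly, as
  \<open>snd w \<bullet> F1 (fst w) b\<close>; varying it therefore produces the coordinates of the
  adjoint Jacobian.\<close>

lemma gz_derivative: "(gz has_derivative (\<lambda>h. Hz w (fst h) + adjoint (F1 (fst w)) (snd h))) (at w)"
proof -
  note d1 = derivative_of_fst[OF C2_derivsD(2)[OF c]] and d2 = derivative_of_fst[OF C2_derivsD(2)[OF F]]
  show ?thesis unfolding gz_def[abs_def]
    by (rule has_derivative_eq_rhs[OF has_derivative_sum[OF has_derivative_scaleR_left[OF has_derivative_add[OF d1
          has_derivative_inner[OF has_derivative_snd[OF has_derivative_ident] d2]]]]])
       (auto simp: Hz_def adjoint_Basis[OF linear_F1] sum.distrib algebra_simps)
qed

lemma gz_derivative_fst: "((\<lambda>z. gz (z, l)) has_derivative Hz (z, l)) (at z)"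
proof -
  have "((\<lambda>z. (z, l)) has_derivative (\<lambda>h. (h, 0))) (at z)" by (auto intro!: derivative_eq_intros)
  from has_derivative_compose[OF this gz_derivative] show ?thesis
    by (simp add: linear_0[OF adjoint_linear[OF linear_F1]])
qed

lemma grad_derivative:
  "((\<lambda>w. (gz w, F (fst w))) has_derivative
    (\<lambda>h. (Hz w (fst h) + adjoint (F1 (fst w)) (snd h), F1 (fst w) (fst h)))) (at w)"
  by (intro has_derivative_Pair gz_derivative
derivative_of_fst C2_derivsD(1)[OF F])

lemma continuous_F1: "continuous_on UNIV (\<lambda>w::'a \<times> 'b. F1 (fst w) h)"
proof -
  have "continuous_on UNIV (\<lambda>x. F1 x h)"
    by (intro continuous_at_imp_continuous_on ballI has_derivative_continuous[OF C2_derivsD(2)[OF F]])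
  from continuous_on_compose2[OF this continuous_on_fst[OF continuous_on_id]] show ?thesis by simp
qed

lemma continuous_adjoint_F1: "continuous_on UNIV (\<lambda>w::'a \<times> 'b. adjoint (F1 (fst w)) h)"
  unfolding adjoint_Basis[OF linear_F1] by (intro continuous_intros continuous_F1)

lemma continuous_Hz: "continuous_on UNIV (\<lambda>w. Hz w h)"
proof -
  have "continuous_on UNIV (\<lambda>w::'a \<times> 'b. c2 (fst w) h b)" "continuous_on UNIV (\<lambda>w::'a \<times> 'b. F2 (fst w) h b)" for b
    using continuous_on_compose2[OF C2_derivsD(3)[OF c] continuous_on_fst[OF continuous_on_id]]
      continuous_on_compose2[OF C2_derivsD(3)[OF F] continuous_on_fst[OF continuous_on_id]] by auto
  then show ?thesis unfolding Hz_def by (intro continuous_intros)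
qed

end

section \<open>Stagewise structure of the cost, the constraints and the Lagrangian\<close>

lemma bounded_linear_state: "bounded_linear (\<lambda>z::('n::finite, 'x::finite, 'u::finite) prim. state z k)"
  by (rule linear_conv_bounded_linear[THEN iffD1], rule linearI) (auto simp: state_def stage_z_def)

lemma bounded_linear_stage_z: "bounded_linear (\<lambda>z::('n::finite, 'x::finite, 'u::finite) prim. stage_z z k)"
  by (rule linear_conv_bounded_linear[THEN iffD1], rule linearI) (auto simp: stage_z_def)

lemma bounded_linear_mult_stage: "bounded_linear (\<lambda>l::('n::finite, 'x::finite) dual. mult l k)"
  by (rule linear_conv_bounded_linear[THEN iffD1], rule linearI) (auto simp: mult_def)

lemma dual_eqI:
  fixes l l' :: "('n::finite, 'x::finite) dual"
  assumes "\<And>k. k \<le> CARD('n) \<Longrightarrow> mult l k = mult l' k"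
  shows "l = l'"
proof (rule prod_eqI)
  show "fst l = fst l'"
  proof (rule vec_eq_iff[THEN iffD2], rule)
    fix i :: 'n
    show "fst l $ i = fst l' $ i" using assms[of "idx i"] idx_less[of i] by (simp add: mult_def)
  qed
  show "snd l = snd l'" using assms[of "CARD('n)"] by (simp add: mult_def)
qed

text \<open>Embedding a single block linearly lets the stacked constraint be written as a finite
  sum, to which the closure rules of \<open>C2_derivs\<close> apply.\<close>

definition unit_dual :: "nat \<Rightarrow> real^'x \<Rightarrow> ('n::finite, 'x::finite) dual" where
  "unit_dual k x = mk_dual (\<lambda>j. if j = k then x else 0)"

lemma bounded_linear_unit_dual: "bounded_linear (unit_dual k :: _ \<Rightarrow> ('n::finite, 'x::finite) dual)"
  by (rule linear_conv_bounded_linear[THEN iffD1], rule linearI)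
     (auto simp: unit_dual_def mk_dual_def vec_eq_iff)

lemma mk_dual_sum: "mk_dual X = (\<Sum>k\<le>CARD('n). unit_dual k (X k) :: ('n::finite, 'x::finite) dual)"
proof (rule dual_eqI)
  fix j assume j: "j \<le> CARD('n)"
  have "mult (\<Sum>k\<le>CARD('n). unit_dual k (X k) :: ('n, 'x) dual) j
      = (\<Sum>k\<le>CARD('n). mult (unit_dual k (X k) :: ('n, 'x) dual) j)"
    by (rule linear_sum[OF bounded_linear.linear[OF bounded_linear_mult_stage]])
  also have "\<dots> = (\<Sum>k\<le>CARD('n). if k = j then X k else 0)"
    by (rule sum.cong) (use j in \<open>auto simp: unit_dual_def\<close>)
  finally show "mult (mk_dual X :: ('n, 'x) dual) j = mult (\<Sum>k\<le>CARD('n). unit_dual k (X k) :: ('n, 'x) dual) j"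
    using j by simp
qed

lemma total_cost_C2:
  fixes P :: "('x::finite, 'u::finite) ocp"
  assumes "\<forall>k<CARD('n). C3 (stage_cost P k)" "C3 (term_cost P)"
  obtains D1 D2 where "C2_derivs (total_cost P :: ('n::finite, 'x, 'u) prim \<Rightarrow> real) D1 D2"
proof -
  obtain E1 E2 where E: "C2_derivs (term_cost P) E1 E2" using assms(2) by (rule C3_imp_C2_derivs)
  have "\<forall>k. \<exists>D1 D2. k < CARD('n) \<longrightarrow> C2_derivs (stage_cost P k) D1 D2"
    using assms(1) C3_imp_C2_derivs by metis
  then obtain S1 S2 where S: "\<And>k. k < CARD('n) \<Longrightarrow> C2_derivs (stage_cost P k) (S1 k) (S2 k)"
    by metis
  have "\<exists>D1 D2. C2_derivs (\<lambda>z::('n, 'x, 'u) prim. (\<Sum>k<CARD('n). stage_cost P k (stage_z z k))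
      + term_cost P (state z CARD('n))) D1 D2"
    by (intro exI, rule C2_derivs_add[OF C2_derivs_sum C2_derivs_compose_right[OF E bounded_linear_state]],
        rule C2_derivs_compose_right[OF S bounded_linear_stage_z], simp)
  then show ?thesis using that unfolding total_cost_def[abs_def] by blast
qed

text \<open>The constraint Jacobian is onto at every point because each state appears with identity
  coefficient in its own row, which makes the system block triangular.\<close>

lemma constr_C2:
  fixes P :: "('x::finite, 'u::finite) ocp"
  assumes f: "\<forall>k<CARD('n). C3 (dynamics P k)"
  obtains D1 D2 where "C2_derivs (constr P :: ('n::finite, 'x, 'u) prim \<Rightarrow> _) D1 D2"
    "\<And>z. surj (D1 z)"
proof -
  have "\<forall>k. \<exists>D1 D2. k < CARD('n) \<longrightarrow> C2_derivs (dynamics P k) D1 D2"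
    using f C3_imp_C2_derivs by metis
  then obtain f1 f2 where f12: "\<And>k. k < CARD('n) \<Longrightarrow> C2_derivs (dynamics P k) (f1 k) (f2 k)"
    by metis
  define row where "row k z = (if k = 0 then state z 0 - init_state P
     else state z k - dynamics P (k - 1) (stage_z z (k - 1)))" for k and z :: "('n, 'x, 'u) prim"
  \<comment> \<open>Row \<open>k\<close> carries the dynamics of stage \<open>k - 1\<close>; its
    linearisation drops the initial state, which is constant.\<close>
  define row1 where "row1 k z h = (if k = 0 then state h 0
     else state h k - f1 (k - 1) (stage_z z (k - 1)) (stage_z h (k - 1)))" for k and z h :: "('n, 'x, 'u) prim"
  have row: "\<exists>row2. C2_derivs (row k) (row1 k) row2" if "k \<le> CARD('n)" for k
  proof (cases "k = 0")
    case True
    have "C2_derivs (\<lambda>z::('n, 'x, 'u) prim. state z 0 - init_state P) (\<lambda>z h. state h 0 - 0) (\<lambda>_ _ _. 0 - 0)"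
      by (intro C2_derivs_diff C2_derivs_linear C2_derivs_const bounded_linear_state)
    with True show ?thesis unfolding row_def row1_def by auto
  next
    case False
    then have "k - 1 < CARD('n)" using that by simp
    with False show ?thesis unfolding row_def row1_def
      using C2_derivs_diff[OF C2_derivs_linear[OF bounded_linear_state]
          C2_derivs_compose_right[OF f12 bounded_linear_stage_z]]
      by auto
  qed
  then obtain row2 where row2: "\<And>k. k \<le> CARD('n) \<Longrightarrow> C2_derivs (row k) (row1 k) (row2 k)"
    by metis
  define D1 where "D1 z h = (\<Sum>k\<le>CARD('n). unit_dual k (row1 k z h) :: ('n, 'x) dual)"
    for z h :: "('n, 'x, 'u) prim"
  have "constr P = (\<lambda>z. \<Sum>k\<le>CARD('n). unit_dual k (row k z) :: ('n, 'x) dual)"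
    by (rule ext) (simp only: constr_def row_def mk_dual_sum)
  moreover have "\<exists>D2. C2_derivs (\<lambda>z. \<Sum>k\<le>CARD('n). unit_dual k (row k z) :: ('n, 'x) dual) D1 D2"
    unfolding D1_def[abs_def]
    by (rule exI, rule C2_derivs_sum, rule C2_derivs_compose_left[OF row2 bounded_linear_unit_dual], simp)
  ultimately obtain D2 where D2: "C2_derivs (constr P :: ('n, 'x, 'u) prim \<Rightarrow> _) D1 D2" by auto
  have D1: "D1 z h = mk_dual (\<lambda>k. row1 k z h)" for z h
    unfolding D1_def by (rule mk_dual_sum[symmetric])
  text \<open>Solving the linearised dynamics forward, with zero controls, hits any prescribed value.\<close>
  have "surj (D1 z)" for z
  proof (rule surjI)
    fix y :: "('n, 'x) dual"
    define X where "X = rec_nat (mult y 0) (\<lambda>k x. mult y (Suc k) + f1 k (stage_z z k) (x, 0))"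
    define h :: "('n, 'x, 'u) prim" where "h = mk_prim X (\<lambda>_. 0)"
    have X: "X 0 = mult y 0" "X (Suc k) = mult y (Suc k) + f1 k (stage_z z k) (X k, 0)" for k
      by (simp_all add: X_def)
    have "stage_z h k = (X k, 0)" if "k < CARD('n)" for k
      using that by (simp add: h_def mk_prim_def stage_z_def)
    then have "row1 k z h = mult y k" if "k \<le> CARD('n)" for k
      using that X by (cases k) (auto simp: row1_def h_def)
    then have "D1 z h = y" unfolding D1 by (intro dual_eqI) simp
    then show "D1 z (mk_prim (rec_nat (mult y 0) (\<lambda>k x. mult y (Suc k) + f1 k (stage_z z k) (x, 0))) (\<lambda>_. 0)) = y"
      by (simp add: h_def X_def)
  qed
  with D2 show ?thesis by (rule that)
qed

text \<open>This is the derivative of \<open>grad_lagr\<close>, with the true Hessian where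
  \<open>kkt_mat\<close> has the modified one. It enters the slope of the merit function, whereas
  \<open>kkt_mat\<close> defines the Newton system.\<close>

definition kkt_exact ::
  "('x::finite, 'u::finite) ocp \<Rightarrow> ('n::finite, 'x, 'u) pd \<Rightarrow> ('n, 'x, 'u) pd \<Rightarrow> ('n, 'x, 'u) pd" where
  "kkt_exact P w h = (hess P w (fst h) + adjoint (jac_G P w) (snd h), jac_G P w (fst h))"

lemma lagrangian_calculus:
  fixes P :: "('x::finite, 'u::finite) ocp" and w :: "('n::finite, 'x, 'u) pd"
  assumes "\<forall>k<CARD('n). C3 (stage_cost P k) \<and> C3 (dynamics P k)" "C3 (term_cost P)"
  shows lagr_derivative: "(lagr P has_derivative (\<lambda>h. grad_lagr P w \<bullet> h)) (at w)"
    and grad_lagr_derivative: "(grad_lagr P has_derivative kkt_exact P w) (at w)"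
    and linear_hess: "linear (hess P w)"
    and linear_jac_G: "linear (jac_G P w)"
    and surj_jac_G: "surj (jac_G P w)"
    and continuous_hess: "continuous_on UNIV (\<lambda>w :: ('n, 'x, 'u) pd. hess P w v)"
    and continuous_jac_G: "continuous_on UNIV (\<lambda>w :: ('n, 'x, 'u) pd. jac_G P w v)"
    and continuous_adjoint_jac_G: "continuous_on UNIV (\<lambda>w :: ('n, 'x, 'u) pd. adjoint (jac_G P w) y)"
proof -
  obtain c1 c2 where c: "C2_derivs (total_cost P :: ('n, 'x, 'u) prim \<Rightarrow> real) c1 c2"
    using assms by (auto intro: total_cost_C2)
  obtain F1 F2 where C: "C2_derivs (constr P :: ('n, 'x, 'u) prim \<Rightarrow> _) F1 F2" "\<And>z. surj (F1 z)"
    using assms by (auto intro: constr_C2)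
  interpret smooth_lagrangian "total_cost P :: ('n, 'x, 'u) prim \<Rightarrow> real" "constr P" c1 c2 F1 F2
    by unfold_locales (fact c C(1))+
  \<comment> \<open>Gradients given by choice and Jacobians given by
    \<open>frechet_derivative\<close> are first identified with explicit maps, about which the
    claims are already known.\<close>
  have lagr: "lagr P = Lag" by (rule ext) (simp add: lagr_def Lag_def)
  have gz: "grad_z P = gz"
    by (rule ext) (auto simp: grad_z_def lagr intro!: grad_eqI has_derivative_eq_rhs[OF Lag_derivative_fst])
  have gl: "grad_l P = (\<lambda>w :: ('n, 'x, 'u) pd. constr P (fst w))"
    by (rule ext) (simp add: grad_l_def lagr grad_eqI[OF Lag_derivative_snd])
  have grad: "grad_lagr P = (\<lambda>w. (gz w, constr P (fst w)))"
    by (rule ext) (simp add: grad_lagr_def gz gl)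
  have hess: "hess P = Hz"
  proof (rule ext)
    fix w :: "('n, 'x, 'u) pd"
    show "hess P w = Hz w" unfolding hess_def gz
      using frechet_derivative_at[OF gz_derivative_fst[of "snd w" "fst w"]] by simp
  qed
  have jac: "jac_G P = (\<lambda>w. F1 (fst w))"
    by (rule ext) (simp add: jac_G_def frechet_derivative_at[OF C2_derivsD(1)[OF C(1)]])
  show "(lagr P has_derivative (\<lambda>h. grad_lagr P w \<bullet> h)) (at w)"
    unfolding lagr grad by (rule Lag_derivative)
  show "(grad_lagr P has_derivative kkt_exact P w) (at w)"
    unfolding grad kkt_exact_def[abs_def] hess jac by (rule grad_derivative)
  show "linear (hess P w)"
    unfolding hess using has_derivative_linear[OF gz_derivative_fst[of "snd w" "fst w"]] by simp
  show "linear (jac_G P w)" unfolding jac by (rule linear_F1)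
  show "surj (jac_G P w)" unfolding jac by (rule C(2))
  show "continuous_on UNIV (\<lambda>w :: ('n, 'x, 'u) pd. hess P w v)"
    unfolding hess by (rule continuous_Hz)
  show "continuous_on UNIV (\<lambda>w :: ('n, 'x, 'u) pd. jac_G P w v)"
    unfolding jac by (rule continuous_F1)
  show "continuous_on UNIV (\<lambda>w :: ('n, 'x, 'u) pd. adjoint (jac_G P w) y)"
    unfolding jac by (rule continuous_adjoint_F1)
qed

section \<open>The merit function and its slope\<close>

text \<open>The weight \<open>\<eta>2\<close> goes to the first component, because in
  \<open>merit\<close> it multiplies the primal gradient, and \<open>\<eta>1\<close> to the
  second.\<close>

definition merit_weight :: "real \<Rightarrow> real \<Rightarrow> 'a::real_vector \<times> 'b::real_vector \<Rightarrow> 'a \<times> 'b" where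
  "merit_weight \<eta>1 \<eta>2 v = (\<eta>2 *\<^sub>R fst v, \<eta>1 *\<^sub>R snd v)"

lemma bounded_linear_merit_weight:
  "bounded_linear (merit_weight \<eta>1 \<eta>2 :: 'a::real_normed_vector \<times> 'b::real_normed_vector \<Rightarrow> _)"
  unfolding merit_weight_def[abs_def]
  by (intro bounded_linear_Pair bounded_linear_scaleR_right[THEN bounded_linear_compose]
      bounded_linear_fst bounded_linear_snd)

lemma merit_weight_sym: "merit_weight \<eta>1 \<eta>2 u \<bullet> v = u \<bullet> merit_weight \<eta>1 \<eta>2 v"
  by (simp add: merit_weight_def inner_prod_def)

lemma norm_merit_weight:
  assumes "0 \<le> \<eta>1" "0 \<le> \<eta>2"
  shows "norm (merit_weight \<eta>1 \<eta>2 v) \<le> (\<eta>1 + \<eta>2) * norm v"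
proof -
  have "norm (merit_weight \<eta>1 \<eta>2 v) \<le> \<eta>2 * norm (fst v) + \<eta>1 * norm (snd v)"
    unfolding merit_weight_def using assms norm_Pair_le[of "\<eta>2 *\<^sub>R fst v" "\<eta>1 *\<^sub>R snd v"] by simp
  also have "\<dots> \<le> \<eta>2 * norm v + \<eta>1 * norm v"
    using assms norm_fst_le[of "fst v" "snd v"] norm_snd_le[of "snd v" "fst v"]
    by (intro add_mono mult_left_mono) auto
  finally show ?thesis by (simp add: algebra_simps)
qed

lemma merit_eq: "merit P \<eta>1 \<eta>2 w
    = lagr P w + 1/2 * (merit_weight \<eta>1 \<eta>2 (grad_lagr P w) \<bullet> grad_lagr P w)"
  by (simp add: merit_def merit_weight_def grad_lagr_def inner_prod_def power2_norm_eq_inner field_simps)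

text \<open>The product rule yields two penalty terms, which coincide by symmetry of the weight and
  so cancel the factor 1/2.\<close>

lemma grad_merit_inner:
  fixes P :: "('x::finite, 'u::finite) ocp" and w :: "('n::finite, 'x, 'u) pd"
  assumes "\<forall>k<CARD('n). C3 (stage_cost P k) \<and> C3 (dynamics P k)" "C3 (term_cost P)"
  shows "grad (merit P \<eta>1 \<eta>2) w \<bullet> h
    = grad_lagr P w \<bullet> h + merit_weight \<eta>1 \<eta>2 (grad_lagr P w) \<bullet> kkt_exact P w h"
proof -
  let ?D = "merit_weight \<eta>1 \<eta>2" and ?g = "grad_lagr P w"
  note g = grad_lagr_derivative[OF assms, of w]
  have "(merit P \<eta>1 \<eta>2 has_derivative (\<lambda>h. ?g \<bullet> h + 1/2 * (?D ?g \<bullet> kkt_exact P w h + ?D (kkt_exact P w h) \<bullet> ?g))) (at w)"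
    unfolding merit_eq[abs_def]
    by (intro has_derivative_add has_derivative_mult_right has_derivative_inner lagr_derivative[OF assms] g
        bounded_linear.has_derivative[OF bounded_linear_merit_weight g])
  moreover have "?D (kkt_exact P w h) \<bullet> ?g = ?D ?g \<bullet> kkt_exact P w h"
    by (metis merit_weight_sym inner_commute)
  ultimately show ?thesis by (simp add: grad_inner)
qed

section \<open>The KKT matrices along the iterates\<close>

lemma linear_hat_blk: "linear (hat_blk W k)"
  by (rule linearI) (auto simp: hat_blk_def matrix_vector_right_distrib matrix_vector_mult_scaleR scaleR_add_right)

lemma linear_hat_hess: "linear (hat_hess W :: ('n::finite, 'x::finite, 'u::finite) prim \<Rightarrow> _)"
  by (rule linearI)
     (auto simp: hat_hess_def vec_eq_iff linear_add[OF linear_hat_blk] linear_scale[OF linear_hat_blk]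
       matrix_vector_right_distrib matrix_vector_mult_scaleR)

lemma inner_transpose: "(transpose A *v x) \<bullet> y = x \<bullet> (A *v (y::real^'m))"
  by (simp add: dot_lmul_matrix)

lemma symmetric_matrix_inner:
  assumes "transpose A = A"
  shows "(A *v x) \<bullet> y = x \<bullet> (A *v (y::real^'m))"
  using inner_transpose[of A x y] by (simp only: assms)

lemma hat_hess_symmetric:
  fixes y z :: "('n::finite, 'x::finite, 'u::finite) prim"
  assumes W: "hess_modification P \<gamma> (w :: ('n, 'x, 'u) pd) W"
  shows "hat_hess W y \<bullet> z = y \<bullet> hat_hess W z"
proof -
  have Q: "transpose (hQ W k) = hQ W k" if "k \<le> CARD('n)" for k
    using W that by (simp add: hess_modification_def)
  have R: "transpose (hR W k) = hR W k" if "k < CARD('n)" for k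
    using W that by (simp add: hess_modification_def)
  \<comment> \<open>The diagonal blocks are symmetric by \<open>hess_modification\<close>; the two
    off-diagonal blocks are transposes of each other by construction.\<close>
  have blk: "hat_blk W k u \<bullet> v = u \<bullet> hat_blk W k v" if k: "k < CARD('n)" for k u v
  proof -
    have "(hQ W k *v fst u) \<bullet> fst v = fst u \<bullet> (hQ W k *v fst v)"
      using k by (intro symmetric_matrix_inner Q) simp
    moreover have "(hR W k *v snd u) \<bullet> snd v = snd u \<bullet> (hR W k *v snd v)"
      using k by (intro symmetric_matrix_inner R)
    moreover have "(transpose (hS W k) *v snd u) \<bullet> fst v = snd u \<bullet> (hS W k *v fst v)"
      by (rule inner_transpose)
    moreover have "fst u \<bullet> (transpose (hS W k) *v snd v) = (hS W k *v fst u) \<bullet> snd v"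
      by (metis inner_transpose inner_commute)
    ultimately show ?thesis by (simp add: hat_blk_def inner_prod_def inner_add_left inner_add_right)
  qed
  have "(\<Sum>i\<in>UNIV. hat_blk W (idx i) (fst y $ i) \<bullet> fst z $ i)
      = (\<Sum>i\<in>UNIV. fst y $ i \<bullet> hat_blk W (idx i) (fst z $ i))"
    by (intro sum.cong refl blk idx_less)
  moreover have "(hQ W CARD('n) *v snd y) \<bullet> snd z = snd y \<bullet> (hQ W CARD('n) *v snd z)"
    by (intro symmetric_matrix_inner Q) simp
  ultimately show ?thesis by (simp add: hat_hess_def inner_prod_def inner_vec_def)
qed

lemma linear_saddle:
  fixes H :: "'a::euclidean_space \<Rightarrow> 'a" and G :: "'a \<Rightarrow> 'b::euclidean_space"
  assumes H: "linear H" and G: "linear G"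
  shows "linear (\<lambda>v. (H (fst v) + adjoint G (snd v), G (fst v)))"
proof (rule linearI)
  note A = adjoint_linear[OF G]
  show "(H (fst (x + y)) + adjoint G (snd (x + y)), G (fst (x + y)))
    = (H (fst x) + adjoint G (snd x), G (fst x)) + (H (fst y) + adjoint G (snd y), G (fst y))" for x y
    by (simp add: linear_add[OF H] linear_add[OF A] linear_add[OF G])
  show "(H (fst (c *\<^sub>R x)) + adjoint G (snd (c *\<^sub>R x)), G (fst (c *\<^sub>R x)))
    = c *\<^sub>R (H (fst x) + adjoint G (snd x), G (fst x))" for c x
    by (simp add: linear_scale[OF H] linear_scale[OF A] linear_scale[OF G] scaleR_add_right)
qed

text \<open>\<open>Psi\<close> is the constant of \<open>saddle_lower_bound\<close> with coercivity
  and least singular value truncated above at 1 and the Hessian norm truncated below at 1.\<close>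

lemma kkt_mat_lower_bound:
  fixes P :: "('x::finite, 'u::finite) ocp" and w v :: "('n::finite, 'x, 'u) pd"
  assumes G: "linear (jac_G P w)" and \<sigma>: "0 < sigma_min (jac_G P w)" and "0 < gam a"
    and red: "reduced_ge (hat_hess W) (jac_G P w) (gam a)"
  shows "norm v \<le> Psi P a W w * norm (kkt_mat P W w v)"
proof -
  let ?H = "hat_hess W :: ('n, 'x, 'u) prim \<Rightarrow> _" and ?G = "jac_G P w"
  define c where "c = min (sigma_min ?G) 1"
  define h where "h = max (onorm ?H) 1"
  have blH: "bounded_linear ?H" using linear_hat_hess by (rule linear_conv_bounded_linear[THEN iffD1])
  have c: "0 < c" "c \<le> 1" using \<sigma> by (simp_all add: c_def)
  \<comment> \<open>Truncation at 1 commutes with squaring nonnegative numbers, which brings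
    \<open>c\<close> and \<open>h\<close> into the form used in \<open>Psi\<close>.\<close>
  have c2: "c\<^sup>2 = min ((sigma_min ?G)\<^sup>2) 1"
    using \<sigma> power_le_one[of "sigma_min ?G" 2] one_le_power[of "sigma_min ?G" 2]
    by (cases "sigma_min ?G \<le> 1") (simp_all add: c_def)
  have h2: "h\<^sup>2 = max ((onorm ?H)\<^sup>2) 1"
    using onorm_pos_le[OF blH] power_le_one[of "onorm ?H" 2] one_le_power[of "onorm ?H" 2]
    by (cases "onorm ?H \<le> 1") (simp_all add: h_def)
  have hb: "norm (?H v) \<le> h * norm v" for v
    using onorm[OF blH, of v] mult_right_mono[of "onorm ?H" h "norm v"] by (simp add: h_def)
  have ker: "min (gam a) 1 * (v \<bullet> v) \<le> v \<bullet> ?H v" if "?G v = 0" for v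
    using reduced_ge_on_kernel[OF red linear_hat_hess G that] mult_right_mono[of "min (gam a) 1" "gam a" "v \<bullet> v"]
    by simp
  have adj: "c * norm y \<le> norm (adjoint ?G y)" for y
    using sigma_min_le[OF G, of y] mult_right_mono[of c "sigma_min ?G" "norm y"] by (simp add: c_def)
  have "norm (fst v, snd v) \<le> 20 * h\<^sup>2 / (min (gam a) 1 * c\<^sup>2) * norm (?H (fst v) + adjoint ?G (snd v), ?G (fst v))"
    using \<open>0 < gam a\<close> by (intro saddle_lower_bound[OF linear_hat_hess G _ _ c _ hb ker adj]) (auto simp: h_def)
  then show ?thesis by (simp add: Psi_def kkt_mat_def c2 h2)
qed

lemma Psi_ge:
  assumes "0 < sigma_min (jac_G P w)" "0 < gam a"
  shows "20 \<le> Psi P a W (w :: ('n::finite, 'x::finite, 'u::finite) pd)"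
proof -
  let ?m = "max ((onorm (hat_hess W :: ('n, 'x, 'u) prim \<Rightarrow> _))\<^sup>2) 1"
  let ?q = "min (gam a) 1 * min ((sigma_min (jac_G P w))\<^sup>2) 1"
  have q: "0 < ?q" using assms by simp
  have "?q \<le> 1 * 1" by (rule mult_mono) auto
  then have "20 * ?q \<le> 20 * ?m" by (simp add: le_max_iff_disj)
  then show ?thesis unfolding Psi_def using q by (simp add: pos_le_divide_eq)
qed

lemma Psi_le:
  fixes w :: "('n::finite, 'x::finite, 'u::finite) pd"
  assumes "0 < c" "c \<le> 1" "c \<le> sigma_min (jac_G P w)" "0 < gam a" "1 \<le> h"
    "onorm (hat_hess W :: ('n, 'x, 'u) prim \<Rightarrow> _) \<le> h"
  shows "Psi P a W w \<le> 20 * h\<^sup>2 / (min (gam a) 1 * c\<^sup>2)"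
  unfolding Psi_def
proof (rule frac_le)
  have "0 \<le> onorm (hat_hess W :: ('n, 'x, 'u) prim \<Rightarrow> _)"
    by (rule onorm_pos_le[OF linear_conv_bounded_linear[THEN iffD1, OF linear_hat_hess]])
  then have "(onorm (hat_hess W :: ('n, 'x, 'u) prim \<Rightarrow> _))\<^sup>2 \<le> h\<^sup>2"
    using assms by (intro power_mono)
  then show "20 * max ((onorm (hat_hess W :: ('n, 'x, 'u) prim \<Rightarrow> _))\<^sup>2) 1 \<le> 20 * h\<^sup>2"
    using assms(5) by simp
  have "c\<^sup>2 \<le> (sigma_min (jac_G P w))\<^sup>2" "c\<^sup>2 \<le> 1"
    using assms by (auto intro: power_mono power_le_one)
  then show "min (gam a) 1 * c\<^sup>2 \<le> min (gam a) 1 * min ((sigma_min (jac_G P w))\<^sup>2) 1"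
    using assms by (intro mult_left_mono) auto
qed (use assms in auto)

section \<open>Invariants of the algorithm\<close>

text \<open>This is the invariant of all parameter updates. Positivity of the merit parameters is
  included because it makes the cap nonnegative.\<close>

definition tol_capped ::
  "('x::finite, 'u::finite) ocp \<Rightarrow> params \<Rightarrow> ('x, 'u) hmod \<Rightarrow> ('n::finite, 'x, 'u) pd \<Rightarrow> adapt \<Rightarrow> bool" where
  "tol_capped P a W w s \<longleftrightarrow>
    0 < eta1 s \<and> 0 < eta2 s \<and> acc_tol s \<le> eps_max P a W w (eta1 s) (eta2 s)"

text \<open>Every change of the merit parameters or of the cap strictly decreases a positive tolerance, so
  a frozen tolerance means frozen merit parameters.\<close>

definition tol_descends :: "adapt \<Rightarrow> adapt \<Rightarrow> bool" where
  "tol_descends s s' \<longleftrightarrow> (0 < acc_tol s' \<longrightarrow> acc_tol s' \<le> acc_tol s \<and>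
    (acc_tol s' = acc_tol s \<longrightarrow> eta1 s' = eta1 s \<and> eta2 s' = eta2 s))"

text \<open>Positivity of the last tolerance propagates backwards through the inequalities, and
  equality of the outer tolerances forces equality in between.\<close>

lemma tol_descends_trans: "tol_descends s s' \<Longrightarrow> tol_descends s' s'' \<Longrightarrow> tol_descends s s''"
  by (auto simp: tol_descends_def)

lemma merit_update_tol:
  assumes "1 < nu a" "tol_capped P a W w s"
  shows "tol_capped P a W w (merit_update P a W w d s)" "tol_descends s (merit_update P a W w d s)"
proof -
  show "tol_capped P a W w (merit_update P a W w d s)"
    using assms by (auto simp: merit_update_def tol_capped_def Let_def)
  have n4: "1 < nu a ^ 4" using assms(1) by (simp add: one_less_power)
  \<comment> \<open>A positive tolerance strictly decreases when divided by
    \<open>nu a ^ 4 > 1\<close>, so a tolerance that stays equal rules out a merit update.\<close>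
  have "t \<le> acc_tol s \<and> t \<noteq> acc_tol s" if t: "0 < t" "t \<le> acc_tol s / nu a ^ 4" for t
  proof -
    have "0 < acc_tol s / nu a ^ 4" using t by linarith
    then have "0 < acc_tol s" using n4 by (simp add: zero_less_divide_iff)
    then have "acc_tol s / nu a ^ 4 < acc_tol s" using n4 by (simp add: divide_less_eq)
    with t show ?thesis by linarith
  qed
  note less = this
  show "tol_descends s (merit_update P a W w d s)"
  proof (cases "descent P w (eta1 s) (eta2 s) d")
    case False
    then have "acc_tol (merit_update P a W w d s) \<le> acc_tol s / nu a ^ 4"
      by (simp add: merit_update_def Let_def)
    with less[of "acc_tol (merit_update P a W w d s)"] show ?thesis
      by (simp add: tol_descends_def)
  qed (simp add: merit_update_def tol_descends_def)
qed

lemma direction_loop_tol: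
  assumes "direction_loop P a W w c c'" "1 < nu a" "tol_capped P a W w (fst c)"
  shows "accurate P a W w (acc_tol (fst c')) (snd c') \<and>
    descent P w (eta1 (fst c')) (eta2 (fst c')) (snd c') \<and>
    tol_capped P a W w (fst c') \<and> tol_descends (fst c) (fst c')"
  using assms
proof (induction rule: direction_loop.induct)
  case (stop s d)
  then show ?case by (simp add: tol_descends_def)
next
  case (again s d e b d' c)
  \<comment> \<open>The accuracy loop changes only local tolerances and overlaps, which neither
    invariant sees.\<close>
  let ?s = "s\<lparr>loc_tol := e, overlap := b\<rparr>"
  have s: "tol_capped P a W w ?s" "tol_descends s ?s"
    using again.prems by (simp_all add: tol_capped_def tol_descends_def)
  note m = merit_update_tol[OF \<open>1 < nu a\<close> s(1), of d']
  show ?case using again.IH[OF \<open>1 < nu a\<close>] m s(2) by (auto intro: tol_descends_trans)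
qed

lemma eps_max_nonneg:
  assumes "beta a < 1/2" "0 < \<eta>1" "0 < \<eta>2"
  shows "0 \<le> eps_max P a W w \<eta>1 \<eta>2"
  using assms by (auto simp: eps_max_def intro!: divide_nonneg_nonneg mult_nonneg_nonneg)

text \<open>When the cap \<open>m\<close> is exceeded, the new tolerance \<open>m / nu a\<close> is
  at most \<open>m\<close> and hence strictly smaller than the old one; the merit parameters do not
  move.\<close>

lemma cap_acc_tol:
  assumes a: "beta a < 1/2" "1 < nu a" and s: "0 < eta1 s" "0 < eta2 s"
  shows "tol_capped P a W w (cap_acc_tol P a W w s)" "tol_descends s (cap_acc_tol P a W w s)"
proof -
  define m where "m = eps_max P a W w (eta1 s) (eta2 s)"
  have m: "0 \<le> m" unfolding m_def using a(1) s by (rule eps_max_nonneg)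
  then have mn: "m / nu a \<le> m" using a(2) by (simp add: divide_le_eq mult_le_cancel_left1)
  show "tol_capped P a W w (cap_acc_tol P a W w s)"
    using s mn by (auto simp: tol_capped_def cap_acc_tol_def Let_def m_def)
  show "tol_descends s (cap_acc_tol P a W w s)"
    using mn by (auto simp: tol_descends_def cap_acc_tol_def Let_def m_def)
qed

lemma aotd_step_tol:
  assumes step: "aotd_step P a W w s s' d \<alpha> w'" and a: "valid_params n a" and s: "0 < eta1 s" "0 < eta2 s"
  shows "accurate P a W w (acc_tol s') d" "descent P w (eta1 s') (eta2 s') d"
    "tol_capped P a W w s'" "tol_descends s s'"
proof -
  have b: "beta a < 1/2" "1 < nu a" using a by (auto simp: valid_params_def)
  note c = cap_acc_tol[OF b s, of P W w]
  have "direction_loop P a W w (cap_acc_tol P a W w s, 0) (s', d)" using step by (simp add: aotd_step_def)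
  from direction_loop_tol[OF this b(2)] c
  show "accurate P a W w (acc_tol s') d" "descent P w (eta1 s') (eta2 s') d"
    "tol_capped P a W w s'" "tol_descends s s'"
    by (auto intro: tol_descends_trans)
qed

text \<open>Backtracking stops at the least accepted exponent, which is 0 once the unit step
  passes.\<close>

lemma aotd_step_unit:
  assumes step: "aotd_step P a W w s s' d \<alpha> w'" and "armijo P a w (eta1 s') (eta2 s') d 1"
  shows "w' = w + d"
proof -
  obtain j where "\<alpha> = delta a ^ j" "\<forall>i<j. \<not> armijo P a w (eta1 s') (eta2 s') d (delta a ^ i)" "w' = w + \<alpha> *\<^sub>R d"
    using step by (auto simp: aotd_step_def)
  moreover have "j = 0" using calculation(2) assms(2) by (metis gr0I power_0)
  ultimately show ?thesis by simp
qed

lemma aotd_run_tol: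
  fixes P :: "('x::finite, 'u::finite) ocp" and w :: "nat \<Rightarrow> ('n::finite, 'x, 'u) pd"
  assumes run: "aotd_run P a s0 W w s d \<alpha>"
  shows "accurate P a (W \<tau>) (w \<tau>) (acc_tol (s \<tau>)) (d \<tau>)"
    "descent P (w \<tau>) (eta1 (s \<tau>)) (eta2 (s \<tau>)) (d \<tau>)"
    "tol_capped P a (W \<tau>) (w \<tau>) (s \<tau>)" "tol_descends (s \<tau>) (s (Suc \<tau>))"
proof -
  have a: "valid_params CARD('n) a" using run by (simp add: aotd_run_def)
  have step: "aotd_step P a (W \<tau>) (w \<tau>) (if \<tau> = 0 then s0 else s (\<tau> - 1)) (s \<tau>) (d \<tau>) (\<alpha> \<tau>) (w (Suc \<tau>))" for \<tau>
    using run by (simp add: aotd_run_def)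
  have "0 < eta1 s0" "0 < eta2 s0" using run by (auto simp: aotd_run_def valid_init_def)
  then have cap: "tol_capped P a (W \<tau>) (w \<tau>) (s \<tau>)" for \<tau>
  proof (induction \<tau>)
    case 0
    then show ?case using aotd_step_tol(3)[OF step[of 0] a] by simp
  next
    case (Suc \<tau>)
    then have "0 < eta1 (s \<tau>)" "0 < eta2 (s \<tau>)" by (simp_all add: tol_capped_def)
    then show ?case using aotd_step_tol(3)[OF step[of "Suc \<tau>"] a] by simp
  qed
  have pos: "0 < eta1 (if \<tau> = 0 then s0 else s (\<tau> - 1))" "0 < eta2 (if \<tau> = 0 then s0 else s (\<tau> - 1))" for \<tau>
    using cap[of "\<tau> - 1"] \<open>0 < eta1 s0\<close> \<open>0 < eta2 s0\<close> by (simp_all add: tol_capped_def)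
  show "accurate P a (W \<tau>) (w \<tau>) (acc_tol (s \<tau>)) (d \<tau>)"
    "descent P (w \<tau>) (eta1 (s \<tau>)) (eta2 (s \<tau>)) (d \<tau>)"
    by (rule aotd_step_tol(1)[OF step[of \<tau>] a pos[of \<tau>]] aotd_step_tol(2)[OF step[of \<tau>] a pos[of \<tau>]])+
  show "tol_capped P a (W \<tau>) (w \<tau>) (s \<tau>)" by (rule cap)
  show "tol_descends (s \<tau>) (s (Suc \<tau>))" using aotd_step_tol(4)[OF step[of "Suc \<tau>"] a pos[of "Suc \<tau>"]] by simp
qed

lemma frozen_tol_imp_frozen_merit:
  assumes run: "aotd_run P a s0 W w s d \<alpha>"
    and frozen: "\<forall>\<tau>\<ge>\<tau>b. acc_tol (s \<tau>) = acc_tol (s \<tau>b)" and "0 < acc_tol (s \<tau>b)" and "\<tau>b \<le> \<tau>"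
  shows "eta1 (s \<tau>) = eta1 (s \<tau>b) \<and> eta2 (s \<tau>) = eta2 (s \<tau>b)"
  using \<open>\<tau>b \<le> \<tau>\<close>
proof (induction \<tau> rule: dec_induct)
  case (step \<tau>)
  have "acc_tol (s (Suc \<tau>)) = acc_tol (s \<tau>b)" "acc_tol (s \<tau>) = acc_tol (s \<tau>b)"
    using frozen step.hyps by (metis le_SucI)+
  with aotd_run_tol(4)[OF run, of \<tau>] \<open>0 < acc_tol (s \<tau>b)\<close> step.IH show ?case
    by (simp add: tol_descends_def)
qed simp

text \<open>The squared denominator of the cap has room to spare: from
  \<open>\<Psi> \<ge> 20\<close> and \<open>Ups \<ge> 1\<close> its square factor is at least
  \<open>4 * \<Psi>\<close>, and \<open>\<Psi> * (1 + \<eta>1 + \<eta>2)\<close> dominates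
  \<open>\<Psi> + \<eta>1 + \<eta>2\<close>. This gives the cap condition of
  \<open>unit_step_armijo\<close>.\<close>

lemma eps_max_cap:
  fixes w :: "('n::finite, 'x::finite, 'u::finite) pd"
  assumes cap: "\<epsilon> \<le> eps_max P a W w \<eta>1 \<eta>2" and "0 \<le> \<epsilon>" "0 < \<eta>1" "0 < \<eta>2" and Psi: "20 \<le> Psi P a W w"
  shows "\<epsilon> * (Psi P a W w + (\<eta>1 + \<eta>2)) \<le> (1/2 - beta a) * \<eta>2 / 4"
proof -
  let ?\<Psi> = "Psi P a W w" and ?U = "Ups P W w" and ?\<eta> = "1 + \<eta>1 + \<eta>2"
  have U: "1 \<le> ?U" by (simp add: Ups_def)
  have "1 * 1 \<le> ?U * ?U" using U by (intro mult_mono) auto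
  have P2: "4 * ?\<Psi> \<le> (?\<Psi> * ?U)\<^sup>2"
  proof -
    have "4 * ?\<Psi> \<le> ?\<Psi> * ?\<Psi>" using Psi by (intro mult_right_mono) auto
    also have "\<dots> \<le> (?\<Psi> * ?\<Psi>) * (?U * ?U)" using mult_left_mono[OF \<open>1 * 1 \<le> ?U * ?U\<close>, of "?\<Psi> * ?\<Psi>"] Psi by simp
    finally show ?thesis by (simp add: power2_eq_square mult_ac)
  qed
  have "0 < (?\<Psi> * ?U)\<^sup>2" using P2 Psi by linarith
  then have pos: "0 < ?\<eta> * (?\<Psi> * ?U)\<^sup>2" using assms by simp
  have "?\<Psi> + (\<eta>1 + \<eta>2) \<le> ?\<Psi> * ?\<eta>"
    using Psi assms mult_right_mono[of 1 ?\<Psi> "\<eta>1 + \<eta>2"] by (simp add: algebra_simps)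
  then have "4 * (?\<Psi> + (\<eta>1 + \<eta>2)) \<le> (4 * ?\<Psi>) * ?\<eta>" by simp
  also have "\<dots> \<le> (?\<Psi> * ?U)\<^sup>2 * ?\<eta>" using P2 assms by (intro mult_right_mono) auto
  finally have "\<epsilon> * (4 * (?\<Psi> + (\<eta>1 + \<eta>2))) \<le> \<epsilon> * (?\<eta> * (?\<Psi> * ?U)\<^sup>2)"
    using \<open>0 \<le> \<epsilon>\<close> by (simp add: mult_left_mono mult.commute)
  also have "\<dots> \<le> (1/2 - beta a) * \<eta>2" using cap pos by (simp add: eps_max_def pos_le_divide_eq)
  finally show ?thesis by (simp add: algebra_simps)
qed

section \<open>Linear convergence of the iterates\<close>

theorem theorem2:
  fixes P :: "('x::finite, 'u::finite) ocp"
    and a :: params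
    and s0 :: adapt
    and W :: "nat \<Rightarrow> ('x, 'u) hmod"
    and w :: "nat \<Rightarrow> ('n::finite, 'x, 'u) pd"
    and s :: "nat \<Rightarrow> adapt"
    and d :: "nat \<Rightarrow> ('n, 'x, 'u) pd"
    and \<alpha> :: "nat \<Rightarrow> real"
    and ws :: "('n, 'x, 'u) pd"
    and \<gamma>C \<Upsilon> \<phi> :: real
    and tC \<tau>b :: nat
  assumes run: "aotd_run P a s0 W w s d \<alpha>"
    and "reduced_hessian_lower_bound P (gam a) W w"
    and "uniform_controllability P \<gamma>C tC w"
    and "uniform_boundedness P \<Upsilon> W w"
    and "compactness_smoothness P \<Upsilon> w d"
    and "vanishing_modification P W w"
    and "local_lipschitz_at P ws"
    and mu: "mu a \<ge> 32 * \<Upsilon> ^ (4 * tC + 1) / \<gamma>C"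
    and limit: "w \<longlonglongrightarrow> ws" "kkt_pair P ws" "strict_local_min P (fst ws)"
    and frozen: "\<forall>\<tau>\<ge>\<tau>b. acc_tol (s \<tau>) = acc_tol (s \<tau>b)"
    and eps01: "0 < acc_tol (s \<tau>b)" "acc_tol (s \<tau>b) < 1"
    and phi: "0 < \<phi>" "\<phi> < 1 / acc_tol (s \<tau>b) - 1"
  shows "(1 + \<phi>) * acc_tol (s \<tau>b) < 1 \<and>
    (\<forall>\<^sub>F \<tau> in sequentially.
      norm (w (Suc \<tau>) - ws) \<le> (1 + \<phi>) * acc_tol (s \<tau>b) * norm (w \<tau> - ws))"
proof -
  have C3: "\<forall>k<CARD('n). C3 (stage_cost P k) \<and> C3 (dynamics P k)" "C3 (term_cost P)"
    using assms(5) unfolding compactness_smoothness_def by blast+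
  have a: "0 < gam a" "beta a < 1/2"
    using run by (auto simp: aotd_run_def valid_params_def)
  define \<epsilon> where "\<epsilon> = acc_tol (s \<tau>b)"
  define \<eta>1 where "\<eta>1 = eta1 (s \<tau>b)"
  define \<eta>2 where "\<eta>2 = eta2 (s \<tau>b)"
  have \<epsilon>: "0 < \<epsilon>" "\<epsilon> < 1" using eps01 by (simp_all add: \<epsilon>_def)
  have \<eta>: "0 < \<eta>1" "0 < \<eta>2"
    using aotd_run_tol(3)[OF run, of \<tau>b] by (simp_all add: tol_capped_def \<eta>1_def \<eta>2_def)
  have merit_frozen: "eta1 (s \<tau>) = \<eta>1" "eta2 (s \<tau>) = \<eta>2" "acc_tol (s \<tau>) = \<epsilon>" if "\<tau>b \<le> \<tau>" for \<tau>
    using frozen_tol_imp_frozen_merit[OF run frozen eps01(1) that] frozen[rule_format, OF that]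
    by (auto simp: \<eta>1_def \<eta>2_def \<epsilon>_def)
  note linG = linear_jac_G[OF C3] and linH = linear_hess[OF C3]
  let ?hs = "hess P ws" and ?Gs = "jac_G P ws" and ?K = "kkt_exact P ws"

  have lim: "(\<lambda>n. f (w n)) \<longlonglongrightarrow> f ws" if "continuous_on UNIV f" for f :: "('n, 'x, 'u) pd \<Rightarrow> 'c::topological_space"
    using continuous_on_tendsto_compose[OF that limit(1)] by simp
  have hess: "op_tendsto (\<lambda>n. hess P (w n)) ?hs"
    by (rule op_tendsto_pointwise[OF linH linH lim[OF continuous_hess[OF C3]]])
  have adjG: "op_tendsto (\<lambda>n. adjoint (jac_G P (w n))) (adjoint ?Gs)"
    by (rule op_tendsto_pointwise[OF adjoint_linear[OF linG] adjoint_linear[OF linG]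
          lim[OF continuous_adjoint_jac_G[OF C3]]])
  have hat: "op_tendsto (\<lambda>n. hat_hess (W n)) ?hs"
  proof (rule op_tendsto_trans[OF hess], unfold op_tendsto_def, intro allI impI)
    fix c :: real assume "0 < c"
    have "\<forall>\<^sub>F n in sequentially. onorm (\<lambda>v. hess P (w n) v - hat_hess (W n) v) < c"
      using assms(6) \<open>0 < c\<close> unfolding vanishing_modification_def by (rule order_tendstoD)
    then show "\<forall>\<^sub>F n in sequentially. \<forall>v. norm (hat_hess (W n) v - hess P (w n) v - 0) \<le> c * norm v"
    proof eventually_elim
      case (elim n)
      \<comment> \<open>Bounded linearity of the difference is what turns smallness of
        \<open>onorm\<close> into an estimate on vectors.\<close>
      have bl: "bounded_linear (\<lambda>v. hess P (w n) v - hat_hess (W n) v)"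
        by (rule linear_conv_bounded_linear[THEN iffD1, OF linear_compose_sub[OF linH linear_hat_hess]])
      show ?case
      proof
        fix v
        show "norm (hat_hess (W n) v - hess P (w n) v - 0) \<le> c * norm v"
          using onorm[OF bl, of v] mult_right_mono[OF less_imp_le[OF elim], of "norm v"]
          by (simp add: norm_minus_commute)
      qed
    qed
  qed
  have exact: "op_tendsto (\<lambda>n. kkt_exact P (w n)) ?K"
  proof (rule op_tendsto_pointwise)
    show "linear (kkt_exact P y)" for y :: "('n, 'x, 'u) pd"
      unfolding kkt_exact_def[abs_def] by (rule linear_saddle[OF linH linG])
    then show "linear ?K" .
    show "(\<lambda>n. kkt_exact P (w n) v) \<longlonglongrightarrow> ?K v" for v
      unfolding kkt_exact_def
      by (intro tendsto_Pair tendsto_add tendsto_op_tendsto[OF hess] tendsto_op_tendsto[OF adjG]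
          lim[OF continuous_jac_G[OF C3]])
  qed
  have lin_kkt: "linear (kkt_mat P V y)" for V and y :: "('n, 'x, 'u) pd"
    unfolding kkt_mat_def[abs_def] by (rule linear_saddle[OF linear_hat_hess linG])
  have kkt: "op_tendsto (\<lambda>n. kkt_mat P (W n) (w n)) ?K"
  proof (rule op_tendsto_pointwise[OF lin_kkt])
    show "linear ?K" unfolding kkt_exact_def[abs_def] by (rule linear_saddle[OF linH linG])
    show "(\<lambda>n. kkt_mat P (W n) (w n) v) \<longlonglongrightarrow> ?K v" for v
      unfolding kkt_mat_def kkt_exact_def
      by (intro tendsto_Pair tendsto_add tendsto_op_tendsto[OF hat] tendsto_op_tendsto[OF adjG]
          lim[OF continuous_jac_G[OF C3]])
  qed

  text \<open>Symmetry of the limiting Hessian is inherited from that of the modified Hessians.\<close>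
  have hs_sym: "?hs y \<bullet> z = y \<bullet> ?hs z" for y z
  proof -
    have "(\<lambda>n. hat_hess (W n) y \<bullet> z) \<longlonglongrightarrow> ?hs y \<bullet> z" "(\<lambda>n. y \<bullet> hat_hess (W n) z) \<longlonglongrightarrow> y \<bullet> ?hs z"
      by (intro tendsto_inner tendsto_const tendsto_op_tendsto[OF hat])+
    moreover have "hat_hess (W n) y \<bullet> z = y \<bullet> hat_hess (W n) z" for n
      using run unfolding aotd_run_def by (blast intro: hat_hess_symmetric)
    ultimately show ?thesis using LIMSEQ_unique by simp
  qed
  have K_sym: "?K u \<bullet> v = u \<bullet> ?K v" for u v
  proof -
    have "?K u \<bullet> v = (?hs (fst u) \<bullet> fst v + adjoint ?Gs (snd u) \<bullet> fst v) + ?Gs (fst u) \<bullet> snd v"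
      by (cases v) (simp only: kkt_exact_def inner_Pair fst_conv snd_conv inner_add_left)
    moreover have "u \<bullet> ?K v = (fst u \<bullet> ?hs (fst v) + fst u \<bullet> adjoint ?Gs (snd v)) + snd u \<bullet> ?Gs (fst v)"
      by (cases u) (simp only: kkt_exact_def inner_Pair fst_conv snd_conv inner_add_right)
    ultimately show ?thesis by (simp only: hs_sym adjoint_clauses[OF linG] add_ac)
  qed

  \<comment> \<open>The adjoint of the surjective limiting Jacobian is injective, hence bounded
    below. Half of \<open>c0\<close> survives near the limit, which bounds the least singular values
    along the tail.\<close>
  obtain c0 where c0: "0 < c0" "\<And>y. c0 * norm y \<le> norm (adjoint ?Gs y)"
    using linear_inj_bounded_below_pos[OF adjoint_linear[OF linG[of ws]]] surj_jac_G[OF C3, of ws]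
      inj_adjoint_iff_surj[OF linG[of ws]] by blast
  define c where "c = min (c0 / 2) 1"
  have c: "0 < c" "c \<le> 1" "c \<le> c0 / 2" using c0 by (auto simp: c_def)
  have blhs: "bounded_linear ?hs" using linH by (rule linear_conv_bounded_linear[THEN iffD1])
  \<comment> \<open>The modified Hessians are eventually within distance 1 of the limiting one, so
    \<open>h\<close> bounds their norms.\<close>
  define h where "h = onorm ?hs + 1"
  have h: "1 \<le> h" using onorm_pos_le[OF blhs] by (simp add: h_def)
  have "c0 / 2 > 0" using c0(1) by simp
  then have "\<forall>\<^sub>F n in sequentially. \<tau>b \<le> n \<and>
      (\<forall>v. norm (hat_hess (W n) v - ?hs v) \<le> 1 * norm v) \<and>
      (\<forall>y. norm (adjoint (jac_G P (w n)) y - adjoint ?Gs y) \<le> c0 / 2 * norm y)"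
    by (intro eventually_conj eventually_ge_at_top hat[unfolded op_tendsto_def, rule_format]
        adjG[unfolded op_tendsto_def, rule_format]) simp_all
  then obtain n0 where n0: "\<And>n. n0 \<le> n \<Longrightarrow> \<tau>b \<le> n"
    "\<And>n v. n0 \<le> n \<Longrightarrow> norm (hat_hess (W n) v - ?hs v) \<le> 1 * norm v"
    "\<And>n y. n0 \<le> n \<Longrightarrow> norm (adjoint (jac_G P (w n)) y - adjoint ?Gs y) \<le> c0 / 2 * norm y"
    unfolding eventually_sequentially by blast

  \<comment> \<open>Past \<open>n0\<close> the parameters are frozen and the bounds on Hessian and
    Jacobian hold, so the shifted sequences satisfy the hypotheses of the abstract lemmas for every
    index.\<close>
  define wn where "wn n = w (n + n0)" for n
  define dn where "dn n = d (n + n0)" for n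
  define Wn where "Wn n = W (n + n0)" for n
  define N where "N n = onorm (kkt_mat P (Wn n) (wn n))" for n
  define \<Psi> where "\<Psi> n = Psi P a (Wn n) (wn n)" for n
  define C where "C = 20 * h\<^sup>2 / (min (gam a) 1 * c\<^sup>2)"
  let ?g = "grad_lagr P" and ?\<Gamma> = "\<lambda>n. kkt_mat P (Wn n) (wn n)" and ?D = "merit_weight \<eta>1 \<eta>2"
  have shift: "op_tendsto (\<lambda>n. T (n + n0)) T'" if "op_tendsto T T'" for T :: "nat \<Rightarrow> 'c::real_normed_vector \<Rightarrow> 'd::real_normed_vector" and T'
    unfolding op_tendsto_def
  proof (intro allI impI)
    fix c :: real assume "0 < c"
    with that have "\<forall>\<^sub>F n in sequentially. \<forall>v. norm (T n v - T' v) \<le> c * norm v"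
      unfolding op_tendsto_def by simp
    then show "\<forall>\<^sub>F n in sequentially. \<forall>v. norm (T (n + n0) v - T' v) \<le> c * norm v"
      by (rule sequentially_offset)
  qed
  have wn: "wn \<longlonglongrightarrow> ws" unfolding wn_def using limit(1) by (rule LIMSEQ_ignore_initial_segment)
  have \<Gamma>: "op_tendsto ?\<Gamma> ?K" and K': "op_tendsto (\<lambda>n. kkt_exact P (wn n)) ?K"
    using shift[OF kkt] shift[OF exact] by (simp_all add: wn_def Wn_def)
  have \<sigma>: "c \<le> sigma_min (jac_G P (wn n))" for n
  proof (rule sigma_min_ge[OF linG])
    fix y :: "('n, 'x) dual"
    have "norm (adjoint ?Gs y) \<le> norm (adjoint (jac_G P (wn n)) y) + norm (adjoint (jac_G P (wn n)) y - adjoint ?Gs y)"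
      using norm_triangle_ineq4[of "adjoint (jac_G P (wn n)) y" "adjoint (jac_G P (wn n)) y - adjoint ?Gs y"] by simp
    then have "c0 / 2 * norm y \<le> norm (adjoint (jac_G P (wn n)) y)"
      using c0(2)[of y] n0(3)[of "n + n0" y] by (simp add: wn_def)
    then show "c * norm y \<le> norm (adjoint (jac_G P (wn n)) y)"
      using mult_right_mono[OF c(3), of "norm y"] by simp
  qed
  then have \<sigma>0: "0 < sigma_min (jac_G P (wn n))" for n using c(1) by (rule less_le_trans[rotated])
  have \<Psi>20: "20 \<le> \<Psi> n" for n unfolding \<Psi>_def by (rule Psi_ge[OF \<sigma>0 a(1)])
  then have \<Psi>0: "0 < \<Psi> n" for n by (rule less_le_trans[rotated]) simp
  have \<Psi>C: "\<Psi> n \<le> C" for n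
    unfolding \<Psi>_def C_def
  proof (rule Psi_le[OF c(1,2) \<sigma> a(1) h], rule onorm_le)
    fix v
    have "norm (hat_hess (Wn n) v) \<le> norm (?hs v) + norm (hat_hess (Wn n) v - ?hs v)"
      by (rule norm_triangle_sub)
    also have "\<dots> \<le> onorm ?hs * norm v + 1 * norm v"
      using n0(2)[of "n + n0" v] by (intro add_mono onorm[OF blhs]) (simp_all add: Wn_def)
    finally show "norm (hat_hess (Wn n) v) \<le> h * norm v" by (simp add: h_def algebra_simps)
  qed
  have lower: "norm v \<le> \<Psi> n * norm (?\<Gamma> n v)" for n v
    unfolding \<Psi>_def
  proof (rule kkt_mat_lower_bound[OF linG \<sigma>0 a(1)])
    show "reduced_ge (hat_hess (Wn n)) (jac_G P (wn n)) (gam a)"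
      using assms(2) by (simp add: reduced_hessian_lower_bound_def Wn_def wn_def)
  qed
  have bl_kkt: "bounded_linear (?\<Gamma> n)" for n
    using lin_kkt by (rule linear_conv_bounded_linear[THEN iffD1])
  have upper: "norm (?\<Gamma> n v) \<le> N n * norm v" for n v unfolding N_def by (rule onorm[OF bl_kkt])
  \<comment> \<open>Chaining the lower and upper bounds on a unit vector shows that the condition
    estimate is at least 1.\<close>
  have NP: "1 \<le> N n * \<Psi> n" for n
  proof -
    obtain b :: "('n, 'x, 'u) pd" where "b \<in> Basis" using nonempty_Basis by blast
    then have "norm b = 1" by (rule norm_Basis)
    have "norm b \<le> \<Psi> n * (N n * norm b)"
      using lower[of b n] mult_left_mono[OF upper[of n b], of "\<Psi> n"] \<Psi>0[of n] by linarith
    then show ?thesis using \<open>norm b = 1\<close> by (simp add: mult.commute)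
  qed
  have N: "0 < N n" for n
    using NP[of n] \<Psi>0[of n] by (metis less_le_trans zero_less_mult_pos2 zero_less_one)
  have frozen': "eta1 (s (n + n0)) = \<eta>1" "eta2 (s (n + n0)) = \<eta>2" "acc_tol (s (n + n0)) = \<epsilon>" for n
    using merit_frozen[OF n0(1), of "n + n0"] by simp_all
  have res: "norm (?\<Gamma> n (dn n) + ?g (wn n)) \<le> \<epsilon> * norm (?g (wn n)) / (N n * \<Psi> n)" for n
    using aotd_run_tol(1)[OF run, of "n + n0"]
    by (simp add: accurate_def residual_def frozen' wn_def dn_def Wn_def N_def \<Psi>_def)
  have g0: "?g ws = 0" using limit(2) by (simp add: kkt_pair_def)

  define slope where "slope n = grad (merit P \<eta>1 \<eta>2) (wn n) \<bullet> dn n" for n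
  have "\<forall>\<^sub>F n in sequentially. merit P \<eta>1 \<eta>2 (wn n + dn n) \<le> merit P \<eta>1 \<eta>2 (wn n) + beta a * slope n"
  proof (rule unit_step_armijo[OF lagr_derivative[OF C3] grad_lagr_derivative[OF C3] g0 wn
        bounded_linear_merit_weight merit_weight_sym _ _ merit_eq K_sym \<Gamma> K' lin_kkt upper N lower
        \<Psi>0 \<Psi>C NP res \<epsilon> _ _ a(2) \<eta>(2)])
    show "norm (?D v) \<le> (\<eta>1 + \<eta>2) * norm v" for v :: "('n, 'x, 'u) pd"
      using \<eta> by (intro norm_merit_weight) auto
    show "0 \<le> \<eta>1 + \<eta>2" using \<eta> by simp
    show "slope n = ?g (wn n) \<bullet> dn n + ?D (?g (wn n)) \<bullet> kkt_exact P (wn n) (dn n)" for n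
      unfolding slope_def by (rule grad_merit_inner[OF C3])
    show "slope n \<le> - \<eta>2 * (norm (?g (wn n)))\<^sup>2 / 2" for n
      using aotd_run_tol(2)[OF run, of "n + n0"] by (simp add: descent_def frozen' slope_def wn_def dn_def)
    show "\<epsilon> * (\<Psi> n + (\<eta>1 + \<eta>2)) \<le> (1/2 - beta a) * \<eta>2 / 4" for n
      unfolding \<Psi>_def
    proof (rule eps_max_cap[OF _ _ \<eta>])
      show "\<epsilon> \<le> eps_max P a (Wn n) (wn n) \<eta>1 \<eta>2"
        using aotd_run_tol(3)[OF run, of "n + n0"] by (simp add: tol_capped_def frozen' wn_def Wn_def)
    qed (use \<epsilon> \<Psi>20[of n] in \<open>simp_all add: \<Psi>_def\<close>)
  qed
  then have unit: "\<forall>\<^sub>F n in sequentially. w (Suc (n + n0)) = wn n + dn n"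
  proof eventually_elim
    case (elim n)
    have "aotd_step P a (W (n + n0)) (w (n + n0)) (if n + n0 = 0 then s0 else s (n + n0 - 1))
        (s (n + n0)) (d (n + n0)) (\<alpha> (n + n0)) (w (Suc (n + n0)))"
      using run unfolding aotd_run_def by blast
    from aotd_step_unit[OF this] show ?case
      using elim by (simp add: armijo_def frozen' slope_def wn_def dn_def)
  qed

  have e0: "(\<lambda>n. wn n - ws) \<longlonglongrightarrow> 0" using wn by (simp add: LIM_zero)
  have "(\<lambda>n. norm (?g (wn n) - ?K (wn n - ws))) \<in> o(\<lambda>n. norm (wn n - ws))"
    using second_order_expansion(1)[OF lagr_derivative[OF C3] grad_lagr_derivative[OF C3] g0 e0] by simp
  from norm_diff_smallo[OF this op_tendsto_smallo[OF \<Gamma>, of "\<lambda>n. wn n - ws"]]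
  have model: "(\<lambda>n. norm (?g (wn n) - ?\<Gamma> n (wn n - ws))) \<in> o(\<lambda>n. norm (wn n - ws))" by simp
  \<comment> \<open>The slack \<open>\<phi> * \<epsilon>\<close> turns the contraction factor
    \<open>\<epsilon> + c\<close> into \<open>(1 + \<phi>) * \<epsilon>\<close>.\<close>
  have "0 < \<phi> * \<epsilon>" using phi \<epsilon> by simp
  from newton_step_contraction[OF lin_kkt upper N lower \<Psi>0 \<Psi>C NP model res \<epsilon> this] unit
  have "\<forall>\<^sub>F n in sequentially. norm (w (Suc (n + n0)) - ws) \<le> (1 + \<phi>) * \<epsilon> * norm (w (n + n0) - ws)"
    by eventually_elim (simp add: wn_def algebra_simps)
  then have "\<forall>\<^sub>F \<tau> in sequentially. norm (w (Suc \<tau>) - ws) \<le> (1 + \<phi>) * \<epsilon> * norm (w \<tau> - ws)"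
    by (rule eventually_sequentially_seg[THEN iffD1])
  moreover have "(1 + \<phi>) * \<epsilon> < 1" using phi(2) \<epsilon>(1) by (simp add: \<epsilon>_def[symmetric] field_simps)
  ultimately show ?thesis by (simp add: \<epsilon>_def)
qed

end
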